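(* For every $q\ge 2$ and $\varepsilon>0$, there are integers $\sigma$ and $\delta$ such that if an algorithm solves in time $(q-\varepsilon)^p\cdot n^{\mathcal{O}(1)}$ every $n$-vertex instance of List Edge Deletion to $q$-Coloring that is given with a $(\sigma,\delta)$-hub of size $p$, then the SETH fails.
   Context: For a graph $G$, a set $Q\subseteq V(G)$ is a $(\sigma,\delta)$-hub if every connected component of $G-Q$ has at most $\sigma$ vertices and is adjacent to at most $\delta$ vertices of $Q$. List Edge Deletion to $q$-Coloring: given a graph $G$ and lists $L:V(G)\to 2^{\{1,\dots,q\}}$, find a minimum-size set $X$ of edges such that $G\setminus X$ has a proper coloring $\phi$ with $\phi(v)\in L(v)$ for all $v$. SETH: there is no $\epsilon>0$ such that for every $k$, every $n$-variable $k$-SAT instance can be solved in time $(2-\epsilon)^n n^{\mathcal{O}(1)}$. *)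

theory Defs
  imports Complex_Main "HOL-Library.Log_Nat"
begin

section \<open>Machine model\<close>

text \<open>
  Running times refer to a random access machine with logarithmic cost, presented as a structured
  language. The memory is split into banks; \<open>Get b e\<close> is the content of cell \<open>e\<close> of
  bank \<open>b\<close> (indirect addressing). The bank is a constant of the program, so a program uses
  finitely many banks, and interleaving them in one memory changes its running time by a constant
  factor only.
\<close>

type_synonym memory = "nat \<Rightarrow> nat \<Rightarrow> nat"

datatype expr =
    Const nat
  | Get nat expr
  | Add expr expr
  | Sub expr expr
  | Mul expr expr
  | Div expr expr

datatype program =
    Skip
  | Store nat expr expr
  | Seq program program
  | Cond expr program program
  | Loop expr program

text \<open>\<open>Sub\<close> is truncated at zero, and division by zero yields zero.\<close>

fun eval :: "expr \<Rightarrow> memory \<Rightarrow> nat" where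
  "eval (Const k) s = k"
| "eval (Get b e) s = s b (eval e s)"
| "eval (Add e f) s = eval e s + eval f s"
| "eval (Sub e f) s = eval e s - eval f s"
| "eval (Mul e f) s = eval e s * eval f s"
| "eval (Div e f) s = eval e s div eval f s"

definition word_cost :: "nat \<Rightarrow> nat" where
  "word_cost k = 1 + floorlog 2 k"

text \<open>
  Every node of an expression is charged the bit length of its value; in particular operands,
  results and addresses are all charged. Without such charges, repeated addition or multiplication
  would produce exponentially long numbers at unit cost per operation.
\<close>

fun expr_cost :: "expr \<Rightarrow> memory \<Rightarrow> nat" where
  "expr_cost (Const k) s = word_cost k"
| "expr_cost (Get b e) s = expr_cost e s + word_cost (eval (Get b e) s)"
| "expr_cost (Add e f) s = expr_cost e s + expr_cost f s + word_cost (eval (Add e f) s)"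
| "expr_cost (Sub e f) s = expr_cost e s + expr_cost f s + word_cost (eval (Sub e f) s)"
| "expr_cost (Mul e f) s = expr_cost e s + expr_cost f s + word_cost (eval (Mul e f) s)"
| "expr_cost (Div e f) s = expr_cost e s + expr_cost f s + word_cost (eval (Div e f) s)"

text \<open>
  \<open>exec P s t s'\<close>: started in \<open>s\<close>, the program \<open>P\<close> halts in \<open>s'\<close> after time \<open>t\<close>.
  Conditions count as true if they are nonzero.
\<close>

inductive exec :: "program \<Rightarrow> memory \<Rightarrow> nat \<Rightarrow> memory \<Rightarrow> bool" where
  Skip: "exec Skip s 1 s"
| Store: "exec (Store b e f) s (1 + expr_cost e s + expr_cost f s)
            (s(b := (s b)(eval e s := eval f s)))"
| Seq: "exec P s t s' \<Longrightarrow> exec R s' t' s'' \<Longrightarrow> exec (Seq P R) s (t + t') s''"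
| CondTrue: "eval e s \<noteq> 0 \<Longrightarrow> exec P s t s' \<Longrightarrow> exec (Cond e P R) s (expr_cost e s + t) s'"
| CondFalse: "eval e s = 0 \<Longrightarrow> exec R s t s' \<Longrightarrow> exec (Cond e P R) s (expr_cost e s + t) s'"
| LoopFalse: "eval e s = 0 \<Longrightarrow> exec (Loop e P) s (expr_cost e s) s"
| LoopTrue: "eval e s \<noteq> 0 \<Longrightarrow> exec P s t s' \<Longrightarrow> exec (Loop e P) s' t' s'' \<Longrightarrow>
            exec (Loop e P) s (expr_cost e s + t + t') s''"

inductive_cases exec_SkipE: "exec Skip s t s'"
inductive_cases exec_StoreE: "exec (Store b e f) s t s'"
inductive_cases exec_SeqE: "exec (Seq P R) s t s'"
inductive_cases exec_CondE: "exec (Cond e P R) s t s'"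
inductive_cases exec_LoopE: "exec (Loop e P) s t s'"

lemma exec_deterministic:
  "exec P s t s' \<Longrightarrow> exec P s u s'' \<Longrightarrow> u = t \<and> s'' = s'"
proof (induction arbitrary: u s'' rule: exec.induct)
  case (Skip s)
  then show ?case by (rule exec_SkipE) simp
next
  case (Store b e f s)
  then show ?case by (rule exec_StoreE) simp
next
  case (Seq P s t s' R t' s1)
  from Seq.prems obtain v w r where "exec P s v r" "exec R r w s''" "u = v + w"
    by (rule exec_SeqE)
  with Seq.IH show ?case by metis
next
  case (CondTrue e s P t s' R)
  from CondTrue.prems obtain v where "exec P s v s''" "u = expr_cost e s + v"
    by (rule exec_CondE) (use CondTrue.hyps(1) in auto)
  with CondTrue.IH show ?case by metis
next
  case (CondFalse e s R t s' P)
  from CondFalse.prems obtain v where "exec R s v s''" "u = expr_cost e s + v"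
    by (rule exec_CondE) (use CondFalse.hyps(1) in auto)
  with CondFalse.IH show ?case by metis
next
  case (LoopFalse e s P)
  from LoopFalse.prems show ?case by (rule exec_LoopE) (use LoopFalse.hyps in simp_all)
next
  case (LoopTrue e s P t s' t' s1)
  from LoopTrue.prems obtain v w r where
    "exec P s v r" "exec (Loop e P) r w s''" "u = expr_cost e s + v + w"
    by (rule exec_LoopE) (use LoopTrue.hyps(1) in auto)
  with LoopTrue.IH show ?case by metis
qed

text \<open>
  Inputs and outputs are lists of natural numbers. They are held in bank 0, with the length in
  cell 0 and the entries in the following cells; all remaining memory is initially zero.
\<close>

definition input_memory :: "nat list \<Rightarrow> memory" where
  "input_memory xs = (\<lambda>b i. if b = 0 \<and> i \<le> length xs then (length xs # xs) ! i else 0)"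

definition output_of :: "memory \<Rightarrow> nat list" where
  "output_of s = map (s 0) [1..<Suc (s 0 0)]"

definition computes :: "program \<Rightarrow> nat list \<Rightarrow> nat \<Rightarrow> nat list \<Rightarrow> bool" where
  "computes P xs t ys \<longleftrightarrow> (\<exists>s. exec P (input_memory xs) t s \<and> output_of s = ys)"


section \<open>Satisfiability and the SETH\<close>

text \<open>The literal \<open>(x, b)\<close> is true iff the variable \<open>x\<close> has the value \<open>b\<close>.\<close>

type_synonym literal = "nat \<times> bool"
type_synonym clause = "literal list"

text \<open>
  The clauses of a formula are distinct, so that the length of an instance is polynomial in the
  number \<open>n\<close> of variables for every fixed \<open>k\<close>.
\<close>

definition kCNF :: "nat \<Rightarrow> nat \<Rightarrow> clause list \<Rightarrow> bool" where
  "kCNF k n F \<longleftrightarrow> distinct F \<and> (\<forall>C \<in> set F. length C \<le> k \<and> (\<forall>(x, b) \<in> set C. x < n))"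

definition satisfiable :: "clause list \<Rightarrow> bool" where
  "satisfiable F \<longleftrightarrow> (\<exists>\<alpha> :: nat \<Rightarrow> bool. \<forall>C \<in> set F. \<exists>(x, b) \<in> set C. \<alpha> x = b)"

definition encode_clause :: "clause \<Rightarrow> nat list" where
  "encode_clause C = length C # concat (map (\<lambda>(x, b). [x, of_bool b]) C)"

definition encode_CNF :: "nat \<Rightarrow> clause list \<Rightarrow> nat list" where
  "encode_CNF n F = [n, length F] @ concat (map encode_clause F)"

text \<open>
  Here and below, the factor \<open>n\<^bsup>O(1)\<^esup>\<close> is rendered as \<open>K * (n + 1) ^ d\<close>, which
  also makes sense for \<open>n = 0\<close>.
\<close>

definition solves_kSAT :: "program \<Rightarrow> nat \<Rightarrow> real \<Rightarrow> bool" where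
  "solves_kSAT P k base \<longleftrightarrow>
    (\<exists>K d :: nat. \<forall>n F. kCNF k n F \<longrightarrow>
      (\<exists>t. computes P (encode_CNF n F) t [of_bool (satisfiable F)] \<and>
           real t \<le> base ^ n * (real K * real (n + 1) ^ d)))"

definition SETH :: bool where
  "SETH \<longleftrightarrow> \<not> (\<exists>\<epsilon> > 0. \<forall>k. \<exists>P. solves_kSAT P k (2 - \<epsilon>))"


section \<open>Graphs, hubs and List Edge Deletion to \<open>q\<close>-Coloring\<close>

definition simple_graph :: "'v set \<Rightarrow> 'v set set \<Rightarrow> bool" where
  "simple_graph V E \<longleftrightarrow> finite V \<and> (\<forall>e \<in> E. e \<subseteq> V \<and> card e = 2)"

text \<open>
  The connected components, as vertex sets, of the subgraph induced by \<open>U\<close>; edges of \<open>E\<close>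
  that leave \<open>U\<close> are ignored.
\<close>

definition components :: "'v set \<Rightarrow> 'v set set \<Rightarrow> 'v set set" where
  "components U E =
    U // {(u, v). u \<in> U \<and> v \<in> U \<and> (u, v) \<in> {(x, y). x \<in> U \<and> y \<in> U \<and> {x, y} \<in> E}\<^sup>*}"

definition hub :: "nat \<Rightarrow> nat \<Rightarrow> 'v set \<Rightarrow> 'v set set \<Rightarrow> 'v set \<Rightarrow> bool" where
  "hub \<sigma> \<delta> V E Q \<longleftrightarrow> Q \<subseteq> V \<and>
    (\<forall>C \<in> components (V - Q) E.
      card C \<le> \<sigma> \<and> card {v \<in> Q. \<exists>u \<in> C. {u, v} \<in> E} \<le> \<delta>)"

definition list_coloring :: "'v set \<Rightarrow> 'v set set \<Rightarrow> ('v \<Rightarrow> nat set) \<Rightarrow> ('v \<Rightarrow> nat) \<Rightarrow> bool" where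
  "list_coloring V E L \<phi> \<longleftrightarrow>
    (\<forall>v \<in> V. \<phi> v \<in> L v) \<and> (\<forall>u v. {u, v} \<in> E \<longrightarrow> \<phi> u \<noteq> \<phi> v)"

definition deletion_set :: "'v set \<Rightarrow> 'v set set \<Rightarrow> ('v \<Rightarrow> nat set) \<Rightarrow> 'v set set \<Rightarrow> bool" where
  "deletion_set V E L X \<longleftrightarrow> X \<subseteq> E \<and> (\<exists>\<phi>. list_coloring V (E - X) L \<phi>)"

definition min_deletion_set :: "'v set \<Rightarrow> 'v set set \<Rightarrow> ('v \<Rightarrow> nat set) \<Rightarrow> 'v set set \<Rightarrow> bool" where
  "min_deletion_set V E L X \<longleftrightarrow>
    deletion_set V E L X \<and> (\<forall>Y. deletion_set V E L Y \<longrightarrow> card X \<le> card Y)"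

text \<open>\<open>es\<close> lists every edge of \<open>E\<close> exactly once, in one of its two orientations.\<close>

definition edge_listing :: "('v \<times> 'v) list \<Rightarrow> 'v set set \<Rightarrow> bool" where
  "edge_listing es E \<longleftrightarrow>
    distinct (map (\<lambda>(u, v). {u, v}) es) \<and> set (map (\<lambda>(u, v). {u, v}) es) = E"

definition encode_edges :: "(nat \<times> nat) list \<Rightarrow> nat list" where
  "encode_edges es = concat (map (\<lambda>(u, v). [u, v]) es)"

text \<open>
  The vertices are \<open>0, \<dots>, n - 1\<close>, each list \<open>L v\<close> is written as a bit vector of length
  \<open>q\<close>, and the hub is part of the input.
\<close>

definition encode_instance ::
    "nat \<Rightarrow> nat \<Rightarrow> (nat \<times> nat) list \<Rightarrow> (nat \<Rightarrow> nat set) \<Rightarrow> nat list \<Rightarrow> nat list" where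
  "encode_instance q n es L hs =
    [n, length es] @ encode_edges es
    @ concat (map (\<lambda>v. map (\<lambda>c. of_bool (c \<in> L v)) [1..<Suc q]) [0..<n])
    @ [length hs] @ hs"

text \<open>
  If some vertex has an empty list, no deletion set exists; the program must then still halt within
  the time bound, but its output is arbitrary.
\<close>

definition solves_LED :: "program \<Rightarrow> nat \<Rightarrow> nat \<Rightarrow> nat \<Rightarrow> real \<Rightarrow> bool" where
  "solves_LED P q \<sigma> \<delta> base \<longleftrightarrow>
    (\<exists>K d :: nat. \<forall>n E es L Q hs.
      simple_graph {..<n} E \<and> edge_listing es E \<and> (\<forall>v < n. L v \<subseteq> {1..q}) \<and>
      hub \<sigma> \<delta> {..<n} E Q \<and> distinct hs \<and> set hs = Q \<longrightarrow>
      (\<exists>t ys. computes P (encode_instance q n es L hs) t ys \<and>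
         real t \<le> base ^ card Q * (real K * real (n + 1) ^ d) \<and>
         ((\<exists>X. deletion_set {..<n} E L X) \<longrightarrow>
          (\<exists>X xs. min_deletion_set {..<n} E L X \<and> edge_listing xs X \<and> ys = encode_edges xs))))"

end

theory Submission
  imports Defs
begin

text \<open>
  The quantifiers allow a classical argument: if the SETH holds, then for a suitable \<open>\<gamma> < 2\<close> there
  is a \<open>k\<close> such that no program solves \<open>k\<close>-SAT in time \<open>\<gamma>\<^sup>n n\<^bsup>O(1)\<^esup>\<close>, and the constants
  \<open>\<sigma>\<close> and \<open>\<delta>\<close> may depend on this \<open>k\<close>.

  Choose \<open>s\<close> and \<open>t\<close> with \<open>(q - \<epsilon>)\<^sup>s < 2\<^sup>t \<le> q\<^sup>s\<close>, so that \<open>t\<close> Boolean variables can be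
  encoded by the colours of \<open>s\<close> hub vertices. For every clause and every colouring of the hub
  vertices of its blocks that falsifies it, a gadget of constant size charges one extra deletion
  exactly for this colouring. The formula is satisfiable iff no gadget charges the extra deletion,
  and since the hub has about \<open>s n / t\<close> vertices, the assumed algorithm decides this in time
  \<open>(q - \<epsilon>)\<^bsup>sn/t\<^esup> n\<^bsup>O(1)\<^esup>\<close>, where \<open>(q - \<epsilon>)\<^bsup>s/t\<^esup> < 2\<close>.

  The reduction is a program of the machine model. It is written in a language of bounded loops
  whose programs run in polynomial time by construction, so that only their functional behaviour
  has to be analysed.
\<close>


section \<open>Edge deletion gadgets\<close>

text \<open>Only the size of a minimum deletion set is used, and it adds up over all gadgets. So a
  gadget must cost the same for every colouring that misses its forbidden tuple, in however many
  slots it does so: it has to compute an OR whose gain is capped at one. A clique of vertices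
  coloured 1 or 2 provides the cap. Its cost is quadratic in the number of slots that report a miss,
  which makes one report profitable, while a second one costs more than it saves. The rounding of
  \<open>log\<close> of \<open>q ^ s\<close> to an integer \<open>t\<close> loses less than a factor
  2 in \<open>2 ^ t\<close> against \<open>q ^ s\<close>, so \<open>s\<close> is taken large enough
  for the ratio of \<open>q ^ s\<close> to \<open>(q - \<epsilon>) ^ s\<close> to absorb this
  factor. A gadget with \<open>r\<close> slots has \<open>4 * r\<close> vertices and at most
  \<open>r\<close> neighbours in the hub, whence \<open>\<sigma> = 4 * r\<close> and
  \<open>\<delta> = r\<close>. In the machine model the obstacle is growth: iterating a polynomial
  bound on the memory contents a variable number of times does not stay polynomial. The loop
  language therefore separates the growth per command, controlled by parameters that never change,
  from the size of the memory contents.\<close>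

fun blocks :: "nat \<Rightarrow> (nat \<Rightarrow> 'a \<Rightarrow> 'b list) \<Rightarrow> nat \<Rightarrow> 'a list \<Rightarrow> 'b list" where
  "blocks N f b [] = []"
| "blocks N f b (x # xs) = f b x @ blocks N f (b + N) xs"

lemma blocks_append:
  "blocks N f b (xs @ ys) = blocks N f b xs @ blocks N f (b + length xs * N) ys"
  by (induction xs arbitrary: b) (auto simp: algebra_simps)

lemma blocks_conv_concat:
  "blocks N f b xs = concat (map (\<lambda>g. f (b + g * N) (xs ! g)) [0..<length xs])"
proof (induction xs arbitrary: b)
  case (Cons x xs)
  show ?case
    by (simp add: Cons.IH upt_conv_Cons map_Suc_upt[symmetric] o_def algebra_simps del: upt_Suc)
qed simp

section \<open>Deletion sets as monochromatic edges\<close>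

definition conflicts :: "('v \<Rightarrow> nat) \<Rightarrow> ('v \<times> 'v) list \<Rightarrow> nat" where
  "conflicts \<phi> es = (\<Sum>(u, v)\<leftarrow>es. of_bool (\<phi> u = \<phi> v))"

lemma conflicts_append [simp]: "conflicts \<phi> (es @ fs) = conflicts \<phi> es + conflicts \<phi> fs"
  and conflicts_Nil [simp]: "conflicts \<phi> [] = 0"
  by (simp_all add: conflicts_def)

lemma conflicts_map_upt:
  "conflicts \<phi> (map (\<lambda>i. (f i, g i)) [0..<n]) = (\<Sum>i<n. of_bool (\<phi> (f i) = \<phi> (g i)))"
  by (induction n) (simp_all add: conflicts_def)

lemma conflicts_concat_upt:
  "conflicts \<phi> (concat (map f [0..<n])) = (\<Sum>i<n. conflicts \<phi> (f i))"
  by (induction n) simp_all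

lemma conflicts_eq_card:
  assumes "distinct (map (\<lambda>(u, v). {u, v}) es)"
  shows "conflicts \<phi> es = card {e. \<exists>(u, v) \<in> set es. e = {u, v} \<and> \<phi> u = \<phi> v}"
  using assms
proof (induction es)
  case (Cons e es)
  obtain u v where e: "e = (u, v)" by force
  let ?S = "{e. \<exists>(u, v) \<in> set es. e = {u, v} \<and> \<phi> u = \<phi> v}"
  have fin: "finite ?S"
    by (rule finite_subset[of _ "set (map (\<lambda>(u, v). {u, v}) es)"]) auto
  have "{u, v} \<notin> ?S" using Cons.prems e by force
  moreover have "{e'. \<exists>(u, v) \<in> set (e # es). e' = {u, v} \<and> \<phi> u = \<phi> v} =
      (if \<phi> u = \<phi> v then insert {u, v} ?S else ?S)"
    using e by auto
  moreover have "conflicts \<phi> (e # es) = of_bool (\<phi> u = \<phi> v) + conflicts \<phi> es"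
    by (simp add: e conflicts_def)
  ultimately show ?case using Cons fin by simp
qed (simp add: conflicts_def)

text \<open>An edge that survives the deletion cannot be monochromatic, so all monochromatic edges
  lie in \<open>X\<close>. Together with \<open>deletion_set_of_conflicts\<close>, minimising
  deletions becomes minimising monochromatic edges over colourings from the lists.\<close>

lemma conflicts_le_deletion_set:
  assumes es: "edge_listing es E" and X: "X \<subseteq> E" "list_coloring V (E - X) L \<phi>"
  shows "conflicts \<phi> es \<le> card X"
proof -
  have E: "E = set (map (\<lambda>(u, v). {u, v}) es)" using es by (simp add: edge_listing_def)
  have "finite X" using X(1) E by (auto intro: finite_subset)
  moreover have "{e. \<exists>(u, v) \<in> set es. e = {u, v} \<and> \<phi> u = \<phi> v} \<subseteq> X"
    using X(2) unfolding E list_coloring_def by (fastforce simp: image_iff)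
  ultimately show ?thesis
    using es by (simp add: conflicts_eq_card edge_listing_def card_mono)
qed

lemma deletion_set_of_conflicts:
  assumes es: "edge_listing es E" and L: "\<forall>v \<in> V. \<phi> v \<in> L v"
  shows "\<exists>X. deletion_set V E L X \<and> card X = conflicts \<phi> es"
proof (intro exI conjI)
  let ?X = "{e. \<exists>(u, v) \<in> set es. e = {u, v} \<and> \<phi> u = \<phi> v}"
  have E: "E = set (map (\<lambda>(u, v). {u, v}) es)" using es by (simp add: edge_listing_def)
  have "\<phi> u \<noteq> \<phi> v" if "{u, v} \<in> E - ?X" for u v
  proof
    assume eq: "\<phi> u = \<phi> v"
    have "{u, v} \<in> (\<lambda>(u, v). {u, v}) ` set es" using that by (simp add: E)
    then obtain a b where ab: "(a, b) \<in> set es" "{u, v} = {a, b}"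
      by (elim imageE) (simp add: case_prod_unfold, metis prod.collapse)
    then have "\<phi> a = \<phi> b" using eq by (auto simp: doubleton_eq_iff)
    with ab have "{u, v} \<in> ?X" by blast
    with that show False by blast
  qed
  then have "list_coloring V (E - ?X) L \<phi>" using L by (auto simp: list_coloring_def)
  moreover have "?X \<subseteq> E" unfolding E by auto
  ultimately show "deletion_set V E L ?X" by (auto simp: deletion_set_def)
  show "card ?X = conflicts \<phi> es"
    using es by (simp add: conflicts_eq_card edge_listing_def)
qed

section \<open>Cost of a single gadget\<close>

definition clique_edges :: "nat \<Rightarrow> nat \<Rightarrow> (nat \<times> nat) list" where
  "clique_edges n b = concat (map (\<lambda>j. map (\<lambda>i. (b + i, b + j)) [0..<j]) [0..<n])"

text \<open>Classes of sizes A and B contain A(A-1)/2 + B(B-1)/2 monochromatic pairs. Doubling and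
  adding n = A + B leaves plain squares, without division or subtraction.\<close>

lemma conflicts_clique:
  assumes "\<forall>i<n. \<phi> (b + i) \<in> {1, 2}"
  shows "2 * conflicts \<phi> (clique_edges n b) + n =
    (\<Sum>i<n. of_bool (\<phi> (b + i) = 1))\<^sup>2 + (\<Sum>i<n. of_bool (\<phi> (b + i) = 2))\<^sup>2"
  using assms
proof (induction n)
  case (Suc n)
  have "conflicts \<phi> (clique_edges (Suc n) b) =
      conflicts \<phi> (clique_edges n b) + (\<Sum>i<n. of_bool (\<phi> (b + i) = \<phi> (b + n)))"
    by (simp add: clique_edges_def conflicts_map_upt)
  moreover have "\<phi> (b + n) = 1 \<or> \<phi> (b + n) = 2" using Suc.prems by auto
  ultimately show ?case using Suc by (auto simp: power2_eq_square algebra_simps)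
qed (simp add: clique_edges_def)

text \<open>
  A gadget has \<open>r\<close> slots; slot \<open>i\<close> consists of a hub vertex \<open>h\<close> and a target colour \<open>a\<close>. The
  offsets are \<open>z\<^sub>i = i\<close>, followed by \<open>r - 1\<close> vertices of the fixed colour 1 (and an isolated vertex),
  \<open>y\<^sub>i = 2r + i\<close> and \<open>m\<^sub>i = 3r + i\<close>. If \<open>h\<close> has colour \<open>a\<close>, then \<open>y\<^sub>i\<close> is forced to the colour 1,
  through \<open>m\<^sub>i\<close> or, for \<open>a = 2\<close>, by a direct edge. If \<open>Z\<close> of the \<open>z\<^sub>i\<close> have colour 1, the
  clique costs \<open>(r - 1)\<^sup>2 + Z (Z - 1)\<close>, and slot \<open>i\<close> costs \<open>1 - [z\<^sub>i = 1]\<close> if \<open>y\<^sub>i\<close> is free to have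
  colour 2. Hence the optimum \<open>r (r - 1)\<close> is attained at \<open>Z = 1\<close>, and only if some hub vertex
  avoids its target.
\<close>

definition gadget_size :: "nat \<Rightarrow> nat" where
  "gadget_size r = 4 * r"

definition attachment :: "nat \<Rightarrow> nat \<Rightarrow> nat \<Rightarrow> nat" where
  "attachment r a i = (if a = 2 then 2 * r + i else 3 * r + i)"

definition gadget_edges :: "nat \<Rightarrow> nat \<Rightarrow> (nat \<times> nat) list \<Rightarrow> (nat \<times> nat) list" where
  "gadget_edges r b sl = clique_edges (2 * r - 1) b
    @ map (\<lambda>i. (b + i, b + (2 * r + i))) [0..<r]
    @ map (\<lambda>i. (b + r, b + (2 * r + i))) [0..<r]
    @ map (\<lambda>i. (b + (2 * r + i), b + (3 * r + i))) [0..<r]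
    @ map (\<lambda>i. (fst (sl ! i), b + attachment r (snd (sl ! i)) i)) [0..<r]"

text \<open>For the target 2 the vertex \<open>m\<^sub>i\<close> has no neighbour in the hub; the
  colour 1 in its list lets it avoid \<open>y\<^sub>i\<close> when that has colour 2.\<close>

definition gadget_list :: "nat \<Rightarrow> (nat \<times> nat) list \<Rightarrow> nat \<Rightarrow> nat set" where
  "gadget_list r sl i =
    (if i < r then {1, 2} else if i < 2 * r then {1} else if i < 3 * r then {1, 2}
     else {2, if snd (sl ! (i - 3 * r)) = 2 then 1 else snd (sl ! (i - 3 * r))})"

text \<open>The colour classes of the clique have sizes \<open>Z + (r - 1)\<close> and
  \<open>r - Z\<close>, which gives the quadratic part. \<open>D i\<close> collects the four edges
  of slot \<open>i\<close> outside the clique. Integers make the later differences safe.\<close>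

lemma gadget_conflicts_eq:
  fixes \<phi> :: "nat \<Rightarrow> nat"
  assumes r: "r \<ge> 2" and L: "\<forall>i < gadget_size r. \<phi> (b + i) \<in> gadget_list r sl i"
  defines "Z \<equiv> (\<Sum>i<r. of_bool (\<phi> (b + i) = 1) :: int)"
  defines "D \<equiv> (\<lambda>i. of_bool (\<phi> (b + i) = \<phi> (b + (2 * r + i)))
       + of_bool (\<phi> (b + (2 * r + i)) = 1)
       + of_bool (\<phi> (b + (2 * r + i)) = \<phi> (b + (3 * r + i)))
       + of_bool (\<phi> (fst (sl ! i)) = \<phi> (b + attachment r (snd (sl ! i)) i)) :: int)"
  shows "int (conflicts \<phi> (gadget_edges r b sl)) = (int r - 1)\<^sup>2 + Z * Z - Z + (\<Sum>i<r. D i)"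
proof -
  let ?n = "2 * r - 1"
  have low: "\<phi> (b + i) \<in> {1, 2}" if "i < r" for i
    using L[rule_format, of i] that by (simp add: gadget_size_def gadget_list_def)
  have one: "\<phi> (b + i) = 1" if "r \<le> i" "i < ?n" for i
  proof -
    have "i < 2 * r" using that by linarith
    then show ?thesis using L[rule_format, of i] that by (simp add: gadget_size_def gadget_list_def)
  qed
  have "\<forall>i < ?n. \<phi> (b + i) \<in> {1, 2}"
    using low one by (metis insertI1 not_le)
  then have cl: "2 * conflicts \<phi> (clique_edges ?n b) + ?n =
    (\<Sum>i<?n. of_bool (\<phi> (b + i) = 1))\<^sup>2 + (\<Sum>i<?n. of_bool (\<phi> (b + i) = 2))\<^sup>2"
    by (rule conflicts_clique)
  have split: "{..<?n} = {..<r} \<union> {r..<?n}" using r by auto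
  have S: "int (\<Sum>i<?n. of_bool (\<phi> (b + i) = 1)) = Z + (int r - 1)"
    unfolding split by (subst sum.union_disjoint) (use r one in \<open>auto simp: Z_def of_nat_diff\<close>)
  have "int (\<Sum>i<?n. of_bool (\<phi> (b + i) = 2)) = int (\<Sum>i<r. of_bool (\<phi> (b + i) = 2))"
    unfolding split by (subst sum.union_disjoint) (use r one in auto)
  also have "\<dots> = (\<Sum>i<r. 1 - of_bool (\<phi> (b + i) = 1))"
    unfolding of_nat_sum by (rule sum.cong) (use low in force)+
  also have "\<dots> = int r - Z" by (simp add: sum_subtractf Z_def)
  finally have T: "int (\<Sum>i<?n. of_bool (\<phi> (b + i) = 2)) = int r - Z" .
  have "2 * int (conflicts \<phi> (clique_edges ?n b)) + (2 * int r - 1) =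
      (Z + (int r - 1))\<^sup>2 + (int r - Z)\<^sup>2"
    using arg_cong[OF cl, of int] r by (simp only: of_nat_add of_nat_mult of_nat_power S T)
  then have "2 * int (conflicts \<phi> (clique_edges ?n b)) = 2 * ((int r - 1)\<^sup>2 + Z * Z - Z)"
    by (simp add: power2_eq_square algebra_simps)
  moreover have "\<phi> (b + r) = 1" using one[of r] r by simp
  ultimately show ?thesis
    by (simp add: gadget_edges_def conflicts_map_upt D_def sum.distrib eq_commute[of "1::nat"] add.assoc
        eq_commute[of "Suc 0"])
qed

text \<open>On a hit every \<open>D i\<close> is at least 1 and \<open>Z * Z \<ge> Z\<close>, so the
  cost is at least \<open>(r - 1)^2 + r\<close>. Otherwise \<open>D i\<close> is at least 1 minus
  the indicator of \<open>z\<^sub>i = 1\<close>, and the cost is at least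
  \<open>(Z - 1)^2 + (r - 1)^2 + (r - 1)\<close>.\<close>

lemma gadget_conflicts_ge:
  fixes \<phi> :: "nat \<Rightarrow> nat"
  assumes r: "r \<ge> 2" and L: "\<forall>i < gadget_size r. \<phi> (b + i) \<in> gadget_list r sl i"
  shows "conflicts \<phi> (gadget_edges r b sl) \<ge> r * (r - 1)
      + of_bool (\<forall>i<r. \<phi> (fst (sl ! i)) = snd (sl ! i))"
proof -
  let ?hit = "\<forall>i<r. \<phi> (fst (sl ! i)) = snd (sl ! i)"
  define Z where "Z = (\<Sum>i<r. of_bool (\<phi> (b + i) = 1) :: int)"
  define D where "D = (\<lambda>i. of_bool (\<phi> (b + i) = \<phi> (b + (2 * r + i)))
       + of_bool (\<phi> (b + (2 * r + i)) = 1)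
       + of_bool (\<phi> (b + (2 * r + i)) = \<phi> (b + (3 * r + i)))
       + of_bool (\<phi> (fst (sl ! i)) = \<phi> (b + attachment r (snd (sl ! i)) i)) :: int)"
  have eq: "int (conflicts \<phi> (gadget_edges r b sl)) = (int r - 1)\<^sup>2 + Z * Z - Z + (\<Sum>i<r. D i)"
    unfolding Z_def D_def by (rule gadget_conflicts_eq[OF r L])
  have z: "\<phi> (b + i) \<in> {1, 2}" and y: "\<phi> (b + (2 * r + i)) \<in> {1, 2}"
    and m: "\<phi> (b + (3 * r + i)) \<in>
      {2, if snd (sl ! i) = 2 then 1 else snd (sl ! i)}" if "i < r" for i
    using L[rule_format, of i] L[rule_format, of "2 * r + i"]
      L[rule_format, of "3 * r + i"] that
    by (simp_all add: gadget_size_def gadget_list_def split: if_splits)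
  have D1: "D i \<ge> 1 - of_bool (\<phi> (b + i) = 1)" if "i < r" for i
    using z[OF that] y[OF that] by (auto simp: D_def)
  have D2: "D i \<ge> 1" if "i < r" ?hit for i
    using z[OF that(1)] y[OF that(1)] m[OF that(1)] that
    by (auto simp: D_def attachment_def split: if_splits)
  have *: "(int r - 1)\<^sup>2 + int r = int (r * (r - 1)) + 1"
    using r by (simp add: of_nat_diff power2_eq_square algebra_simps)
  show ?thesis
  proof (cases ?hit)
    case True
    have "(\<Sum>i<r. D i) \<ge> (\<Sum>i<r. 1)" by (rule sum_mono) (use D2 True in auto)
    moreover have "Z \<ge> 0" by (simp add: Z_def sum_nonneg)
    then have "Z * Z \<ge> Z" using mult_right_mono[of 1 Z Z] by (cases "Z = 0") simp_all
    ultimately have "int (conflicts \<phi> (gadget_edges r b sl)) \<ge> int (r * (r - 1) + 1)"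
      using eq * by simp
    then show ?thesis using True by (simp only: of_nat_le_iff) simp
  next
    case False
    have "(\<Sum>i<r. D i) \<ge> (\<Sum>i<r. 1 - of_bool (\<phi> (b + i) = 1))"
      by (rule sum_mono) (use D1 in auto)
    then have "(\<Sum>i<r. D i) \<ge> int r - Z" by (simp add: sum_subtractf Z_def)
    moreover have "(Z - 1) * (Z - 1) \<ge> 0" by simp
    ultimately have "int (conflicts \<phi> (gadget_edges r b sl)) \<ge> int (r * (r - 1))"
      using eq * by (simp add: algebra_simps)
    then have "conflicts \<phi> (gadget_edges r b sl) \<ge> r * (r - 1)" by (simp only: of_nat_le_iff)
    then show ?thesis using False by auto
  qed
qed

text \<open>
  The optimal extension sets \<open>z\<^sub>i = 1\<close> only for the first slot whose hub vertex avoids its target;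
  the \<open>LEAST\<close> is meaningful only if there is such a slot.
\<close>

definition gadget_coloring :: "nat \<Rightarrow> (nat \<Rightarrow> nat) \<Rightarrow> (nat \<times> nat) list \<Rightarrow> nat \<Rightarrow> nat" where
  "gadget_coloring r \<phi> sl i =
    (if i < r then (if i = (LEAST i. \<phi> (fst (sl ! i)) \<noteq> snd (sl ! i)) then 1 else 2)
     else if i < 2 * r then 1
     else if i < 3 * r then
       (case sl ! (i - 2 * r) of (h, a) \<Rightarrow> if \<phi> h = a then 1 else 2)
     else (case sl ! (i - 3 * r) of (h, a) \<Rightarrow>
       if \<phi> h = a then 2 else if a = 2 then 1 else a))"

lemma gadget_coloring_in_list: "gadget_coloring r \<phi> sl i \<in> gadget_list r sl i"
  by (auto simp: gadget_coloring_def gadget_list_def split: prod.splits)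

text \<open>Here \<open>Z = 1\<close>, and every slot except the reporting slot \<open>i0\<close>
  costs 1, so the total is \<open>(r - 1)^2 + (r - 1)\<close>. \<open>\<psi>\<close> is the given
  hub colouring and \<open>\<phi>\<close> its extension to the graph.\<close>

lemma gadget_conflicts_optimal:
  fixes \<phi> \<psi> :: "nat \<Rightarrow> nat"
  assumes r: "r \<ge> 2" and "i < r" "\<psi> (fst (sl ! i)) \<noteq> snd (sl ! i)"
    and agree: "\<forall>i<r. \<phi> (fst (sl ! i)) = \<psi> (fst (sl ! i))"
    and col: "\<forall>i < gadget_size r. \<phi> (b + i) = gadget_coloring r \<psi> sl i"
  shows "conflicts \<phi> (gadget_edges r b sl) = r * (r - 1)"
proof -
  define i0 where "i0 = (LEAST i. \<psi> (fst (sl ! i)) \<noteq> snd (sl ! i))"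
  have i0: "\<psi> (fst (sl ! i0)) \<noteq> snd (sl ! i0)" "i0 \<le> i"
    unfolding i0_def using LeastI[where P = "\<lambda>i. \<psi> (fst (sl ! i)) \<noteq> snd (sl ! i)", OF assms(3)]
      Least_le[where P = "\<lambda>i. \<psi> (fst (sl ! i)) \<noteq> snd (sl ! i)", OF assms(3)] by simp_all
  then have "i0 < r" using assms(2) by simp
  define Z where "Z = (\<Sum>i<r. of_bool (\<phi> (b + i) = 1) :: int)"
  define D where "D = (\<lambda>i. of_bool (\<phi> (b + i) = \<phi> (b + (2 * r + i)))
       + of_bool (\<phi> (b + (2 * r + i)) = 1)
       + of_bool (\<phi> (b + (2 * r + i)) = \<phi> (b + (3 * r + i)))
       + of_bool (\<phi> (fst (sl ! i)) = \<phi> (b + attachment r (snd (sl ! i)) i)) :: int)"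
  have eq: "int (conflicts \<phi> (gadget_edges r b sl)) = (int r - 1)\<^sup>2 + Z * Z - Z + (\<Sum>i<r. D i)"
    unfolding Z_def D_def
    by (rule gadget_conflicts_eq[OF r]) (metis col gadget_coloring_in_list)
  have z: "\<phi> (b + i) = (if i = i0 then 1 else 2)"
    and y: "\<phi> (b + (2 * r + i)) = (if \<psi> (fst (sl ! i)) = snd (sl ! i) then 1 else 2)"
    and m: "\<phi> (b + (3 * r + i)) = (if \<psi> (fst (sl ! i)) = snd (sl ! i) then 2
       else if snd (sl ! i) = 2 then 1 else snd (sl ! i))" if "i < r" for i
    using col[rule_format, of i] col[rule_format, of "2 * r + i"]
      col[rule_format, of "3 * r + i"] that
    by (simp_all add: gadget_size_def gadget_coloring_def i0_def case_prod_unfold)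
  have D: "D i = 1 - of_bool (i = i0)" if "i < r" for i
    using z[OF that] y[OF that] m[OF that] i0(1) agree[rule_format, OF that]
    by (cases "\<psi> (fst (sl ! i)) = snd (sl ! i)"; cases "i = i0") (simp_all add: D_def attachment_def)
  have Z: "Z = 1"
  proof -
    have "Z = (\<Sum>i<r. of_bool (i = i0))" unfolding Z_def by (rule sum.cong) (auto simp: z)
    also have "\<dots> = 1" using \<open>i0 < r\<close> by (simp add: of_bool_def)
    finally show ?thesis .
  qed
  have "(\<Sum>i<r. D i) = (\<Sum>i<r. 1 - of_bool (i = i0))" by (rule sum.cong) (auto simp: D)
  also have "\<dots> = int r - 1" using \<open>i0 < r\<close> by (simp add: sum_subtractf of_bool_def)
  finally have "int (conflicts \<phi> (gadget_edges r b sl)) = (int r - 1)\<^sup>2 + int r - 1"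
    using eq Z by simp
  also have "\<dots> = int (r * (r - 1))"
    using r by (simp add: of_nat_diff power2_eq_square algebra_simps)
  finally show ?thesis by (simp only: of_nat_eq_iff)
qed


section \<open>The graph assembled from all gadgets\<close>

definition instance_edges :: "nat \<Rightarrow> nat \<Rightarrow> (nat \<times> nat) list list \<Rightarrow> (nat \<times> nat) list" where
  "instance_edges r p gs = blocks (gadget_size r) (gadget_edges r) p gs"

definition instance_lists :: "nat \<Rightarrow> nat \<Rightarrow> nat \<Rightarrow> (nat \<times> nat) list list \<Rightarrow> nat \<Rightarrow> nat set" where
  "instance_lists q r p gs v = (if v < p then {1..q} else
     gadget_list r (gs ! ((v - p) div gadget_size r)) ((v - p) mod gadget_size r))"

definition edge_set :: "('v \<times> 'v) list \<Rightarrow> 'v set set" where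
  "edge_set es = set (map (\<lambda>(u, v). {u, v}) es)"

lemma clique_edges_set:
  "(u, v) \<in> set (clique_edges n b) \<longleftrightarrow> b \<le> u \<and> u < v \<and> v < b + n"
proof
  assume "b \<le> u \<and> u < v \<and> v < b + n"
  then have *: "v - b < n" "u - b < v - b" "(u, v) = (b + (u - b), b + (v - b))" by auto
  have "set (clique_edges n b) = (\<Union>j<n. (\<lambda>i. (b + i, b + j)) ` {..<j})"
    by (auto simp: clique_edges_def)
  then show "(u, v) \<in> set (clique_edges n b)" using * by blast
qed (auto simp: clique_edges_def)

lemma distinct_clique_edges: "distinct (clique_edges n b)"
proof (induction n)
  case (Suc n)
  have "clique_edges (Suc n) b = clique_edges n b @ map (\<lambda>i. (b + i, b + n)) [0..<n]"
    by (simp add: clique_edges_def)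
  then show ?case using Suc by (auto simp: clique_edges_set distinct_map inj_on_def)
qed (simp add: clique_edges_def)

lemma gadget_edgesD:
  assumes "(u, v) \<in> set (gadget_edges r b sl)" "r \<ge> 2" "\<forall>i<r. fst (sl ! i) < b"
  shows "b \<le> v" "v < b + gadget_size r" "u < v" "u < b \<Longrightarrow> u \<in> (\<lambda>i. fst (sl ! i)) ` {..<r}"
  using assms
  by (auto simp: gadget_edges_def clique_edges_set gadget_size_def attachment_def)

lemma distinct_gadget_edges:
  assumes r: "r \<ge> 2" and sl: "\<forall>i<r. fst (sl ! i) < b"
  shows "distinct (gadget_edges r b sl)"
proof -
  define A where "A = clique_edges (2 * r - 1) b"
  define B where "B = map (\<lambda>i. (b + i, b + (2 * r + i))) [0..<r]"
  define C where "C = map (\<lambda>i. (b + r, b + (2 * r + i))) [0..<r]"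
  define D where "D = map (\<lambda>i. (b + (2 * r + i), b + (3 * r + i))) [0..<r]"
  define E where "E = map (\<lambda>i. (fst (sl ! i), b + attachment r (snd (sl ! i)) i)) [0..<r]"
  have A: "b \<le> fst e \<and> snd e < b + 2 * r" if "e \<in> set A" for e
    using that clique_edges_set[of "fst e" "snd e" "2 * r - 1" b] unfolding A_def prod.collapse by linarith
  have B: "b \<le> fst e \<and> fst e < b + r \<and> snd e \<ge> b + 2 * r" if "e \<in> set B" for e
    using that by (auto simp: B_def)
  have C: "fst e = b + r \<and> snd e \<ge> b + 2 * r" if "e \<in> set C" for e
    using that by (auto simp: C_def)
  have D: "fst e \<ge> b + 2 * r \<and> snd e \<ge> b + 2 * r" if "e \<in> set D" for e
    using that by (auto simp: D_def)
  have E: "fst e < b" if "e \<in> set E" for e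
    using that sl by (auto simp: E_def)
  have "inj_on (\<lambda>i. (fst (sl ! i), b + attachment r (snd (sl ! i)) i)) {0..<r}"
    by (rule inj_onI) (auto simp: attachment_def split: if_splits)
  then have "distinct E" by (simp add: E_def distinct_map)
  moreover have "distinct B" "distinct C" "distinct D"
    by (simp_all add: B_def C_def D_def distinct_map inj_on_def)
  moreover have "distinct A" by (simp add: A_def distinct_clique_edges)
  moreover have "set A \<inter> set B = {}" "set A \<inter> set C = {}" "set A \<inter> set D = {}" "set A \<inter> set E = {}"
    using A B C D E by fastforce+
  moreover have "set B \<inter> set C = {}" "set B \<inter> set D = {}" "set B \<inter> set E = {}"
    using B C D E by fastforce+
  moreover have "set C \<inter> set D = {}" "set C \<inter> set E = {}" "set D \<inter> set E = {}"
    using r C D E by fastforce+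
  ultimately have "distinct (A @ B @ C @ D @ E)" by (simp add: Int_Un_distrib)
  then show ?thesis by (simp add: gadget_edges_def A_def B_def C_def D_def E_def)
qed

locale gadget_instance =
  fixes q r p :: nat and gs :: "(nat \<times> nat) list list"
  assumes q: "q \<ge> 2" and r: "r \<ge> 2"
    and slots: "\<And>sl i. sl \<in> set gs \<Longrightarrow> i < r \<Longrightarrow> fst (sl ! i) < p \<and> snd (sl ! i) \<in> {1..q}"
begin

abbreviation "N \<equiv> gadget_size r"
abbreviation "n \<equiv> p + length gs * N"
abbreviation "es \<equiv> instance_edges r p gs"
abbreviation "L \<equiv> instance_lists q r p gs"

lemma N_pos: "N > 0"
  using r by (simp add: gadget_size_def)

lemma slot_less: "g < length gs \<Longrightarrow> \<forall>i<r. fst (gs ! g ! i) < p + g * N"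
  using slots[OF nth_mem] by (meson trans_less_add1)

lemma instance_edges_conv:
  "es = concat (map (\<lambda>g. gadget_edges r (p + g * N) (gs ! g)) [0..<length gs])"
  by (simp add: instance_edges_def blocks_conv_concat)

lemma instance_edgesE:
  assumes "(u, v) \<in> set es"
  obtains g where "g < length gs" "(u, v) \<in> set (gadget_edges r (p + g * N) (gs ! g))"
    "p + g * N \<le> v" "v < p + g * N + N" "u < v"
    "u < p + g * N \<Longrightarrow> u \<in> (\<lambda>i. fst (gs ! g ! i)) ` {..<r}"
proof -
  obtain g where g: "g < length gs" "(u, v) \<in> set (gadget_edges r (p + g * N) (gs ! g))"
    using assms by (auto simp: instance_edges_conv)
  show thesis
    using that[OF g] gadget_edgesD[OF g(2) r slot_less[OF g(1)]] by blast
qed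

lemma block_le: "g < length gs \<Longrightarrow> p + g * N + N \<le> n"
  using mult_le_mono1[of "Suc g" "length gs" N] by simp

lemma distinct_instance_edges: "distinct es"
proof -
  have "distinct (concat (map (\<lambda>g. gadget_edges r (p + g * N) (gs ! g)) [0..<m]))"
    if "m \<le> length gs" for m
    using that
  proof (induction m)
    case (Suc m)
    have "set (gadget_edges r (p + g * N) (gs ! g)) \<inter>
        set (gadget_edges r (p + m * N) (gs ! m)) = {}" if "g < m" for g
    proof -
      have "p + g * N + N \<le> p + m * N" using that mult_le_mono1[of "Suc g" m N] by simp
      then show ?thesis
        using gadget_edgesD(1)[OF _ r slot_less, of _ _ m] gadget_edgesD(2)[OF _ r slot_less, of _ _ g]
          Suc.prems that by fastforce
    qed
    moreover have "distinct (gadget_edges r (p + m * N) (gs ! m))"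
      using Suc.prems r slot_less by (intro distinct_gadget_edges) auto
    ultimately show ?case using Suc by (auto simp: disjoint_iff)
  qed simp
  then show ?thesis by (simp add: instance_edges_conv)
qed

text \<open>Every listed pair is increasing, so distinct pairs are also distinct as unordered
  edges.\<close>

lemma edge_listing_instance: "edge_listing es (edge_set es)"
proof -
  have "inj_on (\<lambda>(u, v). {u, v}) (set es)"
  proof (rule inj_onI, clarify)
    fix a b c d assume "(a, b) \<in> set es" "(c, d) \<in> set es" "{a, b} = {c, d}"
    moreover from this have "a < b" "c < d" by (auto elim: instance_edgesE)
    ultimately show "a = c \<and> b = d" by (auto simp: doubleton_eq_iff)
  qed
  then show ?thesis
    by (simp add: edge_listing_def edge_set_def distinct_map distinct_instance_edges)
qed

lemma simple_graph_instance: "simple_graph {..<n} (edge_set es)"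
  unfolding simple_graph_def
proof (intro conjI ballI)
  fix e assume "e \<in> edge_set es"
  then obtain u v where e: "e = {u, v}" "(u, v) \<in> set es" by (auto simp: edge_set_def)
  from e(2) have "u < v" "v < n"
    by (auto elim!: instance_edgesE dest!: block_le)
  then show "e \<subseteq> {..<n}" "card e = 2" using e(1) by auto
qed simp

lemma block_index: "p + g * N \<le> v \<Longrightarrow> v < p + g * N + N \<Longrightarrow> (v - p) div N = g"
  by (rule div_nat_eqI) (auto simp: algebra_simps)

text \<open>Edges avoiding the hub stay inside one gadget, so a component lies in one block of
  \<open>N\<close> vertices and sees only the hub vertices of the \<open>r\<close> slots of that
  gadget.\<close>

lemma hub_instance: "hub N r {..<n} (edge_set es) {..<p}"
  unfolding hub_def
proof (intro conjI ballI)
  fix C assume "C \<in> components ({..<n} - {..<p}) (edge_set es)"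
  define U where "U = {..<n} - {..<p}"
  define R where "R = {(x, y). x \<in> U \<and> y \<in> U \<and> {x, y} \<in> edge_set es}"
  obtain x where C: "C = {(u, v). u \<in> U \<and> v \<in> U \<and> (u, v) \<in> R\<^sup>*} `` {x}"
    using \<open>C \<in> _\<close> unfolding components_def U_def[symmetric] R_def[symmetric] by (rule quotientE)
  define g where "g = (x - p) div N"
  \<comment> \<open>The block number is invariant along paths that avoid the hub.\<close>
  have inv: "(v - p) div N = g" if "(x, v) \<in> R\<^sup>*" for v
    using that
  proof (induction rule: rtrancl_induct)
    case (step y z)
    then have "y \<ge> p" "z \<ge> p" "{y, z} \<in> edge_set es" by (auto simp: R_def U_def)
    then obtain u v where uv: "{y, z} = {u, v}" "(u, v) \<in> set es" by (auto simp: edge_set_def)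
    from uv(2) show ?case
    proof (rule instance_edgesE)
      fix h assume h: "h < length gs" "p + h * N \<le> v" "v < p + h * N + N" "u < v"
        "u < p + h * N \<Longrightarrow> u \<in> (\<lambda>i. fst (gs ! h ! i)) ` {..<r}"
      have "u \<ge> p" using uv(1) \<open>y \<ge> p\<close> \<open>z \<ge> p\<close> by (auto simp: doubleton_eq_iff)
      then have "u \<ge> p + h * N" using h(5) slots[of "gs ! h"] h(1) by force
      then have "(u - p) div N = h" "(v - p) div N = h" using h by (auto intro!: block_index)
      then show ?thesis using uv(1) step.IH by (auto simp: doubleton_eq_iff)
    qed
  qed (simp add: g_def)
  have sub: "v \<ge> p \<and> v < n \<and> (v - p) div N = g" if "v \<in> C" for v
    using that inv by (auto simp: C U_def)
  have "C \<subseteq> {p + g * N..<p + g * N + N}"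
  proof
    fix v assume "v \<in> C"
    then have "p \<le> v" "(v - p) div N = g" using sub by auto
    then have "g * N \<le> v - p" "v - p < g * N + N"
      using div_times_less_eq_dividend[of "v - p" N] dividend_less_div_times[OF N_pos, of "v - p"] by auto
    then show "v \<in> {p + g * N..<p + g * N + N}" using \<open>p \<le> v\<close> by auto
  qed
  then show "card C \<le> N" using card_mono[of "{p + g * N..<p + g * N + N}" C] by simp
  have "{v \<in> {..<p}. \<exists>u\<in>C. {u, v} \<in> edge_set es} \<subseteq> (\<lambda>i. fst (gs ! g ! i)) ` {..<r}"
  proof
    fix v assume "v \<in> {v \<in> {..<p}. \<exists>u\<in>C. {u, v} \<in> edge_set es}"
    then obtain u where v: "v < p" and u: "u \<in> C" "{u, v} \<in> edge_set es" by auto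
    obtain a b where ab: "{u, v} = {a, b}" "(a, b) \<in> set es" using u(2) by (auto simp: edge_set_def)
    from ab(2) show "v \<in> (\<lambda>i. fst (gs ! g ! i)) ` {..<r}"
    proof (rule instance_edgesE)
      fix h assume h: "h < length gs" "p + h * N \<le> b" "b < p + h * N + N"
        "a < p + h * N \<Longrightarrow> a \<in> (\<lambda>i. fst (gs ! h ! i)) ` {..<r}"
      have "a = v" "b = u" using ab(1) h(2) v by (auto simp: doubleton_eq_iff)
      moreover from this have "h = g" using block_index[OF h(2,3)] sub[OF u(1)] by simp
      ultimately show ?thesis using h(4) v by simp
    qed
  qed
  then show "card {v \<in> {..<p}. \<exists>u\<in>C. {u, v} \<in> edge_set es} \<le> r"
    using surj_card_le[OF finite_lessThan[of r]] by simp
qed auto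

lemma lists_subset: "v < n \<Longrightarrow> L v \<subseteq> {1..q}"
proof -
  assume v: "v < n"
  show ?thesis
  proof (cases "v < p")
    case False
    define g where "g = (v - p) div N"
    define i where "i = (v - p) mod N"
    have g: "g < length gs" using v False N_pos by (simp add: g_def div_less_iff_less_mult)
    have "i < 4 * r" using N_pos by (simp add: i_def gadget_size_def)
    then have "snd (gs ! g ! (i - 3 * r)) \<in> {1..q}" if "3 * r \<le> i"
      using slots[of "gs ! g" "i - 3 * r"] g that by simp
    then show ?thesis
      using q False by (auto simp: instance_lists_def gadget_list_def g_def[symmetric] i_def[symmetric])
  qed (simp add: instance_lists_def)
qed

lemma lists_nonempty: "\<exists>c. c \<in> L v"
  using q by (auto simp: instance_lists_def gadget_list_def)

lemma conflicts_instance: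
  "conflicts \<phi> es = (\<Sum>g<length gs. conflicts \<phi> (gadget_edges r (p + g * N) (gs ! g)))"
  by (simp add: instance_edges_conv conflicts_concat_upt)

text \<open>The deletion algorithm promises a meaningful output only if a deletion set exists;
  nonempty lists guarantee one.\<close>

lemma ex_deletion_set: "\<exists>X. deletion_set {..<n} (edge_set es) L X"
  using deletion_set_of_conflicts[OF edge_listing_instance, of "{..<n}" "\<lambda>v. SOME c. c \<in> L v" L]
    lists_nonempty by (auto simp: some_in_eq intro: someI_ex)

text \<open>The gadget bounds add up since the gadgets share no edges. A single hit already pushes
  the total above the threshold, and a colouring without hits extends to every gadget at its optimum
  simultaneously.\<close>

lemma min_deletion_set_le_iff:
  assumes X: "min_deletion_set {..<n} (edge_set es) L X"
  shows "card X \<le> length gs * (r * (r - 1)) \<longleftrightarrow>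
    (\<exists>\<phi>. (\<forall>h<p. \<phi> h \<in> {1..q}) \<and> (\<forall>sl \<in> set gs. \<exists>i<r. \<phi> (fst (sl ! i)) \<noteq> snd (sl ! i)))"
    (is "?small \<longleftrightarrow> ?colorable")
proof
  assume ?small
  obtain \<phi> where X': "X \<subseteq> edge_set es" and \<phi>: "list_coloring {..<n} (edge_set es - X) L \<phi>"
    using X by (auto simp: min_deletion_set_def deletion_set_def)
  let ?c = "\<lambda>g. conflicts \<phi> (gadget_edges r (p + g * N) (gs ! g))"
  let ?hit = "\<lambda>g. \<forall>i<r. \<phi> (fst (gs ! g ! i)) = snd (gs ! g ! i)"
  have col: "\<phi> v \<in> L v" if "v < n" for v using \<phi> that by (auto simp: list_coloring_def)
  have ge: "?c g \<ge> r * (r - 1) + of_bool (?hit g)" if "g < length gs" for g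
  proof (rule gadget_conflicts_ge[OF r], intro allI impI)
    fix i assume "i < N"
    moreover have "(g * N + i) div N = g" "(g * N + i) mod N = i" using \<open>i < N\<close> by auto
    ultimately show "\<phi> (p + g * N + i) \<in> gadget_list r (gs ! g) i"
      using col[of "p + g * N + i"] block_le[OF that] by (simp add: instance_lists_def)
  qed
  have "\<not> ?hit g" if "g < length gs" for g
  proof
    assume "?hit g"
    then have "(\<Sum>g<length gs. r * (r - 1)) < (\<Sum>g<length gs. ?c g)"
      using that ge[OF that] ge
      by (intro sum_strict_mono_ex1) (auto intro!: bexI[of _ g] dest: add_leD1 simp: Suc_le_eq)
    then show False
      using conflicts_le_deletion_set[OF edge_listing_instance X' \<phi>] \<open>?small\<close>
      by (simp add: conflicts_instance)
  qed
  moreover have "\<phi> h \<in> {1..q}" if "h < p" for h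
    using col[of h] that by (simp add: instance_lists_def)
  ultimately show ?colorable by (metis in_set_conv_nth)
next
  assume ?colorable
  then obtain \<psi> where hub: "\<forall>h<p. \<psi> h \<in> {1..q}"
    and ok: "\<And>sl. sl \<in> set gs \<Longrightarrow> \<exists>i<r. \<psi> (fst (sl ! i)) \<noteq> snd (sl ! i)" by blast
  define \<phi> where "\<phi> v = (if v < p then \<psi> v else
      gadget_coloring r \<psi> (gs ! ((v - p) div N)) ((v - p) mod N))" for v
  have "\<forall>v \<in> {..<n}. \<phi> v \<in> L v"
    using hub gadget_coloring_in_list by (auto simp: \<phi>_def instance_lists_def)
  then obtain Y where Y: "deletion_set {..<n} (edge_set es) L Y" "card Y = conflicts \<phi> es"
    using deletion_set_of_conflicts[OF edge_listing_instance] by blast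
  have "conflicts \<phi> (gadget_edges r (p + g * N) (gs ! g)) = r * (r - 1)" if g: "g < length gs" for g
  proof -
    have agree: "\<forall>i<r. \<phi> (fst (gs ! g ! i)) = \<psi> (fst (gs ! g ! i))"
      using slots[of "gs ! g"] g by (simp add: \<phi>_def)
    obtain i where i: "i < r" "\<psi> (fst (gs ! g ! i)) \<noteq> snd (gs ! g ! i)" using ok[of "gs ! g"] g by auto
    have "\<phi> (p + g * N + j) = gadget_coloring r \<psi> (gs ! g) j" if "j < N" for j
    proof -
      have "(g * N + j) div N = g" "(g * N + j) mod N = j" using that by auto
      then show ?thesis by (simp add: \<phi>_def)
    qed
    then show ?thesis by (intro gadget_conflicts_optimal[OF r i agree]) blast
  qed
  then have "card Y = length gs * (r * (r - 1))" by (simp add: Y(2) conflicts_instance)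
  then show ?small using X Y(1) unfolding min_deletion_set_def by metis
qed

end


section \<open>A polynomial-time loop language\<close>

definition poly_bounded :: "(nat \<Rightarrow> nat) \<Rightarrow> bool" where
  "poly_bounded f \<longleftrightarrow> mono f \<and> (\<exists>K d. \<forall>n. f n \<le> K * (n + 1) ^ d)"

lemma poly_boundedI: "mono f \<Longrightarrow> (\<And>n. f n \<le> K * (n + 1) ^ d) \<Longrightarrow> poly_bounded f"
  by (auto simp: poly_bounded_def)

text \<open>Monotonicity belongs to \<open>poly_bounded\<close> because bounds are constantly
  evaluated at upper estimates of the actual numbers.\<close>

lemma poly_bounded_mono: "poly_bounded f \<Longrightarrow> m \<le> n \<Longrightarrow> f m \<le> f n"
  by (auto simp: poly_bounded_def mono_def)

lemma poly_bounded_const: "poly_bounded (\<lambda>_. c)"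
  by (rule poly_boundedI[of _ c 0]) (auto simp: mono_def)

lemma poly_bounded_id: "poly_bounded (\<lambda>n. n)"
  by (rule poly_boundedI[of _ 1 1]) (auto simp: mono_def)

lemma poly_bounded_add:
  assumes "poly_bounded f" "poly_bounded g"
  shows "poly_bounded (\<lambda>n. f n + g n)"
proof -
  obtain K d K' d' where f: "\<And>n. f n \<le> K * (n + 1) ^ d" and g: "\<And>n. g n \<le> K' * (n + 1) ^ d'"
    using assms unfolding poly_bounded_def by blast
  show ?thesis
  proof (rule poly_boundedI)
    fix n
    have "f n \<le> K * (n + 1) ^ (d + d')"
      using f[of n] by (rule order.trans) (intro mult_left_mono power_increasing; simp)
    moreover have "g n \<le> K' * (n + 1) ^ (d + d')"
      using g[of n] by (rule order.trans) (intro mult_left_mono power_increasing; simp)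
    ultimately show "f n + g n \<le> (K + K') * (n + 1) ^ (d + d')" by (simp add: algebra_simps)
  qed (use assms in \<open>auto simp: poly_bounded_def mono_def intro: add_mono\<close>)
qed

lemma poly_bounded_Suc: "poly_bounded f \<Longrightarrow> poly_bounded (\<lambda>n. Suc (f n))"
  using poly_bounded_add[OF _ poly_bounded_const[of 1]] by simp

lemma poly_bounded_mult:
  assumes "poly_bounded f" "poly_bounded g"
  shows "poly_bounded (\<lambda>n. f n * g n)"
proof -
  obtain K d K' d' where f: "\<And>n. f n \<le> K * (n + 1) ^ d" and g: "\<And>n. g n \<le> K' * (n + 1) ^ d'"
    using assms unfolding poly_bounded_def by blast
  show ?thesis
  proof (rule poly_boundedI)
    fix n
    show "f n * g n \<le> (K * K') * (n + 1) ^ (d + d')"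
      using mult_mono[OF f[of n] g[of n]] by (simp add: power_add algebra_simps)
  qed (use assms in \<open>auto simp: poly_bounded_def mono_def intro: mult_mono\<close>)
qed

lemma poly_bounded_compose:
  assumes "poly_bounded f" "poly_bounded g"
  shows "poly_bounded (\<lambda>n. f (g n))"
proof -
  obtain K d K' d' where f: "\<And>n. f n \<le> K * (n + 1) ^ d" and g: "\<And>n. g n \<le> K' * (n + 1) ^ d'"
    using assms unfolding poly_bounded_def by blast
  show ?thesis
  proof (rule poly_boundedI)
    fix n
    have "g n + 1 \<le> (K' + 1) * (n + 1) ^ d'" 
      using add_mono[OF g[of n] one_le_power[of "n + 1" d']] by (simp only: add_mult_distrib mult_1)
    then have "(g n + 1) ^ d \<le> ((K' + 1) * (n + 1) ^ d') ^ d" by (rule power_mono) simp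
    then have "K * (g n + 1) ^ d \<le> (K * (K' + 1) ^ d) * (n + 1) ^ (d' * d)"
      by (simp only: power_mult_distrib power_mult mult.assoc mult_le_mono2)
    with f[of "g n"] show "f (g n) \<le> (K * (K' + 1) ^ d) * (n + 1) ^ (d' * d)" by (rule order.trans)
  qed (use assms in \<open>auto simp: poly_bounded_def mono_def\<close>)
qed

lemma poly_bounded_power: "poly_bounded f \<Longrightarrow> poly_bounded (\<lambda>n. f n ^ d)"
  by (induction d) (simp_all add: poly_bounded_const poly_bounded_mult)

lemmas poly_bounded_intros = poly_bounded_const poly_bounded_id poly_bounded_add poly_bounded_Suc
  poly_bounded_mult poly_bounded_power

text \<open>Bounding a bit length by the value is crude but sufficient, since all values that are
  charged stay polynomial.\<close>

lemma word_cost_le: "word_cost k \<le> k + 1"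
  using floorlog_le_iff[of 2 k k] by (simp add: word_cost_def less_exp)

fun reads :: "expr \<Rightarrow> nat set" where
  "reads (Const k) = {}"
| "reads (Get b e) = insert b (reads e)"
| "reads (Add e f) = reads e \<union> reads f"
| "reads (Sub e f) = reads e \<union> reads f"
| "reads (Mul e f) = reads e \<union> reads f"
| "reads (Div e f) = reads e \<union> reads f"

lemma eval_cong: "(\<And>b. b \<in> reads e \<Longrightarrow> s b = s' b) \<Longrightarrow> eval e s = eval e s'"
  by (induction e) auto

lemma expr_cost_cong: "(\<And>b. b \<in> reads e \<Longrightarrow> s b = s' b) \<Longrightarrow> expr_cost e s = expr_cost e s'"
proof (induction e)
  case (Get b e)
  then show ?case using eval_cong[of e s s'] by auto
next
  case (Add e f)
  then show ?case using eval_cong[of e s s'] eval_cong[of f s s'] by auto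
next
  case (Sub e f)
  then show ?case using eval_cong[of e s s'] eval_cong[of f s s'] by auto
next
  case (Mul e f)
  then show ?case using eval_cong[of e s s'] eval_cong[of f s s'] by auto
next
  case (Div e f)
  then show ?case using eval_cong[of e s s'] eval_cong[of f s s'] by auto
qed simp

text \<open>The bound \<open>M\<close> is only required for the banks that are read. This is what
  later permits a bank of uncontrolled contents, as long as no expression reads it.\<close>

lemma expr_poly_bounded:
  "\<exists>h. poly_bounded h \<and> (\<forall>s M. (\<forall>b \<in> reads e. \<forall>i. s b i \<le> M) \<longrightarrow>
     eval e s \<le> h M \<and> expr_cost e s \<le> h M)"
proof (induction e)
  case (Const k)
  show ?case by (rule exI[of _ "\<lambda>_. k + 1"]) (use word_cost_le[of k] in \<open>auto intro: poly_bounded_const\<close>)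
next
  case (Get b e)
  then obtain h where h: "poly_bounded h"
    "\<And>s M. \<forall>b \<in> reads e. \<forall>i. s b i \<le> M \<Longrightarrow> eval e s \<le> h M \<and> expr_cost e s \<le> h M" by blast
  show ?case
  proof (intro exI[of _ "\<lambda>M. h M + (M + 1)"] conjI allI impI)
    fix s :: memory and M assume *: "\<forall>b \<in> reads (Get b e). \<forall>i. s b i \<le> M"
    then show "eval (Get b e) s \<le> h M + (M + 1)" by (simp add: trans_le_add2 le_SucI)
    show "expr_cost (Get b e) s \<le> h M + (M + 1)"
    proof -
      have "expr_cost e s \<le> h M" "s b (eval e s) \<le> M" using h(2)[of s M] * by auto
      then show ?thesis using word_cost_le[of "s b (eval e s)"] by simp
    qed
  qed (intro poly_bounded_intros h(1))
next
  case (Add e f)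
  then obtain h g where h: "poly_bounded h" "poly_bounded g"
    "\<And>s M. \<forall>b \<in> reads e. \<forall>i. s b i \<le> M \<Longrightarrow> eval e s \<le> h M \<and> expr_cost e s \<le> h M"
    "\<And>s M. \<forall>b \<in> reads f. \<forall>i. s b i \<le> M \<Longrightarrow> eval f s \<le> g M \<and> expr_cost f s \<le> g M" by blast
  show ?case
  proof (intro exI[of _ "\<lambda>M. h M + g M + (h M + g M + 1)"] conjI allI impI)
    fix s :: memory and M assume *: "\<forall>b \<in> reads (Add e f). \<forall>i. s b i \<le> M"
    then show "eval (Add e f) s \<le> h M + g M + (h M + g M + 1)"
      "expr_cost (Add e f) s \<le> h M + g M + (h M + g M + 1)"
      using h(3,4)[of s M] word_cost_le[of "eval (Add e f) s"] by auto
  qed (intro poly_bounded_intros h(1,2))+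
next
  case (Sub e f)
  then obtain h g where h: "poly_bounded h" "poly_bounded g"
    "\<And>s M. \<forall>b \<in> reads e. \<forall>i. s b i \<le> M \<Longrightarrow> eval e s \<le> h M \<and> expr_cost e s \<le> h M"
    "\<And>s M. \<forall>b \<in> reads f. \<forall>i. s b i \<le> M \<Longrightarrow> eval f s \<le> g M \<and> expr_cost f s \<le> g M" by blast
  show ?case
  proof (intro exI[of _ "\<lambda>M. h M + g M + (h M + 1)"] conjI allI impI)
    fix s :: memory and M assume *: "\<forall>b \<in> reads (Sub e f). \<forall>i. s b i \<le> M"
    then show "eval (Sub e f) s \<le> h M + g M + (h M + 1)"
      "expr_cost (Sub e f) s \<le> h M + g M + (h M + 1)"
      using h(3,4)[of s M] word_cost_le[of "eval (Sub e f) s"] by auto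
  qed (intro poly_bounded_intros h(1,2))+
next
  case (Mul e f)
  then obtain h g where h: "poly_bounded h" "poly_bounded g"
    "\<And>s M. \<forall>b \<in> reads e. \<forall>i. s b i \<le> M \<Longrightarrow> eval e s \<le> h M \<and> expr_cost e s \<le> h M"
    "\<And>s M. \<forall>b \<in> reads f. \<forall>i. s b i \<le> M \<Longrightarrow> eval f s \<le> g M \<and> expr_cost f s \<le> g M" by blast
  show ?case
  proof (intro exI[of _ "\<lambda>M. h M + g M + (h M * g M + 1)"] conjI allI impI)
    fix s :: memory and M assume "\<forall>b \<in> reads (Mul e f). \<forall>i. s b i \<le> M"
    then have *: "eval e s \<le> h M \<and> expr_cost e s \<le> h M" "eval f s \<le> g M \<and> expr_cost f s \<le> g M"
      using h(3,4)[of s M] by auto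
    then have "eval e s * eval f s \<le> h M * g M" by (intro mult_mono) auto
    then show "eval (Mul e f) s \<le> h M + g M + (h M * g M + 1)"
      "expr_cost (Mul e f) s \<le> h M + g M + (h M * g M + 1)"
      using * word_cost_le[of "eval (Mul e f) s"] by auto
  qed (intro poly_bounded_intros h(1,2))+
next
  case (Div e f)
  then obtain h g where h: "poly_bounded h" "poly_bounded g"
    "\<And>s M. \<forall>b \<in> reads e. \<forall>i. s b i \<le> M \<Longrightarrow> eval e s \<le> h M \<and> expr_cost e s \<le> h M"
    "\<And>s M. \<forall>b \<in> reads f. \<forall>i. s b i \<le> M \<Longrightarrow> eval f s \<le> g M \<and> expr_cost f s \<le> g M" by blast
  show ?case
  proof (intro exI[of _ "\<lambda>M. h M + g M + (h M + 1)"] conjI allI impI)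
    fix s :: memory and M assume "\<forall>b \<in> reads (Div e f). \<forall>i. s b i \<le> M"
    then have *: "eval e s \<le> h M \<and> expr_cost e s \<le> h M" "eval f s \<le> g M \<and> expr_cost f s \<le> g M"
      using h(3,4)[of s M] by auto
    then have "eval (Div e f) s \<le> h M" by (auto intro: order.trans[OF div_le_dividend])
    then show "eval (Div e f) s \<le> h M + g M + (h M + 1)"
      "expr_cost (Div e f) s \<le> h M + g M + (h M + 1)"
      using * word_cost_le[of "eval (Div e f) s"] by auto
  qed (intro poly_bounded_intros h(1,2))+
qed

section \<open>Commands with bounded loops and their compilation\<close>

datatype cmd =
    Nop
  | Put nat expr expr
  | Then cmd cmd
  | If expr cmd cmd
  | For nat expr cmd

fun compile :: "cmd \<Rightarrow> program" where
  "compile Nop = Skip"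
| "compile (Put b a e) = Store b a e"
| "compile (Then c d) = Seq (compile c) (compile d)"
| "compile (If e c d) = Cond e (compile c) (compile d)"
| "compile (For v e c) = Seq (Store v (Const 0) (Const 0))
     (Loop (Sub e (Get v (Const 0)))
       (Seq (compile c) (Store v (Const 0) (Add (Get v (Const 0)) (Const 1)))))"

definition upd :: "nat \<Rightarrow> nat \<Rightarrow> nat \<Rightarrow> memory \<Rightarrow> memory" where
  "upd b i x s = s(b := (s b)(i := x))"

lemma upd_apply: "upd b i x s c = (if c = b then (s b)(i := x) else s c)"
  by (simp add: upd_def)

lemma upd_same [simp]: "upd b i x s b = (s b)(i := x)"
  and upd_other [simp]: "c \<noteq> b \<Longrightarrow> upd b i x s c = s c"
  by (simp_all add: upd_def)

text \<open>The number of rounds is the value of the bound on entry. The compiled loop evaluates its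
  guard, bound minus counter, in every round; both agree for commands satisfying
  \<open>wf_cmd\<close>, whose bounds read only a bank that is never written.\<close>

fun run :: "cmd \<Rightarrow> memory \<Rightarrow> memory" where
  "run Nop s = s"
| "run (Put b a e) s = upd b (eval a s) (eval e s) s"
| "run (Then c d) s = run d (run c s)"
| "run (If e c d) s = (if eval e s \<noteq> 0 then run c s else run d s)"
| "run (For v e c) s =
    ((\<lambda>s. upd v 0 (Suc (run c s v 0)) (run c s)) ^^ eval e s) (upd v 0 0 s)"

fun writes :: "cmd \<Rightarrow> nat set" where
  "writes Nop = {}"
| "writes (Put b a e) = {b}"
| "writes (Then c d) = writes c \<union> writes d"
| "writes (If e c d) = writes c \<union> writes d"
| "writes (For v e c) = insert v (writes c)"

lemma run_frame: "b \<notin> writes c \<Longrightarrow> run c s b = s b"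
proof (induction c arbitrary: s)
  case (For v e c)
  have "((\<lambda>s. upd v 0 (Suc (run c s v 0)) (run c s)) ^^ k) s' b = s' b" for k s'
    using For by (induction k) auto
  then show ?case using For.prems by simp
qed auto

text \<open>
  Loop bounds may only read the parameter bank \<open>\<rho>\<close>, and a store outside the write-only bank \<open>\<omega>\<close>
  may exceed the largest number in memory only by an amount that is polynomial in the parameters.
  This keeps all numbers, and hence all costs, polynomially bounded.
\<close>

definition tame :: "nat \<Rightarrow> nat \<Rightarrow> expr \<Rightarrow> bool" where
  "tame \<rho> \<omega> e \<longleftrightarrow> (\<exists>g. poly_bounded g \<and> (\<forall>s L M. (\<forall>i. s \<rho> i \<le> L) \<longrightarrow>
     (\<forall>b i. b \<noteq> \<omega> \<longrightarrow> s b i \<le> M) \<longrightarrow> eval e s \<le> M + g L))"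

fun wf_cmd :: "nat \<Rightarrow> nat \<Rightarrow> cmd \<Rightarrow> bool" where
  "wf_cmd \<rho> \<omega> Nop = True"
| "wf_cmd \<rho> \<omega> (Put b a e) \<longleftrightarrow>
     b \<noteq> \<rho> \<and> \<omega> \<notin> reads a \<and> \<omega> \<notin> reads e \<and> (b = \<omega> \<or> tame \<rho> \<omega> e)"
| "wf_cmd \<rho> \<omega> (Then c d) \<longleftrightarrow> wf_cmd \<rho> \<omega> c \<and> wf_cmd \<rho> \<omega> d"
| "wf_cmd \<rho> \<omega> (If e c d) \<longleftrightarrow> \<omega> \<notin> reads e \<and> wf_cmd \<rho> \<omega> c \<and> wf_cmd \<rho> \<omega> d"
| "wf_cmd \<rho> \<omega> (For v e c) \<longleftrightarrow>
     v \<noteq> \<rho> \<and> v \<noteq> \<omega> \<and> reads e \<subseteq> {\<rho>} \<and> v \<notin> writes c \<and> wf_cmd \<rho> \<omega> c"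

lemma wf_cmd_writes: "wf_cmd \<rho> \<omega> c \<Longrightarrow> \<rho> \<notin> writes c"
  by (induction c) auto

text \<open>The split between \<open>L\<close> and \<open>M\<close> is essential. Time may depend on
  the largest number \<open>M\<close>, but the growth depends on the parameter bound
  \<open>L\<close> alone, which stays fixed; so \<open>k\<close> rounds add just
  \<open>k * g L\<close>.\<close>

definition runs_within ::
    "nat \<Rightarrow> nat \<Rightarrow> program \<Rightarrow> (memory \<Rightarrow> memory) \<Rightarrow> (nat \<Rightarrow> nat) \<Rightarrow> (nat \<Rightarrow> nat) \<Rightarrow> bool" where
  "runs_within \<rho> \<omega> P f g h \<longleftrightarrow> (\<forall>s L M. (\<forall>i. s \<rho> i \<le> L) \<longrightarrow> (\<forall>b i. b \<noteq> \<omega> \<longrightarrow> s b i \<le> M) \<longrightarrow>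
     (\<exists>t \<le> h M. exec P s t (f s)) \<and> (\<forall>b i. b \<noteq> \<omega> \<longrightarrow> f s b i \<le> M + g L))"

lemma runs_withinD:
  assumes "runs_within \<rho> \<omega> P f g h" "\<forall>i. s \<rho> i \<le> L" "\<forall>b i. b \<noteq> \<omega> \<longrightarrow> s b i \<le> M"
  shows "(\<exists>t \<le> h M. exec P s t (f s)) \<and> (\<forall>b i. b \<noteq> \<omega> \<longrightarrow> f s b i \<le> M + g L)"
  using assms unfolding runs_within_def by blast

text \<open>The guard drops by one per round, so its initial value is the number of rounds. No
  number exceeds \<open>M + k * g L\<close> throughout, and every round is charged at this final
  bound.\<close>

lemma exec_loop_bounded:
  assumes body: "runs_within \<rho> \<omega> C f g h"
    and h: "poly_bounded h"
    and cond: "poly_bounded hc" "\<forall>s M. (\<forall>b i. b \<noteq> \<omega> \<longrightarrow> s b i \<le> M) \<longrightarrow> expr_cost e s \<le> hc M"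
    and keep: "\<And>s. f s \<rho> = s \<rho>"
    and down: "\<And>s. eval e (f s) = eval e s - 1"
  shows "\<lbrakk>\<forall>i. s \<rho> i \<le> L; \<forall>b i. b \<noteq> \<omega> \<longrightarrow> s b i \<le> M; eval e s = k\<rbrakk> \<Longrightarrow>
    (\<exists>t \<le> (k + 1) * (h (M + k * g L) + hc (M + k * g L)). exec (Loop e C) s t ((f ^^ k) s)) \<and>
    (\<forall>b i. b \<noteq> \<omega> \<longrightarrow> (f ^^ k) s b i \<le> M + k * g L)"
proof (induction k arbitrary: s M)
  case 0
  then have "exec (Loop e C) s (expr_cost e s) s" by (intro LoopFalse)
  then show ?case using 0 cond(2)[rule_format, of s M] by (auto intro: trans_le_add2)
next
  case (Suc k)
  let ?M = "M + g L"
  have s': "\<forall>i. f s \<rho> i \<le> L" "eval e (f s) = k" using Suc.prems keep down by auto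
  obtain t where t: "t \<le> h M" "exec C s t (f s)" and M: "\<forall>b i. b \<noteq> \<omega> \<longrightarrow> f s b i \<le> ?M"
    using runs_withinD[OF body Suc.prems(1,2)] by blast
  \<comment> \<open>The induction hypothesis is applied with the enlarged bound \<open>?M\<close>,
    so its final bound is the one for \<open>Suc k\<close> rounds and the cost per round
    \<open>?H\<close> is the same.\<close>
  have eq: "?M + k * g L = M + Suc k * g L" by simp
  let ?H = "h (M + Suc k * g L) + hc (M + Suc k * g L)"
  from Suc.IH[OF s'(1) M s'(2)] obtain t' where t': "t' \<le> (k + 1) * ?H"
    "exec (Loop e C) (f s) t' ((f ^^ k) (f s))"
    and M': "\<forall>b i. b \<noteq> \<omega> \<longrightarrow> (f ^^ k) (f s) b i \<le> M + Suc k * g L"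
    unfolding eq by blast
  have "exec (Loop e C) s (expr_cost e s + t + t') ((f ^^ k) (f s))"
    using Suc.prems(3) t(2) t'(2) by (intro LoopTrue) auto
  moreover have "expr_cost e s + t \<le> ?H"
    using mp[OF cond(2)[THEN spec, THEN spec] Suc.prems(2)] t(1) poly_bounded_mono[OF h, of M "M + Suc k * g L"]
      poly_bounded_mono[OF cond(1), of M "M + Suc k * g L"] by linarith
  moreover have "(Suc k + 1) * ?H = ?H + (k + 1) * ?H" by simp
  ultimately have "exec (Loop e C) s (expr_cost e s + t + t') ((f ^^ Suc k) s)"
    "expr_cost e s + t + t' \<le> (Suc k + 1) * ?H"
    using t'(1) by (simp_all add: funpow_swap1 del: mult_Suc)
  then show ?case using M' by (auto simp: funpow_swap1 simp del: mult_Suc)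
qed

lemma exec_compile:
  assumes "wf_cmd \<rho> \<omega> c" "\<rho> \<noteq> \<omega>"
  shows "\<exists>g h. poly_bounded g \<and> poly_bounded h \<and> runs_within \<rho> \<omega> (compile c) (run c) g h"
  using assms(1)
proof (induction c)
  case Nop
  show ?case by (rule exI[of _ "\<lambda>_. 0"], rule exI[of _ "\<lambda>_. 1"]) (auto simp: runs_within_def intro!: exI[of _ 1] exec.Skip[simplified] poly_bounded_const)
next
  case (Put b a e)
  obtain ha where ha: "poly_bounded ha"
    "\<And>s M. \<forall>b \<in> reads a. \<forall>i. s b i \<le> M \<Longrightarrow> eval a s \<le> ha M \<and> expr_cost a s \<le> ha M"
    using expr_poly_bounded by blast
  obtain he where he: "poly_bounded he"
    "\<And>s M. \<forall>b \<in> reads e. \<forall>i. s b i \<le> M \<Longrightarrow> eval e s \<le> he M \<and> expr_cost e s \<le> he M"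
    using expr_poly_bounded by blast
  obtain g where g: "poly_bounded g" "b \<noteq> \<omega> \<Longrightarrow> \<forall>s L M. (\<forall>i. s \<rho> i \<le> L) \<longrightarrow>
     (\<forall>b i. b \<noteq> \<omega> \<longrightarrow> s b i \<le> M) \<longrightarrow> eval e s \<le> M + g L"
    using Put.prems by (cases "b = \<omega>") (auto simp: tame_def intro: that[OF poly_bounded_const[of 0]])
  show ?case
  proof (rule exI[of _ g], rule exI[of _ "\<lambda>M. 1 + ha M + he M"], unfold runs_within_def, intro conjI allI impI)
    fix s :: memory and L M assume *: "\<forall>i. s \<rho> i \<le> L" "\<forall>b i. b \<noteq> \<omega> \<longrightarrow> s b i \<le> M"
    have "expr_cost a s \<le> ha M" "expr_cost e s \<le> he M"
      using ha(2)[of s M] he(2)[of s M] * Put.prems by (metis wf_cmd.simps(2))+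
    then show "\<exists>t\<le>1 + ha M + he M. exec (compile (Put b a e)) s t (run (Put b a e) s)"
      using exec.Store[of b a e s] by (auto simp: upd_def intro!: exI[of _ "1 + expr_cost a s + expr_cost e s"])
    fix b' i :: nat assume "b' \<noteq> \<omega>"
    then show "run (Put b a e) s b' i \<le> M + g L"
      using g(2) * by (auto simp: trans_le_add1 upd_apply)
  qed (intro poly_bounded_intros g(1) ha(1) he(1))+
next
  case (Then c d)
  then obtain g h g' h' where IH: "poly_bounded g" "poly_bounded h" "poly_bounded g'" "poly_bounded h'"
    and c: "runs_within \<rho> \<omega> (compile c) (run c) g h"
    and d: "runs_within \<rho> \<omega> (compile d) (run d) g' h'"
    by auto
  show ?case
  proof (rule exI[of _ "\<lambda>L. g L + g' L"], rule exI[of _ "\<lambda>M. h M + h' (M + g M)"], intro conjI)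
    show "runs_within \<rho> \<omega> (compile (Then c d)) (run (Then c d)) (\<lambda>L. g L + g' L) (\<lambda>M. h M + h' (M + g M))"
      unfolding runs_within_def
    proof (intro allI impI)
      fix s :: memory and L M assume *: "\<forall>i. s \<rho> i \<le> L" "\<forall>b i. b \<noteq> \<omega> \<longrightarrow> s b i \<le> M"
      \<comment> \<open>The parameter cells obey both bounds because \<open>\<rho>\<close> differs
        from \<open>\<omega>\<close>. With the minimum, growth is at most \<open>g M\<close> where
        only \<open>M\<close> may occur (time) and at most \<open>g L\<close> where only
        \<open>L\<close> may occur (growth).\<close>
      define L' where "L' = min L M"
      have L': "\<forall>i. s \<rho> i \<le> L'" using * assms(2) by (simp add: L'_def)
      have r: "\<forall>i. run c s \<rho> i \<le> L'"
        using L' run_frame[OF wf_cmd_writes, of \<rho> \<omega> c s] Then.prems by simp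
      obtain t where t: "t \<le> h M" "exec (compile c) s t (run c s)"
        and M1: "\<forall>b i. b \<noteq> \<omega> \<longrightarrow> run c s b i \<le> M + g L'" using runs_withinD[OF c L' *(2)] by blast
      obtain t' where t': "t' \<le> h' (M + g L')" "exec (compile d) (run c s) t' (run d (run c s))"
        and M2: "\<forall>b i. b \<noteq> \<omega> \<longrightarrow> run d (run c s) b i \<le> M + g L' + g' L'" using runs_withinD[OF d r M1] by blast
      have ex: "exec (compile (Then c d)) s (t + t') (run (Then c d) s)" 
        unfolding compile.simps run.simps using t(2) t'(2) by (rule exec.Seq)
      have le: "g L' \<le> g M" "g L' \<le> g L" "g' L' \<le> g' L"
        using poly_bounded_mono[OF IH(1), of L'] poly_bounded_mono[OF IH(3), of L'] by (auto simp: L'_def)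
      have "h' (M + g L') \<le> h' (M + g M)" using le by (intro poly_bounded_mono[OF IH(4)]) simp
      then have "t + t' \<le> h M + h' (M + g M)" using t(1) t'(1) by linarith
      moreover have "run (Then c d) s b i \<le> M + (g L + g' L)" if "b \<noteq> \<omega>" for b i
        using M2[rule_format, OF that, of i] le by simp
      ultimately show "(\<exists>t\<le>h M + h' (M + g M). exec (compile (Then c d)) s t (run (Then c d) s)) \<and>
        (\<forall>b i. b \<noteq> \<omega> \<longrightarrow> run (Then c d) s b i \<le> M + (g L + g' L))"
        using ex by blast
    qed
  qed (intro poly_bounded_intros poly_bounded_compose[OF IH(4)] IH)+
next
  case (If e c d)
  then obtain g h g' h' where IH: "poly_bounded g" "poly_bounded h" "poly_bounded g'" "poly_bounded h'"
    and c: "runs_within \<rho> \<omega> (compile c) (run c) g h"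
    and d: "runs_within \<rho> \<omega> (compile d) (run d) g' h'"
    by auto
  obtain he where he: "poly_bounded he"
    "\<And>s M. \<forall>b \<in> reads e. \<forall>i. s b i \<le> M \<Longrightarrow> eval e s \<le> he M \<and> expr_cost e s \<le> he M"
    using expr_poly_bounded by blast
  show ?case
  proof (rule exI[of _ "\<lambda>L. g L + g' L"], rule exI[of _ "\<lambda>M. he M + (h M + h' M)"], intro conjI)
    show "runs_within \<rho> \<omega> (compile (If e c d)) (run (If e c d)) (\<lambda>L. g L + g' L) (\<lambda>M. he M + (h M + h' M))"
      unfolding runs_within_def
    proof (intro allI impI)
      fix s :: memory and L M assume *: "\<forall>i. s \<rho> i \<le> L" "\<forall>b i. b \<noteq> \<omega> \<longrightarrow> s b i \<le> M"
      have "expr_cost e s \<le> he M" using he(2)[of s M] * If.prems by (metis wf_cmd.simps(4))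
      then show "(\<exists>t\<le>he M + (h M + h' M). exec (compile (If e c d)) s t (run (If e c d) s)) \<and>
        (\<forall>b i. b \<noteq> \<omega> \<longrightarrow> run (If e c d) s b i \<le> M + (g L + g' L))"
      proof (cases "eval e s = 0")
        case True
        obtain t where t: "t \<le> h' M" "exec (compile d) s t (run d s)"
          and M': "\<forall>b i. b \<noteq> \<omega> \<longrightarrow> run d s b i \<le> M + g' L" using runs_withinD[OF d *] by blast
        have "exec (compile (If e c d)) s (expr_cost e s + t) (run (If e c d) s)"
          using exec.CondFalse[OF True t(2)] True by simp
        moreover have "expr_cost e s + t \<le> he M + (h M + h' M)"
          using t(1) \<open>expr_cost e s \<le> he M\<close> by linarith
        moreover have "run (If e c d) s b i \<le> M + (g L + g' L)" if "b \<noteq> \<omega>" for b i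
          using M'[rule_format, OF that, of i] True by simp
        ultimately show ?thesis by blast
      next
        case False
        obtain t where t: "t \<le> h M" "exec (compile c) s t (run c s)"
          and M': "\<forall>b i. b \<noteq> \<omega> \<longrightarrow> run c s b i \<le> M + g L" using runs_withinD[OF c *] by blast
        have "exec (compile (If e c d)) s (expr_cost e s + t) (run (If e c d) s)"
          using exec.CondTrue[OF False t(2)] False by simp
        moreover have "expr_cost e s + t \<le> he M + (h M + h' M)"
          using t(1) \<open>expr_cost e s \<le> he M\<close> by linarith
        moreover have "run (If e c d) s b i \<le> M + (g L + g' L)" if "b \<noteq> \<omega>" for b i
          using M'[rule_format, OF that, of i] False by simp
        ultimately show ?thesis by blast
      qed
    qed
  qed (intro poly_bounded_intros IH he(1))+
next
  case (For v e c)
  then obtain g h where IH: "poly_bounded g" "poly_bounded h"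
    and c: "runs_within \<rho> \<omega> (compile c) (run c) g h"
    by auto
  have v: "v \<noteq> \<rho>" "v \<noteq> \<omega>" "reads e \<subseteq> {\<rho>}" "v \<notin> writes c" and \<rho>: "\<rho> \<notin> writes c"
    using For.prems wf_cmd_writes by auto
  obtain he where he: "poly_bounded he"
    "\<And>s M. \<forall>b \<in> reads e. \<forall>i. s b i \<le> M \<Longrightarrow> eval e s \<le> he M \<and> expr_cost e s \<le> he M"
    using expr_poly_bounded by blast
  let ?inc = "Add (Get v (Const 0)) (Const 1)" and ?cond = "Sub e (Get v (Const 0))"
  obtain hi where hi: "poly_bounded hi"
    "\<And>s M. \<forall>b \<in> reads ?inc. \<forall>i. s b i \<le> M \<Longrightarrow> eval ?inc s \<le> hi M \<and> expr_cost ?inc s \<le> hi M"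
    using expr_poly_bounded by blast
  obtain hc where hc: "poly_bounded hc"
    "\<And>s M. \<forall>b \<in> reads ?cond. \<forall>i. s b i \<le> M \<Longrightarrow> eval ?cond s \<le> hc M \<and> expr_cost ?cond s \<le> hc M"
    using expr_poly_bounded by blast
  define f where "f = (\<lambda>s. upd v 0 (Suc (run c s v 0)) (run c s))"
  let ?C = "Seq (compile c) (Store v (Const 0) ?inc)"
  let ?w = "word_cost 0"
  define H where "H = (\<lambda>M. h M + (1 + ?w + hi (M + g M)))"
  have H: "poly_bounded H" unfolding H_def
    by (intro poly_bounded_intros poly_bounded_compose[OF hi(1)] IH hi(1))
  \<comment> \<open>The extra 1 in the growth pays for incrementing the counter.\<close>
  have body: "runs_within \<rho> \<omega> ?C f (\<lambda>L. g L + 1) H"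
    unfolding runs_within_def
  proof (intro allI impI)
    fix s :: memory and L M assume *: "\<forall>i. s \<rho> i \<le> L" "\<forall>b i. b \<noteq> \<omega> \<longrightarrow> s b i \<le> M"
    define L' where "L' = min L M"
    have L': "\<forall>i. s \<rho> i \<le> L'" using * assms(2) by (simp add: L'_def)
    have gL': "g L' \<le> g L" "g L' \<le> g M" using poly_bounded_mono[OF IH(1), of L'] by (auto simp: L'_def)
    obtain t where t: "t \<le> h M" "exec (compile c) s t (run c s)"
      and M: "\<forall>b i. b \<noteq> \<omega> \<longrightarrow> run c s b i \<le> M + g L'" using runs_withinD[OF c L' *(2)] by blast
    have "exec (Store v (Const 0) ?inc) (run c s) (1 + ?w + expr_cost ?inc (run c s)) (f s)"
      using exec.Store[of v "Const 0" ?inc "run c s"] by (simp add: f_def upd_def)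
    then have "exec ?C s (t + (1 + ?w + expr_cost ?inc (run c s))) (f s)" using t(2) by (rule exec.Seq[rotated])
    moreover have "expr_cost ?inc (run c s) \<le> hi (M + g M)"
    proof -
      have "expr_cost ?inc (run c s) \<le> hi (M + g L')"
        using hi(2)[of "run c s" "M + g L'"] M v(2) by simp
      also have "\<dots> \<le> hi (M + g M)" using gL' by (intro poly_bounded_mono[OF hi(1)]) simp
      finally show ?thesis .
    qed
    moreover have "f s b i \<le> M + (g L + 1)" if "b \<noteq> \<omega>" for b i
    proof -
      have "run c s b' j \<le> M + g L" if "b' \<noteq> \<omega>" for b' j
        using M[rule_format, OF that, of j] gL'(1) by linarith
      then show ?thesis using that v(2) by (auto simp: f_def le_SucI upd_apply)
    qed
    moreover have "t + (1 + ?w + expr_cost ?inc (run c s)) \<le> H M"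
      using calculation(2) t(1) unfolding H_def by linarith
    ultimately show "(\<exists>t \<le> H M. exec ?C s t (f s)) \<and>
        (\<forall>b i. b \<noteq> \<omega> \<longrightarrow> f s b i \<le> M + (g L + 1))" by blast
  qed
  have keep: "f s \<rho> = s \<rho>" for s using run_frame[OF \<rho>] v by (simp add: f_def)
  have down: "eval ?cond (f s) = eval ?cond s - 1" for s
  proof -
    have "eval e (f s) = eval e s" using v keep by (intro eval_cong) auto
    moreover have "f s v 0 = Suc (s v 0)" using run_frame[OF v(4)] by (simp add: f_def)
    ultimately show ?thesis by simp
  qed
  have cost: "\<forall>s M. (\<forall>b i. b \<noteq> \<omega> \<longrightarrow> s b i \<le> M) \<longrightarrow> expr_cost ?cond s \<le> hc M"
  proof (intro allI impI)
    fix s :: memory and M assume "\<forall>b i. b \<noteq> \<omega> \<longrightarrow> s b i \<le> M"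
    moreover have "\<omega> \<notin> reads ?cond" using v assms(2) by auto
    ultimately show "expr_cost ?cond s \<le> hc M" using hc(2)[of s M] by metis
  qed
  show ?case
  proof (rule exI[of _ "\<lambda>L. he L * (g L + 1)"],
      rule exI[of _ "\<lambda>M. (1 + ?w + ?w) + (he M + 1) * (H (M + he M * (g M + 1)) + hc (M + he M * (g M + 1)))"],
      intro conjI)
    let ?T = "\<lambda>M. (1 + ?w + ?w) + (he M + 1) * (H (M + he M * (g M + 1)) + hc (M + he M * (g M + 1)))"
    show "runs_within \<rho> \<omega> (compile (For v e c)) (run (For v e c)) (\<lambda>L. he L * (g L + 1)) ?T"
      unfolding runs_within_def
    proof (intro allI impI)
      fix s :: memory and L M assume *: "\<forall>i. s \<rho> i \<le> L" "\<forall>b i. b \<noteq> \<omega> \<longrightarrow> s b i \<le> M"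
      define L' where "L' = min L M"
      define s0 where "s0 = upd v 0 0 s"
      define k where "k = eval e s"
      have s0: "\<forall>i. s0 \<rho> i \<le> L'" "\<forall>b i. b \<noteq> \<omega> \<longrightarrow> s0 b i \<le> M"
        using * assms(2) v by (auto simp: L'_def s0_def upd_apply)
      have k0: "eval ?cond s0 = k"
      proof -
        have "eval e s0 = eval e s" using v by (intro eval_cong) (auto simp: s0_def)
        then show ?thesis by (simp add: k_def s0_def)
      qed
      \<comment> \<open>The loop bound reads only \<open>\<rho>\<close>, so the number of rounds is
        polynomial in the parameters.\<close>
      have kle: "k \<le> he L'" using he(2)[of s L'] * assms(2) v(3) by (auto simp: k_def L'_def)
      have le: "L' \<le> L" "L' \<le> M" by (auto simp: L'_def)
      have keL: "he L' \<le> he L" "he L' \<le> he M" "g L' \<le> g L" "g L' \<le> g M"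
        using le poly_bounded_mono[OF IH(1), of L'] poly_bounded_mono[OF he(1), of L'] by auto
      have prodM: "k * (g L' + 1) \<le> he M * (g M + 1)" and prodL: "k * (g L' + 1) \<le> he L * (g L + 1)"
        using kle keL by (intro mult_mono add_mono; linarith)+
      from exec_loop_bounded[OF body H hc(1) cost keep down s0 k0] obtain t where
        t: "t \<le> (k + 1) * (H (M + k * (g L' + 1)) + hc (M + k * (g L' + 1)))"
          "exec (Loop ?cond ?C) s0 t ((f ^^ k) s0)"
        and fin: "\<forall>b i. b \<noteq> \<omega> \<longrightarrow> (f ^^ k) s0 b i \<le> M + k * (g L' + 1)" by blast
      have run: "run (For v e c) s = (f ^^ k) s0" by (simp add: f_def k_def s0_def)
      have "exec (Store v (Const 0) (Const 0)) s (1 + ?w + ?w) s0"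
        using exec.Store[of v "Const 0" "Const 0" s] by (simp add: s0_def upd_def)
      then have "exec (compile (For v e c)) s ((1 + ?w + ?w) + t) (run (For v e c) s)"
        using t(2) unfolding run compile.simps by (rule exec.Seq)
      moreover have "t \<le> (he M + 1) * (H (M + he M * (g M + 1)) + hc (M + he M * (g M + 1)))"

        using t(1) by (rule order.trans) (intro mult_mono add_mono poly_bounded_mono[OF H]
            poly_bounded_mono[OF hc(1)] prodM order.trans[OF kle keL(2)] order.refl zero_le)
      ultimately show "(\<exists>t\<le>?T M. exec (compile (For v e c)) s t (run (For v e c) s)) \<and>
        (\<forall>b i. b \<noteq> \<omega> \<longrightarrow> run (For v e c) s b i \<le> M + he L * (g L + 1))"
        using fin prodL unfolding run by (meson add_left_mono order.trans)
    qed
  qed (intro poly_bounded_intros poly_bounded_compose[OF H] poly_bounded_compose[OF hc(1)] IH he(1) H hc(1))+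
qed

section \<open>Independence of the banks that a program does not mention\<close>

fun banks :: "program \<Rightarrow> nat set" where
  "banks Skip = {}"
| "banks (Store b e f) = insert b (reads e \<union> reads f)"
| "banks (Seq P R) = banks P \<union> banks R"
| "banks (Cond e P R) = reads e \<union> banks P \<union> banks R"
| "banks (Loop e P) = reads e \<union> banks P"

lemma finite_reads: "finite (reads e)"
  by (induction e) auto

lemma finite_banks: "finite (banks P)"
  by (induction P) (auto simp: finite_reads)

text \<open>This permits running the deletion algorithm on a memory whose higher banks hold
  leftovers of the reduction: its behaviour and time are as on clean memory, and the leftovers
  survive.\<close>

lemma exec_banks:
  assumes "exec P s t s'" "banks P \<subseteq> B" "\<forall>b \<in> B. r b = s b"
  shows "\<exists>r'. exec P r t r' \<and> (\<forall>b \<in> B. r' b = s' b) \<and> (\<forall>b. b \<notin> B \<longrightarrow> r' b = r b)"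
  using assms
proof (induction arbitrary: r rule: exec.induct)
  case (Skip s)
  then show ?case by (blast intro: exec.Skip)
next
  case (Store b e f s)
  have eqs: "eval e r = eval e s" "eval f r = eval f s"
    "expr_cost e r = expr_cost e s" "expr_cost f r = expr_cost f s"
    using Store.prems by (auto intro!: eval_cong expr_cost_cong)
  show ?case
    by (rule exI, rule conjI, rule exec.Store[of b e f r, unfolded eqs]) (use Store.prems in auto)
next
  case (Seq P s t s' R t' s'')
  then obtain r' where r': "exec P r t r'" "\<forall>b \<in> B. r' b = s' b" "\<forall>b. b \<notin> B \<longrightarrow> r' b = r b" by force
  then obtain r'' where "exec R r' t' r''" "\<forall>b \<in> B. r'' b = s'' b" "\<forall>b. b \<notin> B \<longrightarrow> r'' b = r' b"
    using Seq.IH(2)[of r'] Seq.prems by auto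
  then show ?case using r' by (auto intro!: exI[of _ r''] exec.Seq)
next
  case (CondTrue e s P t s' R)
  have *: "eval e r = eval e s" "expr_cost e r = expr_cost e s"
    using CondTrue.prems by (auto intro!: eval_cong expr_cost_cong)
  obtain r' where "exec P r t r'" "\<forall>b \<in> B. r' b = s' b" "\<forall>b. b \<notin> B \<longrightarrow> r' b = r b"
    using CondTrue.IH[of r] CondTrue.prems by auto
  then show ?case using exec.CondTrue[of e r P t r' R] * CondTrue.hyps by (auto intro!: exI[of _ r'])
next
  case (CondFalse e s R t s' P)
  have *: "eval e r = eval e s" "expr_cost e r = expr_cost e s"
    using CondFalse.prems by (auto intro!: eval_cong expr_cost_cong)
  obtain r' where "exec R r t r'" "\<forall>b \<in> B. r' b = s' b" "\<forall>b. b \<notin> B \<longrightarrow> r' b = r b"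
    using CondFalse.IH[of r] CondFalse.prems by auto
  then show ?case using exec.CondFalse[of e r R t r' P] * CondFalse.hyps by (auto intro!: exI[of _ r'])
next
  case (LoopFalse e s P)
  have *: "eval e r = eval e s" "expr_cost e r = expr_cost e s"
    using LoopFalse.prems by (auto intro!: eval_cong expr_cost_cong)
  then show ?case using exec.LoopFalse[of e r P] LoopFalse by (auto intro!: exI[of _ r])
next
  case (LoopTrue e s P t s' t' s'')
  have *: "eval e r = eval e s" "expr_cost e r = expr_cost e s"
    using LoopTrue.prems by (auto intro!: eval_cong expr_cost_cong)
  obtain r' where r': "exec P r t r'" "\<forall>b \<in> B. r' b = s' b" "\<forall>b. b \<notin> B \<longrightarrow> r' b = r b"
    using LoopTrue.IH(1)[of r] LoopTrue.prems by auto
  then obtain r'' where "exec (Loop e P) r' t' r''" "\<forall>b \<in> B. r'' b = s'' b" "\<forall>b. b \<notin> B \<longrightarrow> r'' b = r' b"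
    using LoopTrue.IH(2)[of r'] LoopTrue.prems by auto
  then show ?case using r' exec.LoopTrue[of e r P t r' t' r''] * LoopTrue.hyps by (auto intro!: exI[of _ r''])
qed

lemma word_cost_pos: "word_cost k > 0"
  by (simp add: word_cost_def)

lemma expr_cost_pos: "expr_cost e s > 0"
  by (cases e) (simp_all add: word_cost_pos)

text \<open>Refutes time bounds that are not positive, which arise from a negative base.\<close>

lemma exec_time_pos: "exec P s t s' \<Longrightarrow> t > 0"
  by (induction rule: exec.induct) (simp_all add: expr_cost_pos)


section \<open>Satisfiability as a forbidden tuple problem\<close>

text \<open>The decoder need only reach every pattern of \<open>t\<close> bits; any further words
  may decode to anything. It enters the program as a finite table of constants.
  \<open>\<kappa> \<ge> 2\<close> provides the two slots that a gadget needs.\<close>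

locale block_encoding =
  fixes q s t \<kappa> :: nat and dec :: "nat list \<Rightarrow> nat"
  assumes q: "q \<ge> 2" and s: "s \<ge> 1" and t: "t \<ge> 1" and \<kappa>: "\<kappa> \<ge> 2"
    and dec: "\<And>f :: nat \<Rightarrow> bool. \<exists>w. length w = s \<and> set w \<subseteq> {1..q} \<and> (\<forall>i<t. odd (dec w div 2 ^ i) = f i)"
begin

definition r :: nat where
  "r = \<kappa> * s"

text \<open>The blocks are numbered 0 to \<open>n div t\<close>. The added block makes the hub
  nonempty even for \<open>n = 0\<close>, as slots may refer to the hub vertex 0.\<close>

definition hub_size :: "nat \<Rightarrow> nat" where
  "hub_size n = s * (n div t + 1)"

text \<open>Short clauses are padded with block 0. Positions may share a block; a tuple giving them
  different words is never hit, as its slots would demand two colours of one vertex.\<close>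

definition block_of :: "clause \<Rightarrow> nat \<Rightarrow> nat" where
  "block_of C l = (if l < length C then fst (C ! l) div t else 0)"

definition word_at :: "nat list \<Rightarrow> nat \<Rightarrow> nat list" where
  "word_at a l = map (\<lambda>j. a ! (l * s + j)) [0..<s]"

definition tuple_sat :: "clause \<Rightarrow> nat list \<Rightarrow> bool" where
  "tuple_sat C a \<longleftrightarrow> (\<exists>l<\<kappa>. l < length C \<and>
     odd (dec (word_at a l) div 2 ^ (fst (C ! l) mod t)) = snd (C ! l))"

text \<open>
  A tuple that satisfies the clause gets a gadget which no colouring can hit, since its first two
  slots demand different colours at the hub vertex 0.
\<close>

definition slots :: "clause \<Rightarrow> nat list \<Rightarrow> (nat \<times> nat) list" where
  "slots C a = map (\<lambda>i. if tuple_sat C a then (0, if i = 0 then 1 else 2)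
     else (s * block_of C (i div s) + i mod s, a ! i)) [0..<r]"

definition tuples :: "nat list list" where
  "tuples = List.n_lists r [1..<Suc q]"

definition gadgets :: "clause list \<Rightarrow> (nat \<times> nat) list list" where
  "gadgets F = concat (map (\<lambda>C. map (slots C) tuples) F)"

lemma r_ge_2: "r \<ge> 2"
  using s \<kappa> mult_le_mono[of 2 \<kappa> 1 s] by (simp add: r_def)

lemma tuples_iff: "a \<in> set tuples \<longleftrightarrow> length a = r \<and> set a \<subseteq> {1..q}"
  by (auto simp: tuples_def set_n_lists)

text \<open>Satisfying tuples also receive a gadget, so this count does not depend on the contents
  of the clauses. Hence vertex count, edge count and threshold can be computed from \<open>n\<close>
  and the number of clauses before any clause is read.\<close>

lemma length_gadgets: "length (gadgets F) = length F * length tuples"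
  by (induction F) (simp_all add: gadgets_def)

lemma hub_index_less:
  assumes "\<forall>(x, b) \<in> set C. x < n" "i < r"
  shows "s * block_of C (i div s) + i mod s < hub_size n"
proof -
  have "block_of C l \<le> n div t" for l
  proof (cases "l < length C")
    case True
    then have "fst (C ! l) < n" using assms(1) nth_mem[OF True] by (auto simp: case_prod_unfold)
    then show ?thesis using True by (simp add: block_of_def div_le_mono)
  qed (simp add: block_of_def)
  then have "s * block_of C (i div s) \<le> s * (n div t)" by (intro mult_le_mono2)
  moreover have "i mod s < s" using s by simp
  ultimately have "s * block_of C (i div s) + i mod s < s * (n div t) + s" by linarith
  then show ?thesis by (simp add: hub_size_def)
qed

lemma slots_valid:
  assumes "\<forall>(x, b) \<in> set C. x < n" "a \<in> set tuples" "i < r"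
  shows "fst (slots C a ! i) < hub_size n \<and> snd (slots C a ! i) \<in> {1..q}"
proof -
  have "a ! i \<in> {1..q}" using assms(2,3) nth_mem[of i a] unfolding tuples_iff by (metis subsetD)
  moreover have "0 < hub_size n" using s by (simp add: hub_size_def)
  ultimately show ?thesis using hub_index_less[OF assms(1,3)] assms(3) q by (simp add: slots_def)
qed

lemma slot_index:
  assumes "l < \<kappa>" "j < s"
  shows "l * s + j < r" "(l * s + j) div s = l" "(l * s + j) mod s = j"
proof -
  have "l * s + j < Suc l * s" using assms by simp
  also have "\<dots> \<le> r" unfolding r_def using assms by (intro mult_le_mono1) simp
  finally show "l * s + j < r" .
qed (use assms in auto)

text \<open>A hub colouring shows each clause exactly one tuple, namely the words on its blocks. The
  colouring decodes to an assignment that satisfies the clause iff this tuple does, and a tuple that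
  does not is forbidden by its own gadget.\<close>

lemma satisfiable_iff_colorable:
  assumes F: "kCNF \<kappa> n F"
  shows "satisfiable F \<longleftrightarrow> (\<exists>\<phi>. (\<forall>h<hub_size n. \<phi> h \<in> {1..q}) \<and>
    (\<forall>sl \<in> set (gadgets F). \<exists>i<r. \<phi> (fst (sl ! i)) \<noteq> snd (sl ! i)))"
proof
  assume "satisfiable F"
  then obtain \<alpha> :: "nat \<Rightarrow> bool" where \<alpha>: "\<And>C. C \<in> set F \<Longrightarrow> \<exists>(x, b) \<in> set C. \<alpha> x = b"
    unfolding satisfiable_def by blast
  have "\<forall>B. \<exists>w. length w = s \<and> set w \<subseteq> {1..q} \<and> (\<forall>i<t. odd (dec w div 2 ^ i) = \<alpha> (B * t + i))"
    by (intro allI dec)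
  then obtain w where "\<forall>B. length (w B) = s \<and> set (w B) \<subseteq> {1..q} \<and>
      (\<forall>i<t. odd (dec (w B) div 2 ^ i) = \<alpha> (B * t + i))"
    by (rule choice[THEN exE])
  then have w: "\<And>B. length (w B) = s" "\<And>B. set (w B) \<subseteq> {1..q}"
    "\<And>B i. i < t \<Longrightarrow> odd (dec (w B) div 2 ^ i) = \<alpha> (B * t + i)" by blast+
  define \<phi> where "\<phi> h = w (h div s) ! (h mod s)" for h
  have "\<phi> h \<in> {1..q}" for h
  proof -
    have "h mod s < length (w (h div s))" using w(1) s by simp
    then show ?thesis unfolding \<phi>_def using w(2) nth_mem by blast
  qed
  moreover have "\<exists>i<r. \<phi> (fst (slots C a ! i)) \<noteq> snd (slots C a ! i)" if C: "C \<in> set F" for C a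
  proof (cases "tuple_sat C a")
    case True
    have "slots C a ! 0 = (0, 1)" "slots C a ! 1 = (0, 2)" using True r_ge_2 by (simp_all add: slots_def)
    then show ?thesis using r_ge_2
      \<comment> \<open>The hub vertex 0 cannot have both colours 1 and 2, so it misses slot 0 or
        slot 1.\<close>
      by (intro exI[of _ "if \<phi> 0 = 1 then 1 else 0"]) (simp)
  next
    case False
    show ?thesis
    proof (rule ccontr)
      assume hit: "\<not> ?thesis"
      have eq: "a ! i = \<phi> (s * block_of C (i div s) + i mod s)" if "i < r" for i
        using hit that False by (simp add: slots_def)
      have word: "word_at a l = w (block_of C l)" if "l < \<kappa>" for l
      proof (rule nth_equalityI)
        fix j assume "j < length (word_at a l)"
        then have j: "j < s" by (simp add: word_at_def)
        then show "word_at a l ! j = w (block_of C l) ! j"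
          using slot_index[OF that j] by (simp add: word_at_def eq \<phi>_def)
      qed (simp add: word_at_def w(1))
      obtain l where l: "l < length C" "\<alpha> (fst (C ! l)) = snd (C ! l)"
        using \<alpha>[OF C] unfolding case_prod_unfold in_set_conv_nth Bex_def by blast
      have "l < \<kappa>" using l F C by (auto simp: kCNF_def)
      have "odd (dec (word_at a l) div 2 ^ (fst (C ! l) mod t)) = snd (C ! l)"
        using w(3)[of "fst (C ! l) mod t" "fst (C ! l) div t"] t l
        by (simp add: word[OF \<open>l < \<kappa>\<close>] block_of_def)
      then show False using False l(1) \<open>l < \<kappa>\<close> by (auto simp: tuple_sat_def)
    qed
  qed
  then have "\<forall>sl \<in> set (gadgets F). \<exists>i<r. \<phi> (fst (sl ! i)) \<noteq> snd (sl ! i)"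
    by (auto simp: gadgets_def)
  ultimately show "\<exists>\<phi>. (\<forall>h<hub_size n. \<phi> h \<in> {1..q}) \<and>
    (\<forall>sl \<in> set (gadgets F). \<exists>i<r. \<phi> (fst (sl ! i)) \<noteq> snd (sl ! i))"
    by blast
next
  assume "\<exists>\<phi>. (\<forall>h<hub_size n. \<phi> h \<in> {1..q}) \<and>
    (\<forall>sl \<in> set (gadgets F). \<exists>i<r. \<phi> (fst (sl ! i)) \<noteq> snd (sl ! i))"
  then obtain \<phi> where \<phi>: "\<And>h. h < hub_size n \<Longrightarrow> \<phi> h \<in> {1..q}"
    and ok': "\<And>sl. sl \<in> set (gadgets F) \<Longrightarrow> \<exists>i<r. \<phi> (fst (sl ! i)) \<noteq> snd (sl ! i)" by blast
  have ok: "\<exists>i<r. \<phi> (fst (slots C a ! i)) \<noteq> snd (slots C a ! i)"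
    if "C \<in> set F" "a \<in> set tuples" for C a
    by (rule ok') (use that in \<open>auto simp: gadgets_def\<close>)
  define W where "W B = map (\<lambda>j. \<phi> (s * B + j)) [0..<s]" for B
  define \<alpha> where "\<alpha> x = odd (dec (W (x div t)) div 2 ^ (x mod t))" for x
  have "\<exists>(x, b) \<in> set C. \<alpha> x = b" if C: "C \<in> set F" for C
  proof -
    \<comment> \<open>The tuple that \<open>\<phi>\<close> itself shows to \<open>C\<close>. Unless
      it satisfies \<open>C\<close>, all slots of its gadget would be hit.\<close>
    define a where "a = map (\<lambda>i. \<phi> (s * block_of C (i div s) + i mod s)) [0..<r]"
    have "\<forall>(x, b) \<in> set C. x < n" using F C by (auto simp: kCNF_def)
    then have "\<phi> (s * block_of C (i div s) + i mod s) \<in> {1..q}" if "i < r" for i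
      using \<phi> hub_index_less that by blast
    then have "a \<in> set tuples" by (auto simp: tuples_iff a_def)
    then obtain i where "i < r" "\<phi> (fst (slots C a ! i)) \<noteq> snd (slots C a ! i)" using ok C by blast
    then have "tuple_sat C a" by (cases "tuple_sat C a") (simp_all add: slots_def a_def)
    then obtain l where l: "l < \<kappa>" "l < length C"
      "odd (dec (word_at a l) div 2 ^ (fst (C ! l) mod t)) = snd (C ! l)" by (auto simp: tuple_sat_def)
    have "word_at a l = W (block_of C l)"
    proof (rule nth_equalityI)
      fix j assume "j < length (word_at a l)"
      then have j: "j < s" by (simp add: word_at_def)
      then show "word_at a l ! j = W (block_of C l) ! j"
        using slot_index[OF l(1) j] by (simp add: word_at_def a_def W_def)
    qed (simp add: word_at_def W_def)
    then have "\<alpha> (fst (C ! l)) = snd (C ! l)" using l by (simp add: \<alpha>_def block_of_def)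
    then show ?thesis using nth_mem[OF l(2)] by (auto simp: case_prod_unfold)
  qed
  then show "satisfiable F" unfolding satisfiable_def by (intro exI[of _ \<alpha>] ballI)
qed

lemma gadget_instance:
  assumes "kCNF k n F"
  shows "gadget_instance q r (hub_size n) (gadgets F)"
proof
  fix sl i assume "sl \<in> set (gadgets F)" "i < r"
  then obtain C a where "C \<in> set F" "a \<in> set tuples" "sl = slots C a" by (auto simp: gadgets_def)
  moreover from this have "\<forall>(x, b) \<in> set C. x < n" using assms by (auto simp: kCNF_def)
  ultimately show "fst (sl ! i) < hub_size n \<and> snd (sl ! i) \<in> {1..q}"
    using slots_valid \<open>i < r\<close> by blast
qed (use q r_ge_2 in auto)

end

text \<open>There is an injection of the \<open>2 ^ t\<close> bit patterns into the
  \<open>q ^ s\<close> words; its inverse decodes.\<close>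

lemma ex_block_decoder:
  fixes q s t :: nat
  assumes "2 ^ t \<le> q ^ s"
  shows "\<exists>dec. \<forall>f :: nat \<Rightarrow> bool. \<exists>w. length w = s \<and> set w \<subseteq> {1..q} \<and>
    (\<forall>i<t. odd (dec w div (2::nat) ^ i) = f i)"
proof -
  let ?A = "{w. set w \<subseteq> {1..q} \<and> length w = s}"
  have "card {..<(2::nat) ^ t} \<le> card ?A" using assms by (simp add: card_lists_length_eq)
  then obtain g where g: "inj_on g {..<(2::nat) ^ t}" "g ` {..<2 ^ t} \<subseteq> ?A"
    using card_le_inj[of "{..<(2::nat) ^ t}" ?A] finite_lists_length_eq[of "{1..q}" s] by auto
  show ?thesis
  proof (intro exI[of _ "inv_into {..<2 ^ t} g"] allI)
    fix f :: "nat \<Rightarrow> bool"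
    \<comment> \<open>The number with binary digits \<open>f\<close>; \<open>take_bit\<close> makes
      \<open>v < 2 ^ t\<close> immediate.\<close>
    define v :: nat where "v = take_bit t (horner_sum of_bool 2 (map f [0..<t]))"
    have v: "v < 2 ^ t" by (simp add: v_def)
    have "odd (v div 2 ^ i) = f i" if "i < t" for i
      using that unfolding bit_iff_odd[symmetric] v_def by (simp add: bit_simps)
    then have "length (g v) = s \<and> set (g v) \<subseteq> {1..q} \<and>
      (\<forall>i<t. odd (inv_into {..<2 ^ t} g (g v) div 2 ^ i) = f i)" using g v by auto
    then show "\<exists>w. length w = s \<and> set w \<subseteq> {1..q} \<and>
      (\<forall>i<t. odd (inv_into {..<2 ^ t} g w div 2 ^ i) = f i)" by blast
  qed
qed


section \<open>The reduction as a program\<close>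

text \<open>The part of a gadget that does not involve the hub, as offsets. These are constants of
  the program; only the base vertex is added at run time.\<close>

definition inner_edges :: "nat \<Rightarrow> (nat \<times> nat) list" where
  "inner_edges r = clique_edges (2 * r - 1) 0
    @ map (\<lambda>i. (i, 2 * r + i)) [0..<r]
    @ map (\<lambda>i. (r, 2 * r + i)) [0..<r]
    @ map (\<lambda>i. (2 * r + i, 3 * r + i)) [0..<r]"

lemma gadget_edges_shift:
  "gadget_edges r b sl = map (\<lambda>(u, v). (b + u, b + v)) (inner_edges r)
    @ map (\<lambda>i. (fst (sl ! i), b + attachment r (snd (sl ! i)) i)) [0..<r]"
  by (simp add: gadget_edges_def inner_edges_def clique_edges_def map_concat o_def)

lemma encode_edges_append: "encode_edges (es @ fs) = encode_edges es @ encode_edges fs"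
  by (simp add: encode_edges_def)

lemma length_encode_edges: "length (encode_edges es) = 2 * length es"
  by (induction es) (auto simp: encode_edges_def)

text \<open>The same \<open>blocks\<close> recursion describes the graph and the emitted numbers, so
  the correctness of a pass reduces to a single gadget.\<close>

lemma encode_edges_blocks:
  "encode_edges (blocks N f b gs) = blocks N (\<lambda>b sl. encode_edges (f b sl)) b gs"
  by (induction gs arbitrary: b) (simp_all add: encode_edges_append, simp add: encode_edges_def)

lemma length_encode_clause: "length (encode_clause C) = 1 + 2 * length C"
  by (induction C) (auto simp: encode_clause_def)

lemma encode_clause_nth:
  "encode_clause C ! 0 = length C"
  "l < length C \<Longrightarrow> encode_clause C ! (1 + 2 * l) = fst (C ! l)"
  "l < length C \<Longrightarrow> encode_clause C ! (2 + 2 * l) = of_bool (snd (C ! l))"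
proof -
  have "concat (map (\<lambda>(x, b). [x, of_bool b :: nat]) C) ! (2 * l) = fst (C ! l) \<and>
      concat (map (\<lambda>(x, b). [x, of_bool b]) C) ! Suc (2 * l) = of_bool (snd (C ! l))"
    if "l < length C" for l
    using that
  proof (induction C arbitrary: l)
    case (Cons c C)
    then show ?case by (cases l) (auto split: prod.splits)
  qed simp
  then show "l < length C \<Longrightarrow> encode_clause C ! (1 + 2 * l) = fst (C ! l)"
    "l < length C \<Longrightarrow> encode_clause C ! (2 + 2 * l) = of_bool (snd (C ! l))"
    by (simp_all add: encode_clause_def)
qed (simp add: encode_clause_def)

lemma tameI:
  assumes "\<And>s :: memory. \<exists>i. eval e s \<le> s b i + k" "b \<noteq> \<omega>"
  shows "tame \<rho> \<omega> e"
  unfolding tame_def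
proof (intro exI[of _ "\<lambda>_. k"] conjI allI impI)
  fix s :: memory and L M assume M: "\<forall>b i. b \<noteq> \<omega> \<longrightarrow> s b i \<le> M"
  obtain i where "eval e s \<le> s b i + k" using assms(1) by blast
  moreover have "s b i \<le> M" using M assms(2) by simp
  ultimately show "eval e s \<le> M + k" by linarith
qed (rule poly_bounded_const)

lemma tame_params:
  assumes "reads e \<subseteq> {\<rho>}"
  shows "tame \<rho> \<omega> e"
proof -
  obtain h where "poly_bounded h"
    "\<And>s M. \<forall>b \<in> reads e. \<forall>i. s b i \<le> M \<Longrightarrow> eval e s \<le> h M \<and> expr_cost e s \<le> h M"
    using expr_poly_bounded by blast
  then show ?thesis
    unfolding tame_def using assms by (intro exI[of _ h]) (auto simp: subset_iff intro!: trans_le_add2)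
qed

text \<open>The step may use that the counter equals the round number and that unwritten banks still
  have their contents from before the loop.\<close>

lemma run_For_invariant:
  assumes "v \<notin> writes c" and "I 0 (upd v 0 0 s)"
    and step: "\<And>i s'. \<lbrakk>i < eval e s; I i s'; s' v 0 = i; \<And>b. b \<notin> insert v (writes c) \<Longrightarrow> s' b = s b\<rbrakk>
      \<Longrightarrow> I (Suc i) (upd v 0 (Suc i) (run c s'))"
  shows "I (eval e s) (run (For v e c) s)"
proof -
  let ?f = "\<lambda>s. upd v 0 (Suc (run c s v 0)) (run c s)"
  have "I k ((?f ^^ k) (upd v 0 0 s)) \<and> (?f ^^ k) (upd v 0 0 s) v 0 = k \<and>
      (\<forall>b. b \<notin> insert v (writes c) \<longrightarrow> (?f ^^ k) (upd v 0 0 s) b = s b)" if "k \<le> eval e s" for k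
    using that
  proof (induction k)
    case (Suc k)
    let ?s = "(?f ^^ k) (upd v 0 0 s)"
    have IH: "I k ?s" "?s v 0 = k" "\<And>b. b \<notin> insert v (writes c) \<Longrightarrow> ?s b = s b" using Suc by auto
    have "I (Suc k) (upd v 0 (Suc k) (run c ?s))" by (rule step) (use Suc.prems IH in auto)
    moreover have "run c ?s v 0 = k" using IH(2) run_frame[OF assms(1)] by simp
    ultimately show ?case using IH(3) run_frame[of _ c ?s] by simp
  qed (use assms(2) in simp)
  then show ?thesis by simp
qed

definition seqs :: "cmd list \<Rightarrow> cmd" where
  "seqs cs = foldr Then cs Nop"

lemma seqs_simps [simp]:
  "run (seqs []) s = s" "run (seqs (c # cs)) s = run (seqs cs) (run c s)"
  "writes (seqs cs) = (\<Union>c \<in> set cs. writes c)"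
  "wf_cmd \<rho> \<omega> (seqs cs) \<longleftrightarrow> (\<forall>c \<in> set cs. wf_cmd \<rho> \<omega> c)"
proof -
  show "writes (seqs cs) = (\<Union>c \<in> set cs. writes c)" by (induction cs) (auto simp: seqs_def)
  show "wf_cmd \<rho> \<omega> (seqs cs) \<longleftrightarrow> (\<forall>c \<in> set cs. wf_cmd \<rho> \<omega> c)" by (induction cs) (auto simp: seqs_def)
qed (simp_all add: seqs_def)

definition modE :: "expr \<Rightarrow> nat \<Rightarrow> expr" where
  "modE e c = Sub e (Mul (Div e (Const c)) (Const c))"

lemma modE_simps [simp]: "eval (modE e c) s = eval e s mod c" "reads (modE e c) = reads e"
  by (simp_all add: modE_def minus_div_mult_eq_mod)

text \<open>The deletion algorithm uses no bank above \<open>B\<close>, so the banks above it are free for the reduction.\<close>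

locale reduction = block_encoding +
  fixes B :: nat
begin

abbreviation "PAR \<equiv> B + 10"
abbreviation "INP \<equiv> B + 2"
abbreviation "OUT \<equiv> B + 3"
abbreviation "CLP \<equiv> B + 4"
abbreviation "VTX \<equiv> B + 5"
abbreviation "POW \<equiv> B + 6"
abbreviation "CTR \<equiv> B + 7"

abbreviation "N \<equiv> gadget_size r"

text \<open>Bank 0 is the write-only bank of the generator, so emitted expressions such as the
  products in \<open>hubE\<close> need no \<open>tame\<close> bound; only the pointer in
  \<open>OUT\<close> does.\<close>

definition emit :: "expr \<Rightarrow> cmd" where
  "emit e = Then (Put 0 (Get OUT (Const 0)) e) (Put OUT (Const 0) (Add (Get OUT (Const 0)) (Const 1)))"

definition emits :: "expr list \<Rightarrow> cmd" where
  "emits es = seqs (map emit es)"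

text \<open>Cell 0 is reserved for the length, which is stored last; until then it is 0.
  \<open>OUT\<close> holds the next free cell.\<close>

definition outputs :: "memory \<Rightarrow> nat list \<Rightarrow> bool" where
  "outputs m xs \<longleftrightarrow> m OUT 0 = Suc (length xs) \<and>
     m 0 = (\<lambda>i. if 1 \<le> i \<and> i \<le> length xs then xs ! (i - 1) else 0)"

lemma outputs_upd [simp]: "b \<noteq> 0 \<Longrightarrow> b \<noteq> OUT \<Longrightarrow> outputs (upd b i x m) xs = outputs m xs"
  by (simp add: outputs_def)

lemma emit_writes [simp]: "writes (emit e) = {0, OUT}"
  by (auto simp: emit_def)

lemma emits_writes: "writes (emits es) \<subseteq> {0, OUT}"
  by (auto simp: emits_def)

lemma emits_wf: "\<forall>e \<in> set es. 0 \<notin> reads e \<Longrightarrow> wf_cmd PAR 0 (emits es)"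
  by (auto simp: emits_def emit_def intro!: tameI[of _ OUT 1] exI[of _ 0])

lemma outputs_emit: "outputs m xs \<Longrightarrow> outputs (run (emit e) m) (xs @ [eval e m])"
  by (auto simp: outputs_def emit_def fun_eq_iff nth_append)

lemma outputs_emits:
  assumes "outputs m xs" "\<forall>e \<in> set es. 0 \<notin> reads e \<and> OUT \<notin> reads e"
  shows "outputs (run (emits es) m) (xs @ map (\<lambda>e. eval e m) es)"
  using assms
proof (induction es arbitrary: m xs)
  case (Cons e es)
  have "outputs (run (emits es) (run (emit e) m)) ((xs @ [eval e m]) @ map (\<lambda>e'. eval e' (run (emit e) m)) es)"
    using Cons by (intro Cons.IH) (auto intro: outputs_emit)
  moreover have "map (\<lambda>e'. eval e' (run (emit e) m)) es = map (\<lambda>e'. eval e' m) es"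
  proof (rule map_cong[OF refl])
    fix e' assume "e' \<in> set es"
    then show "eval e' (run (emit e) m) = eval e' m"
      using Cons.prems(2) by (intro eval_cong run_frame) (metis emit_writes insertE list.set_intros(2) singletonD)
  qed
  ultimately show ?case by (simp add: emits_def)
qed (simp add: emits_def)

section \<open>Passes over the clauses of the input\<close>

definition clauseE :: "nat \<Rightarrow> expr" where
  "clauseE i = Get INP (Add (Get CLP (Const 0)) (Const i))"

definition vertexE :: "nat \<Rightarrow> expr" where
  "vertexE i = Add (Get VTX (Const 0)) (Const i)"

text \<open>A sum used as a disjunction. The truncated difference of clause length and
  \<open>l\<close> is nonzero iff the literal exists. The residue mod 2 is 1 iff the decoded bit
  equals the sign; the division by a table entry from \<open>POW\<close> shifts the bit
  down.\<close>

definition satE :: "nat list \<Rightarrow> expr" where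
  "satE a = foldr (\<lambda>l e. Add (Mul (Sub (clauseE 0) (Const l))
      (modE (Add (Add (Div (Const (dec (word_at a l))) (Get POW (modE (clauseE (1 + 2 * l)) t)))
        (clauseE (2 + 2 * l))) (Const 1)) 2)) e) [0..<\<kappa>] (Const 0)"

text \<open>The nested truncated subtractions yield 1 if position \<open>i div s\<close> exists in
  the clause and 0 otherwise, which realises the default block 0.\<close>

definition hubE :: "nat \<Rightarrow> expr" where
  "hubE i = Add (Mul (Const s) (Mul (Div (clauseE (1 + 2 * (i div s))) (Const t))
      (Sub (Const 1) (Sub (Const 1) (Sub (clauseE 0) (Const (i div s))))))) (Const (i mod s))"

definition hubsizeE :: expr where
  "hubsizeE = Mul (Const s) (Add (Div (Get PAR (Const 1)) (Const t)) (Const 1))"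

definition clause_at :: "memory \<Rightarrow> clause \<Rightarrow> bool" where
  "clause_at m C \<longleftrightarrow> length C \<le> \<kappa> \<and> m INP (m CLP 0) = length C \<and>
     (\<forall>l < length C. m INP (m CLP 0 + (1 + 2 * l)) = fst (C ! l) \<and>
        m INP (m CLP 0 + (2 + 2 * l)) = of_bool (snd (C ! l))) \<and>
     (\<forall>i<t. m POW i = 2 ^ i)"

lemma clause_at_cong:
  "m INP = m' INP \<Longrightarrow> m CLP = m' CLP \<Longrightarrow> m POW = m' POW \<Longrightarrow> clause_at m C = clause_at m' C"
  by (simp add: clause_at_def)

lemma satE_eval:
  assumes "clause_at m C"
  shows "eval (satE a) m \<noteq> 0 \<longleftrightarrow> tuple_sat C a"
proof -
  let ?term = "\<lambda>l. (m INP (m CLP 0) - l) *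
     ((dec (word_at a l) div m POW (m INP (m CLP 0 + (1 + 2 * l)) mod t) + m INP (m CLP 0 + (2 + 2 * l)) + 1) mod 2)"
  have "eval (foldr (\<lambda>l e. Add (Mul (Sub (clauseE 0) (Const l))
      (modE (Add (Add (Div (Const (dec (word_at a l))) (Get POW (modE (clauseE (1 + 2 * l)) t)))
        (clauseE (2 + 2 * l))) (Const 1)) 2)) e) ls (Const 0)) m \<noteq> 0 \<longleftrightarrow> (\<exists>l \<in> set ls. ?term l \<noteq> 0)" for ls
    by (induction ls) (auto simp: clauseE_def simp del: mult_Suc_right)
  moreover have "?term l \<noteq> 0 \<longleftrightarrow> l < length C \<and>
     odd (dec (word_at a l) div 2 ^ (fst (C ! l) mod t)) = snd (C ! l)" for l
  proof (cases "l < length C")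
    case True
    have "fst (C ! l) mod t < t" using t by simp
    moreover have "(x + of_bool b + 1) mod 2 \<noteq> 0 \<longleftrightarrow> odd x = b" for x :: nat and b
      by (cases b) (simp_all add: mod_2_eq_odd)
    ultimately show ?thesis using assms True by (simp add: clause_at_def)
  next
    case False
    then show ?thesis using assms by (simp add: clause_at_def)
  qed
  ultimately show ?thesis by (auto simp: satE_def tuple_sat_def)
qed

lemma hubE_eval:
  assumes "clause_at m C"
  shows "eval (hubE i) m = s * block_of C (i div s) + i mod s"
  using assms by (auto simp: hubE_def clauseE_def clause_at_def block_of_def)

lemma clause_reads:
  "reads (satE a) \<subseteq> {INP, CLP, POW}" "reads (hubE i) \<subseteq> {INP, CLP}" "reads (vertexE i) = {VTX}"
proof -
  have "reads (foldr (\<lambda>l e. Add (Mul (Sub (clauseE 0) (Const l))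
      (modE (Add (Add (Div (Const (dec (word_at a l))) (Get POW (modE (clauseE (1 + 2 * l)) t)))
        (clauseE (2 + 2 * l))) (Const 1)) 2)) e) ls (Const 0)) \<subseteq> {INP, CLP, POW}" for ls
    by (induction ls) (auto simp: clauseE_def)
  then show "reads (satE a) \<subseteq> {INP, CLP, POW}" by (simp add: satE_def)
qed (auto simp: hubE_def clauseE_def vertexE_def)

definition gadget_cmd :: "(bool \<Rightarrow> nat list \<Rightarrow> expr list) \<Rightarrow> nat list \<Rightarrow> cmd" where
  "gadget_cmd X a = Then (If (satE a) (emits (X True a)) (emits (X False a)))
     (Put VTX (Const 0) (vertexE N))"

text \<open>The tuples are unrolled, as their number is a constant. The two subtractions compute the
  minimum of the clause length and \<open>\<kappa>\<close>; on valid inputs this is the length, and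
  it keeps the advance of the pointer bounded by a constant, as \<open>tame\<close> demands.\<close>

definition clause_cmd :: "(bool \<Rightarrow> nat list \<Rightarrow> expr list) \<Rightarrow> cmd" where
  "clause_cmd X = Then (seqs (map (gadget_cmd X) tuples))
     (Put CLP (Const 0) (Add (Get CLP (Const 0)) (Add (Const 1)
        (Mul (Const 2) (Sub (clauseE 0) (Sub (clauseE 0) (Const \<kappa>)))))))"

text \<open>Cells 0 to 2 hold the input length, \<open>n\<close> and the number of clauses, so the
  first clause starts at cell 3. Gadget vertices start right after the hub.\<close>

definition pass_cmd :: "(bool \<Rightarrow> nat list \<Rightarrow> expr list) \<Rightarrow> cmd" where
  "pass_cmd X = Then (Put CLP (Const 0) (Const 3)) (Then (Put VTX (Const 0) hubsizeE)
     (For CTR (Get PAR (Const 2)) (clause_cmd X)))"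

text \<open>The instance encoding lists all edges before all colour lists, so the clauses are
  traversed twice; this interface lets both passes share one proof. The Boolean argument of
  \<open>X\<close> tells whether the tuple satisfies the clause.\<close>

definition emission :: "(bool \<Rightarrow> nat list \<Rightarrow> expr list) \<Rightarrow> (nat \<Rightarrow> (nat \<times> nat) list \<Rightarrow> nat list) \<Rightarrow> bool" where
  "emission X Y \<longleftrightarrow> (\<forall>b a. \<forall>e \<in> set (X b a). 0 \<notin> reads e \<and> OUT \<notin> reads e) \<and>
     (\<forall>m C a. clause_at m C \<longrightarrow> map (\<lambda>e. eval e m) (X (tuple_sat C a) a) = Y (m VTX 0) (slots C a))"

lemma gadget_cmd_writes: "writes (gadget_cmd X a) \<subseteq> {0, OUT, VTX}"
  using emits_writes by (auto simp: gadget_cmd_def)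

lemma clause_cmd_writes: "writes (clause_cmd X) \<subseteq> {0, OUT, VTX, CLP}"
  using gadget_cmd_writes by (fastforce simp: clause_cmd_def)

lemma pass_cmd_writes: "writes (pass_cmd X) \<subseteq> {0, OUT, VTX, CLP, CTR}"
  using clause_cmd_writes by (fastforce simp: pass_cmd_def)

lemma run_gadget_cmd:
  assumes X: "emission X Y" and C: "clause_at m C" and out: "outputs m xs"
  shows "outputs (run (gadget_cmd X a) m) (xs @ Y (m VTX 0) (slots C a))"
    "run (gadget_cmd X a) m VTX 0 = m VTX 0 + N"
proof -
  let ?es = "X (tuple_sat C a) a"
  define m' where "m' = run (emits ?es) m"
  have "outputs m' (xs @ map (\<lambda>e. eval e m) ?es)"
    unfolding m'_def using X by (intro outputs_emits[OF out]) (auto simp: emission_def)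
  then have out': "outputs m' (xs @ Y (m VTX 0) (slots C a))" using X C by (auto simp: emission_def)
  have vtx: "m' VTX = m VTX" unfolding m'_def using emits_writes[of ?es] by (intro run_frame) auto
  have "run (gadget_cmd X a) m = upd VTX 0 (m' VTX 0 + N) m'"
    using satE_eval[OF C, of a] by (cases "tuple_sat C a") (simp_all add: gadget_cmd_def m'_def vertexE_def)
  then show "outputs (run (gadget_cmd X a) m) (xs @ Y (m VTX 0) (slots C a))"
    "run (gadget_cmd X a) m VTX 0 = m VTX 0 + N"
    using out' vtx by simp_all
qed

lemma run_gadget_cmds:
  assumes X: "emission X Y"
  shows "\<lbrakk>clause_at m C; outputs m xs\<rbrakk> \<Longrightarrow>
    outputs (run (seqs (map (gadget_cmd X) as)) m) (xs @ blocks N Y (m VTX 0) (map (slots C) as)) \<and>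
    run (seqs (map (gadget_cmd X) as)) m VTX 0 = m VTX 0 + length as * N"
proof (induction as arbitrary: m xs)
  case (Cons a as)
  let ?m = "run (gadget_cmd X a) m"
  have "clause_at ?m C"
    using Cons.prems(1) gadget_cmd_writes[of X a]
    by (subst clause_at_cong[of _ m]) (auto intro!: run_frame)
  from Cons.IH[OF this run_gadget_cmd(1)[OF X Cons.prems]] show ?case
    using run_gadget_cmd(2)[OF X Cons.prems] by (simp add: add.assoc)
qed simp

lemma clause_at_input:
  assumes F: "kCNF k n F" "k \<le> \<kappa>" and i: "i < length F"
    and m: "m INP = input_memory (encode_CNF n F) 0" "\<forall>i<t. m POW i = 2 ^ i"
      "m CLP 0 = 3 + length (concat (map encode_clause (take i F)))"
  shows "clause_at m (F ! i)"
proof -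
  let ?pre = "concat (map encode_clause (take i F))" and ?C = "F ! i"
  have F_eq: "F = take i F @ ?C # drop (Suc i) F" using i by (rule id_take_nth_drop)
  have "encode_CNF n F = [n, length F] @ concat (map encode_clause (take i F @ ?C # drop (Suc i) F))"
    using F_eq by (simp add: encode_CNF_def)
  then have enc: "encode_CNF n F = ([n, length F] @ ?pre) @ encode_clause ?C @ concat (map encode_clause (drop (Suc i) F))"
    by simp
  have cell: "m INP (m CLP 0 + j) = encode_clause ?C ! j" if "j < length (encode_clause ?C)" for j
  proof -
    have "m CLP 0 + j = Suc (length ([n, length F] @ ?pre) + j)" by (simp add: m(3))
    then have "m INP (m CLP 0 + j) = encode_CNF n F ! (length ([n, length F] @ ?pre) + j)"
      unfolding m(1) using that by (simp add: input_memory_def enc)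
    also have "\<dots> = encode_clause ?C ! j"
      unfolding enc nth_append_length_plus using that by (simp add: nth_append)
    finally show ?thesis .
  qed
  have "length ?C \<le> \<kappa>" using F nth_mem[OF i] unfolding kCNF_def by (meson order.trans)
  then show ?thesis
    using cell[of 0] cell[of "1 + 2 * l" for l] cell[of "2 + 2 * l" for l] encode_clause_nth[where C = ?C] m(2)
    by (simp add: clause_at_def length_encode_clause)
qed

lemma run_pass_cmd:
  assumes X: "emission X Y" and F: "kCNF k n F" "k \<le> \<kappa>" and out: "outputs m xs"
    and m: "m INP = input_memory (encode_CNF n F) 0" "\<forall>i<t. m POW i = 2 ^ i"
      "m PAR 1 = n" "m PAR 2 = length F"
  shows "outputs (run (pass_cmd X) m) (xs @ blocks N Y (hub_size n) (gadgets F))"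
proof -
  define m0 where "m0 = upd VTX 0 (hub_size n) (upd CLP 0 3 m)"
  have run: "run (pass_cmd X) m = run (For CTR (Get PAR (Const 2)) (clause_cmd X)) m0"
    using m(3) by (simp add: pass_cmd_def m0_def hubsizeE_def hub_size_def)
  define I where "I i m' \<longleftrightarrow> outputs m' (xs @ blocks N Y (hub_size n) (gadgets (take i F))) \<and>
      m' VTX 0 = hub_size n + length (gadgets (take i F)) * N \<and>
      m' CLP 0 = 3 + length (concat (map encode_clause (take i F)))" for i m'
  have "I (eval (Get PAR (Const 2)) m0) (run (For CTR (Get PAR (Const 2)) (clause_cmd X)) m0)"
  proof (rule run_For_invariant)
    show "CTR \<notin> writes (clause_cmd X)" using clause_cmd_writes by fastforce
    show "I 0 (upd CTR 0 0 m0)" using out by (simp add: I_def m0_def gadgets_def)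
  next
    fix i m' assume i: "i < eval (Get PAR (Const 2)) m0" and I: "I i m'" and
      frame: "\<And>b. b \<notin> insert CTR (writes (clause_cmd X)) \<Longrightarrow> m' b = m0 b"
    have i': "i < length F" using i m(4) by (simp add: m0_def)
    have same: "m' INP = m INP" "m' POW = m POW"
      using frame[of INP] frame[of POW] clause_cmd_writes by (fastforce simp: m0_def)+
    have at: "clause_at m' (F ! i)"
      by (rule clause_at_input[OF F i']) (use I m same in \<open>auto simp: I_def\<close>)
    let ?c = "seqs (map (gadget_cmd X) tuples)"
    let ?m = "run ?c m'"
    have out': "outputs ?m ((xs @ blocks N Y (hub_size n) (gadgets (take i F))) @
        blocks N Y (m' VTX 0) (map (slots (F ! i)) tuples))"
      and vtx: "?m VTX 0 = m' VTX 0 + length tuples * N"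
      using run_gadget_cmds[OF X at, of "xs @ blocks N Y (hub_size n) (gadgets (take i F))" tuples] I
      unfolding I_def by blast+
    have keep: "?m CLP = m' CLP" "?m INP = m' INP"
      using gadget_cmd_writes by (intro run_frame; fastforce)+
    have len: "?m INP (?m CLP 0) = length (F ! i)" "length (F ! i) \<le> \<kappa>"
      using at keep by (auto simp: clause_at_def)
    have run: "run (clause_cmd X) m' = upd CLP 0 (m' CLP 0 + (1 + 2 * length (F ! i))) ?m"
      using len keep by (simp add: clause_cmd_def clauseE_def)
    have g: "gadgets (take (Suc i) F) = gadgets (take i F) @ map (slots (F ! i)) tuples"
      using i' by (simp add: take_Suc_conv_app_nth gadgets_def)
    have e: "length (concat (map encode_clause (take (Suc i) F))) =
        length (concat (map encode_clause (take i F))) + (1 + 2 * length (F ! i))"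
      using i' by (simp add: take_Suc_conv_app_nth length_encode_clause)
    show "I (Suc i) (upd CTR 0 (Suc i) (run (clause_cmd X) m'))"
      unfolding I_def g e blocks_append run using out' vtx I by (simp add: I_def add_mult_distrib)
  qed
  then show ?thesis using m(4) by (simp add: run I_def m0_def)
qed

end

lemma concat_map_upt_blocks:
  "concat (map h [b..<b + k * N]) = concat (map (\<lambda>g. concat (map (\<lambda>j. h (b + g * N + j)) [0..<N])) [0..<k])"
proof (induction k)
  case (Suc k)
  have "[b..<b + Suc k * N] = [b..<b + k * N] @ [b + k * N..<b + k * N + N]"
    using upt_add_eq_append[of b "b + k * N" N] by (simp add: algebra_simps)
  moreover have "map h [b + k * N..<b + k * N + N] = map (\<lambda>j. h (b + k * N + j)) [0..<N]"
    by (rule nth_equalityI) simp_all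
  ultimately show ?case using Suc by simp
qed simp

lemma gadget_list_cong:
  assumes "\<And>i. i < r \<Longrightarrow> snd (sl ! i) = snd (sl' ! i)" "j < gadget_size r"
  shows "gadget_list r sl j = gadget_list r sl' j"
  using assms(1)[of "j - 3 * r"] assms(2) by (auto simp: gadget_list_def gadget_size_def)

lemma eval_concat_map:
  "map (\<lambda>e. eval e m) (concat (map f xs)) = concat (map (\<lambda>x. map (\<lambda>e. eval e m) (f x)) xs)"
  by (simp add: map_concat o_def)

context reduction
begin

section \<open>The edge pass, the list pass and the generated instance\<close>

definition attachE :: "(nat \<Rightarrow> expr) \<Rightarrow> (nat \<Rightarrow> nat) \<Rightarrow> expr list" where
  "attachE H c = concat (map (\<lambda>i. [H i, vertexE (attachment r (c i) i)]) [0..<r])"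

definition target :: "bool \<Rightarrow> nat list \<Rightarrow> nat \<Rightarrow> nat" where
  "target b a i = (if b then if i = 0 then 1 else 2 else a ! i)"

definition edgesX :: "bool \<Rightarrow> nat list \<Rightarrow> expr list" where
  "edgesX b a = concat (map (\<lambda>(u, v). [vertexE u, vertexE v]) (inner_edges r)) @
     attachE (\<lambda>i. if b then Const 0 else hubE i) (target b a)"

definition edgesY :: "nat \<Rightarrow> (nat \<times> nat) list \<Rightarrow> nat list" where
  "edgesY v sl = encode_edges (gadget_edges r v sl)"

text \<open>The colour lists depend on the targets but not on the hub vertices, so 0 stands in for
  each hub vertex and all entries are constants.\<close>

definition listsX :: "bool \<Rightarrow> nat list \<Rightarrow> expr list" where
  "listsX b a = concat (map (\<lambda>j. map (\<lambda>c. Const (of_bool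
      (c \<in> gadget_list r (map (\<lambda>i. (0, target b a i)) [0..<r]) j))) [1..<Suc q]) [0..<N])"

definition listsY :: "nat \<Rightarrow> (nat \<times> nat) list \<Rightarrow> nat list" where
  "listsY v sl = concat (map (\<lambda>j. map (\<lambda>c. of_bool (c \<in> gadget_list r sl j)) [1..<Suc q]) [0..<N])"

lemma slots_nth:
  "i < r \<Longrightarrow> slots C a ! i = (if tuple_sat C a then 0 else s * block_of C (i div s) + i mod s,
     target (tuple_sat C a) a i)"
  by (simp add: slots_def target_def)

lemma edges_emission: "emission edgesX edgesY"
  unfolding emission_def
proof (intro conjI allI impI ballI)
  fix m C a assume C: "clause_at m C"
  have "map (\<lambda>e. eval e m) (concat (map (\<lambda>(u, v). [vertexE u, vertexE v]) (inner_edges r))) =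
      encode_edges (map (\<lambda>(u, v). (m VTX 0 + u, m VTX 0 + v)) (inner_edges r))"
    by (simp add: map_concat encode_edges_def o_def case_prod_unfold vertexE_def)
  moreover have "map (\<lambda>e. eval e m) (attachE (\<lambda>i. if tuple_sat C a then Const 0 else hubE i) (target (tuple_sat C a) a)) =
      encode_edges (map (\<lambda>i. (fst (slots C a ! i), m VTX 0 + attachment r (snd (slots C a ! i)) i)) [0..<r])"
    unfolding attachE_def eval_concat_map encode_edges_def map_map o_def
    by (intro arg_cong[where f = concat] map_cong) (auto simp: slots_nth hubE_eval[OF C] vertexE_def)
  ultimately show "map (\<lambda>e. eval e m) (edgesX (tuple_sat C a) a) = edgesY (m VTX 0) (slots C a)"
    unfolding edgesX_def edgesY_def gadget_edges_shift encode_edges_append map_append by simp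
next
  fix b a e assume "e \<in> set (edgesX b a)"
  then show "0 \<notin> reads e" "OUT \<notin> reads e"
    using clause_reads(2) by (fastforce simp: edgesX_def attachE_def clause_reads split: if_splits)+
qed

lemma lists_emission: "emission listsX listsY"
  unfolding emission_def
proof (intro conjI allI impI ballI)
  fix m C a
  have "gadget_list r (map (\<lambda>i. (0, target (tuple_sat C a) a i)) [0..<r]) j = gadget_list r (slots C a) j"
    if "j < N" for j
    by (rule gadget_list_cong[OF _ that]) (simp add: slots_nth)
  then show "map (\<lambda>e. eval e m) (listsX (tuple_sat C a) a) = listsY (m VTX 0) (slots C a)"
    unfolding listsX_def listsY_def eval_concat_map map_map o_def
    by (intro arg_cong[where f = concat] map_cong) auto
qed (auto simp: listsX_def)

lemma run_For_emits:
  assumes out: "outputs m xs" and reads: "\<forall>e \<in> set es. 0 \<notin> reads e \<and> OUT \<notin> reads e"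
    and f: "\<And>m'. map (\<lambda>e. eval e m') es = f (m' CTR 0)"
  shows "outputs (run (For CTR e (emits es)) m) (xs @ concat (map f [0..<eval e m]))"
proof (rule run_For_invariant[where I = "\<lambda>i m'. outputs m' (xs @ concat (map f [0..<i]))"])
  show "CTR \<notin> writes (emits es)" using emits_writes by fastforce
  fix i m' assume "outputs m' (xs @ concat (map f [0..<i]))" "m' CTR 0 = i"
  then show "outputs (upd CTR 0 (Suc i) (run (emits es) m')) (xs @ concat (map f [0..<Suc i]))"
    using outputs_emits[of m' "xs @ concat (map f [0..<i])" es] reads f by simp
qed (use out in simp)

definition table_cmd :: cmd where
  "table_cmd = seqs (map (\<lambda>i. Put POW (Const i) (Const (2 ^ i))) [0..<t])"

lemma run_table_cmd: "i < t \<Longrightarrow> run table_cmd m POW i = 2 ^ i"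
proof -
  have "run (seqs (map (\<lambda>i. Put POW (Const i) (Const (2 ^ i))) is)) m POW i =
      (if i \<in> set is then 2 ^ i else m POW i)" for "is" m
    by (induction "is" arbitrary: m) auto
  then show "i < t \<Longrightarrow> run table_cmd m POW i = 2 ^ i" by (simp add: table_cmd_def)
qed

lemma table_cmd_writes: "writes table_cmd \<subseteq> {POW}"
  by (auto simp: table_cmd_def)

definition gadget_edge_count :: nat where
  "gadget_edge_count = length (inner_edges r) + r"

definition vertex_countE :: expr where
  "vertex_countE = Add hubsizeE (Mul (Get PAR (Const 2)) (Const (length tuples * N)))"

definition edge_countE :: expr where
  "edge_countE = Mul (Get PAR (Const 2)) (Const (length tuples * gadget_edge_count))"

text \<open>The order is that of \<open>encode_instance\<close>; the rows of ones are the full lists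
  of the hub vertices. The length in cell 0 comes last, when it is known.\<close>

definition generate_cmd :: cmd where
  "generate_cmd = seqs [table_cmd, Put OUT (Const 0) (Const 1), emits [vertex_countE, edge_countE],
     pass_cmd edgesX, For CTR hubsizeE (emits (map (\<lambda>_. Const 1) [1..<Suc q])), pass_cmd listsX,
     emits [hubsizeE], For CTR hubsizeE (emits [Get CTR (Const 0)]),
     Put 0 (Const 0) (Sub (Get OUT (Const 0)) (Const 1))]"

definition instance_of :: "nat \<Rightarrow> clause list \<Rightarrow> nat list" where
  "instance_of n F = encode_instance q (hub_size n + length (gadgets F) * N)
     (instance_edges r (hub_size n) (gadgets F))
     (instance_lists q r (hub_size n) (gadgets F)) [0..<hub_size n]"

lemma length_gadget_edges: "length (gadget_edges r v sl) = gadget_edge_count"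
  by (simp add: gadget_edges_shift gadget_edge_count_def)

lemma length_instance_edges: "length (instance_edges r p gs) = length gs * gadget_edge_count"
proof -
  have "length (blocks N (gadget_edges r) p gs) = length gs * gadget_edge_count"
    by (induction gs arbitrary: p) (auto simp: length_gadget_edges)
  then show ?thesis by (simp add: instance_edges_def)
qed

lemma instance_lists_blocks:
  "concat (map (\<lambda>v. map (\<lambda>c. of_bool (c \<in> instance_lists q r p gs v)) [1..<Suc q]) [0..<p + length gs * N]) =
   concat (map (\<lambda>_. map (\<lambda>_. 1) [1..<Suc q]) [0..<p]) @ blocks N listsY p gs"
proof -
  let ?h = "\<lambda>v. map (\<lambda>c. of_bool (c \<in> instance_lists q r p gs v)) [1..<Suc q] :: nat list"
  have "map ?h [0..<p] = map (\<lambda>_. map (\<lambda>_. 1) [1..<Suc q]) [0..<p]"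
    by (auto simp: instance_lists_def)
  moreover have "concat (map (\<lambda>j. ?h (p + g * N + j)) [0..<N]) = listsY (p + g * N) (gs ! g)" for g
    unfolding listsY_def
  proof (intro arg_cong[where f = concat] map_cong refl)
    fix j c assume "j \<in> set [0..<N]"
    then have "(g * N + j) div N = g" "(g * N + j) mod N = j" by auto
    then show "of_bool (c \<in> instance_lists q r p gs (p + g * N + j)) = of_bool (c \<in> gadget_list r (gs ! g) j)"
      by (simp add: instance_lists_def)
  qed
  moreover have "[0..<p + length gs * N] = [0..<p] @ [p..<p + length gs * N]"
    using upt_add_eq_append[of 0 p "length gs * N"] by simp
  ultimately show ?thesis
    by (simp only: map_append concat_append concat_map_upt_blocks blocks_conv_concat)
qed

lemma run_generate_cmd:
  assumes F: "kCNF k n F" "k \<le> \<kappa>"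
    and m: "m INP = input_memory (encode_CNF n F) 0" "m PAR 1 = n" "m PAR 2 = length F" "m 0 = (\<lambda>_. 0)"
  shows "run generate_cmd m 0 = input_memory (instance_of n F) 0"
proof -
  let ?p = "hub_size n" and ?gs = "gadgets F"
  define m1 where "m1 = run (Put OUT (Const 0) (Const 1)) (run table_cmd m)"
  define m2 where "m2 = run (emits [vertex_countE, edge_countE]) m1"
  define m3 where "m3 = run (pass_cmd edgesX) m2"
  define m4 where "m4 = run (For CTR hubsizeE (emits (map (\<lambda>_. Const 1) [1..<Suc q]))) m3"
  define m5 where "m5 = run (pass_cmd listsX) m4"
  define m6 where "m6 = run (emits [hubsizeE]) m5"
  define m7 where "m7 = run (For CTR hubsizeE (emits [Get CTR (Const 0)])) m6"
  have run: "run generate_cmd m = upd 0 0 (m7 OUT 0 - 1) m7"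
    by (simp add: generate_cmd_def m1_def m2_def m3_def m4_def m5_def m6_def m7_def)
  have f1: "m1 b = m b" if "b \<notin> {OUT, POW}" for b
    unfolding m1_def using that run_frame[of b table_cmd m] table_cmd_writes by auto
  have pow: "\<forall>i<t. m1 POW i = 2 ^ i" using run_table_cmd by (simp add: m1_def)
  have f2: "m2 b = m1 b" if "b \<notin> {0, OUT}" for b
    unfolding m2_def using that emits_writes by (intro run_frame) blast
  have f3: "m3 b = m2 b" if "b \<notin> {0, OUT, VTX, CLP, CTR}" for b
    unfolding m3_def using that pass_cmd_writes by (intro run_frame) blast
  have f4: "m4 b = m3 b" if "b \<notin> {0, OUT, CTR}" for b
    unfolding m4_def using that emits_writes by (intro run_frame) auto
  have f5: "m5 b = m4 b" if "b \<notin> {0, OUT, VTX, CLP, CTR}" for b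
    unfolding m5_def using that pass_cmd_writes by (intro run_frame) blast
  have f6: "m6 b = m5 b" if "b \<notin> {0, OUT}" for b
    unfolding m6_def using that emits_writes by (intro run_frame) blast
  have hubsize: "eval hubsizeE m' = ?p" if "m' PAR 1 = n" for m'
    using that by (simp add: hubsizeE_def hub_size_def)
  have r: "0 \<notin> reads hubsizeE" "OUT \<notin> reads hubsizeE" by (simp_all add: hubsizeE_def)
  have "m1 0 = (\<lambda>_. 0)" using f1[of 0] m(4) by simp
  then have "outputs m1 []" by (auto simp: outputs_def m1_def)
  then have "outputs m2 ([] @ map (\<lambda>e. eval e m1) [vertex_countE, edge_countE])"
    unfolding m2_def by (rule outputs_emits) (use r in \<open>auto simp: vertex_countE_def edge_countE_def\<close>)
  moreover have "m1 PAR 1 = n" "m1 PAR 2 = length F" using f1[of PAR] m by auto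
  ultimately have "outputs m2 [?p + length ?gs * N, length (instance_edges r ?p ?gs)]"
    by (simp add: vertex_countE_def edge_countE_def hubsize length_instance_edges length_gadgets mult.assoc)
  from run_pass_cmd[OF edges_emission F this]
  have "outputs m3 ([?p + length ?gs * N, length (instance_edges r ?p ?gs)] @ blocks N edgesY ?p ?gs)"
    unfolding m3_def using f1[of INP] f1[of PAR] f2[of INP] f2[of POW] f2[of PAR] pow m by auto
  then have "outputs m3 ([?p + length ?gs * N, length (instance_edges r ?p ?gs)] @
      encode_edges (instance_edges r ?p ?gs))"
    by (simp add: instance_edges_def encode_edges_blocks edgesY_def[abs_def])
  from run_For_emits[OF this, of "map (\<lambda>_. Const 1) [1..<Suc q]" "\<lambda>_. map (\<lambda>_. 1) [1..<Suc q]" hubsizeE]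
  have "outputs m4 (([?p + length ?gs * N, length (instance_edges r ?p ?gs)] @
      encode_edges (instance_edges r ?p ?gs)) @ concat (map (\<lambda>_. map (\<lambda>_. 1) [1..<Suc q]) [0..<?p]))"
    unfolding m4_def using f1[of PAR] f2[of PAR] f3[of PAR] m(2) by (simp add: hubsize del: upt_Suc)
  from run_pass_cmd[OF lists_emission F this]
  have "outputs m5 ((([?p + length ?gs * N, length (instance_edges r ?p ?gs)] @
      encode_edges (instance_edges r ?p ?gs)) @ concat (map (\<lambda>_. map (\<lambda>_. 1) [1..<Suc q]) [0..<?p])) @
      blocks N listsY ?p ?gs)"
    unfolding m5_def using f1[of INP] f1[of PAR] f2[of INP] f2[of POW] f2[of PAR] f3[of INP] f3[of POW] f3[of PAR]
      f4[of INP] f4[of POW] f4[of PAR] pow m by auto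
  then have "outputs m6 (((([?p + length ?gs * N, length (instance_edges r ?p ?gs)] @
      encode_edges (instance_edges r ?p ?gs)) @ concat (map (\<lambda>_. map (\<lambda>_. 1) [1..<Suc q]) [0..<?p])) @
      blocks N listsY ?p ?gs) @ map (\<lambda>e. eval e m5) [hubsizeE])"
    unfolding m6_def by (rule outputs_emits) (use r in auto)
  moreover have "eval hubsizeE m5 = ?p"
    using f1[of PAR] f2[of PAR] f3[of PAR] f4[of PAR] f5[of PAR] m(2) by (intro hubsize) simp
  ultimately have "outputs m6 (((([?p + length ?gs * N, length (instance_edges r ?p ?gs)] @
      encode_edges (instance_edges r ?p ?gs)) @ concat (map (\<lambda>_. map (\<lambda>_. 1) [1..<Suc q]) [0..<?p])) @
      blocks N listsY ?p ?gs) @ [?p])" by (simp del: upt_Suc)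
  from run_For_emits[OF this, of "[Get CTR (Const 0)]" "\<lambda>i. [i]" hubsizeE]
  have "outputs m7 ((((([?p + length ?gs * N, length (instance_edges r ?p ?gs)] @
      encode_edges (instance_edges r ?p ?gs)) @ concat (map (\<lambda>_. map (\<lambda>_. 1) [1..<Suc q]) [0..<?p])) @
      blocks N listsY ?p ?gs) @ [?p]) @ [0..<?p])"
    unfolding m7_def using f1[of PAR] f2[of PAR] f3[of PAR] f4[of PAR] f5[of PAR] f6[of PAR] m(2)
    by (simp add: hubsize del: upt_Suc)
  moreover have "instance_of n F = (((([?p + length ?gs * N, length (instance_edges r ?p ?gs)] @
      encode_edges (instance_edges r ?p ?gs)) @ concat (map (\<lambda>_. map (\<lambda>_. 1) [1..<Suc q]) [0..<?p])) @
      blocks N listsY ?p ?gs) @ [?p]) @ [0..<?p]"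
    unfolding instance_of_def encode_instance_def instance_lists_blocks by (simp del: upt_Suc)
  ultimately have "outputs m7 (instance_of n F)" by simp
  then show ?thesis
    unfolding run by (auto simp: outputs_def input_memory_def fun_eq_iff nth_Cons split: nat.splits)
qed


section \<open>The complete satisfiability program\<close>

definition params_cmd :: cmd where
  "params_cmd = seqs (map (\<lambda>i. Put PAR (Const i) (Get 0 (Const i))) [0, 1, 2])"

text \<open>The generator must not read bank 0, so the input is moved away. Clearing the cells
  ensures that everything beyond the emitted instance is zero.\<close>

definition copy_cmd :: cmd where
  "copy_cmd = For CTR (Add (Get PAR (Const 0)) (Const 1))
     (Then (Put INP (Get CTR (Const 0)) (Get 0 (Get CTR (Const 0)))) (Put 0 (Get CTR (Const 0)) (Const 0)))"

text \<open>\<open>PAR\<close> is being written here and cannot be the parameter bank yet; the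
  untouched banks \<open>B + 8\<close> and \<open>B + 9\<close> take the two special roles.\<close>

lemma params_cmd_wf: "wf_cmd (B + 8) (B + 9) params_cmd"
  by (auto simp: params_cmd_def intro!: tameI[of _ 0 0])

lemma copy_cmd_wf: "wf_cmd PAR (B + 9) copy_cmd"
proof -
  have "tame PAR (B + 9) (Get 0 (Get CTR (Const 0)))" by (rule tameI[of _ 0 0]) auto
  moreover have "tame PAR (B + 9) (Const 0)" by (rule tame_params) simp
  ultimately show ?thesis by (simp add: copy_cmd_def)
qed

lemma pass_cmd_wf:
  assumes "emission X Y"
  shows "wf_cmd PAR 0 (pass_cmd X)"
proof -
  have emits: "wf_cmd PAR 0 (emits (X b a))" for b a
    using assms by (intro emits_wf) (auto simp: emission_def)
  have "0 \<notin> reads (satE a)" for a using clause_reads(1)[of a] by auto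
  moreover have "tame PAR 0 (vertexE N)" by (rule tameI[of _ VTX N]) (auto simp: vertexE_def)
  ultimately have gadget: "wf_cmd PAR 0 (gadget_cmd X a)" for a
    using emits by (simp add: gadget_cmd_def clause_reads)
  have "tame PAR 0 (Add (Get CLP (Const 0)) (Add (Const 1)
      (Mul (Const 2) (Sub (clauseE 0) (Sub (clauseE 0) (Const \<kappa>))))))"
    by (rule tameI[of _ CLP "1 + 2 * \<kappa>"]) (auto intro!: exI[of _ 0])
  then have "wf_cmd PAR 0 (clause_cmd X)"
    using gadget by (simp add: clause_cmd_def clauseE_def)
  moreover have "tame PAR 0 hubsizeE" "tame PAR 0 (Const 3)"
    by (auto intro!: tame_params simp: hubsizeE_def)
  moreover have "CTR \<notin> writes (clause_cmd X)" using clause_cmd_writes by fastforce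
  ultimately show ?thesis by (simp add: pass_cmd_def hubsizeE_def)
qed

lemma generate_cmd_wf: "wf_cmd PAR 0 generate_cmd"
proof -
  have "CTR \<notin> writes (emits es)" for es using emits_writes by fastforce
  then show ?thesis
    by (auto simp: generate_cmd_def table_cmd_def hubsizeE_def vertex_countE_def edge_countE_def
        intro!: emits_wf pass_cmd_wf[OF edges_emission] pass_cmd_wf[OF lists_emission] tame_params)
qed

lemma params_cmd_writes: "writes params_cmd = {PAR}"
  by (simp add: params_cmd_def)

lemma copy_cmd_writes: "writes copy_cmd = {CTR, INP, 0}"
  by (auto simp: copy_cmd_def)

lemma generate_cmd_writes: "writes generate_cmd \<subseteq> {0, OUT, VTX, CLP, CTR, POW}"
  using table_cmd_writes emits_writes pass_cmd_writes by (fastforce simp: generate_cmd_def)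

lemma run_params_cmd: "i < 3 \<Longrightarrow> run params_cmd m PAR i = m 0 i"
  by (auto simp: params_cmd_def numeral_3_eq_3 less_Suc_eq)

lemma run_copy_cmd:
  assumes "m 0 = input_memory xs 0" "m PAR 0 = length xs" "m INP = (\<lambda>_. 0)"
  shows "run copy_cmd m INP = input_memory xs 0" "run copy_cmd m 0 = (\<lambda>_. 0)"
proof -
  let ?in = "input_memory xs 0"
  let ?body = "Then (Put INP (Get CTR (Const 0)) (Get 0 (Get CTR (Const 0)))) (Put 0 (Get CTR (Const 0)) (Const 0))"
  define I where "I i m' \<longleftrightarrow> m' INP = (\<lambda>j. if j < i then ?in j else 0) \<and>
      m' 0 = (\<lambda>j. if j < i then 0 else ?in j)" for i and m' :: memory
  have "I (eval (Add (Get PAR (Const 0)) (Const 1)) m) (run (For CTR (Add (Get PAR (Const 0)) (Const 1)) ?body) m)"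
  proof (rule run_For_invariant)
    show "I 0 (upd CTR 0 0 m)" using assms by (simp add: I_def)
    fix i m' assume "I i m'" "m' CTR 0 = i"
    then show "I (Suc i) (upd CTR 0 (Suc i) (run ?body m'))"
      by (auto simp: I_def fun_eq_iff less_Suc_eq)
  qed simp
  then have "I (Suc (length xs)) (run copy_cmd m)" using assms(2) by (simp add: copy_cmd_def)
  then show "run copy_cmd m INP = input_memory xs 0" "run copy_cmd m 0 = (\<lambda>_. 0)"
    by (auto simp: I_def input_memory_def fun_eq_iff)
qed

text \<open>
  The output of the deletion algorithm lists both endpoints of every edge, whence the factor 2.
\<close>

definition budget :: nat where
  "budget = length tuples * (2 * (r * (r - 1)))"

text \<open>By truncated subtraction this is 1 if the length of the output is at most the threshold,
  and 0 otherwise.\<close>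

definition answerE :: expr where
  "answerE = Sub (Const 1) (Sub (Get 0 (Const 0)) (Mul (Get PAR (Const 2)) (Const budget)))"

text \<open>The answer is stored before cell 0 is overwritten, because \<open>answerE\<close> reads
  the length of the output there. The number of clauses in \<open>PAR\<close> survives
  \<open>P\<close>, which stays within the banks up to \<open>B\<close>.\<close>

definition sat_program :: "program \<Rightarrow> program" where
  "sat_program P = Seq (compile params_cmd) (Seq (compile copy_cmd) (Seq (compile generate_cmd)
     (Seq P (Seq (Store 0 (Const 1) answerE) (Store 0 (Const 0) (Const 1))))))"

lemma exec_generate:
  "\<exists>h. poly_bounded h \<and> (\<forall>k n F M. kCNF k n F \<longrightarrow> k \<le> \<kappa> \<longrightarrow>
     (\<forall>b i. input_memory (encode_CNF n F) b i \<le> M) \<longrightarrow>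
     (\<exists>t1 t2 t3 m1 m2 m. t1 + t2 + t3 \<le> h M \<and>
        exec (compile params_cmd) (input_memory (encode_CNF n F)) t1 m1 \<and>
        exec (compile copy_cmd) m1 t2 m2 \<and> exec (compile generate_cmd) m2 t3 m \<and>
        (\<forall>b \<in> {..B}. m b = input_memory (instance_of n F) b) \<and> m PAR 2 = length F))"
proof -
  obtain g1 h1 where 1: "poly_bounded g1" "poly_bounded h1"
    "runs_within (B + 8) (B + 9) (compile params_cmd) (run params_cmd) g1 h1"
    using exec_compile[OF params_cmd_wf] by auto
  obtain g2 h2 where 2: "poly_bounded g2" "poly_bounded h2"
    "runs_within PAR (B + 9) (compile copy_cmd) (run copy_cmd) g2 h2"
    using exec_compile[OF copy_cmd_wf] by auto
  obtain g3 h3 where 3: "poly_bounded g3" "poly_bounded h3"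
    "runs_within PAR 0 (compile generate_cmd) (run generate_cmd) g3 h3"
    using exec_compile[OF generate_cmd_wf] by auto
  define M1 where "M1 M = M + g1 M" for M
  define M2 where "M2 M = M1 M + g2 (M1 M)" for M
  have pb: "poly_bounded M1" "poly_bounded M2"
    unfolding M2_def[abs_def] M1_def[abs_def]
    by (intro poly_bounded_intros poly_bounded_compose[OF 2(1)] 1(1))+
  show ?thesis
  proof (intro exI[of _ "\<lambda>M. h1 M + h2 (M1 M) + h3 (M2 M)"] conjI allI impI)
    show "poly_bounded (\<lambda>M. h1 M + h2 (M1 M) + h3 (M2 M))"
      by (intro poly_bounded_intros poly_bounded_compose[OF 2(2)] poly_bounded_compose[OF 3(2)] 1(2) pb)
    fix k n F M
    assume F: "kCNF k n F" "k \<le> \<kappa>" and M: "\<forall>b i. input_memory (encode_CNF n F) b i \<le> M"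
    define m0 where "m0 = input_memory (encode_CNF n F)"
    define m1 where "m1 = run params_cmd m0"
    define m2 where "m2 = run copy_cmd m1"
    define m where "m = run generate_cmd m2"
    obtain t1 where t1: "t1 \<le> h1 M" "exec (compile params_cmd) m0 t1 m1"
      and b1: "\<forall>b i. b \<noteq> B + 9 \<longrightarrow> m1 b i \<le> M1 M"
      using runs_withinD[OF 1(3), of m0 M M] M unfolding m0_def[symmetric] m1_def M1_def by blast
    obtain t2 where t2: "t2 \<le> h2 (M1 M)" "exec (compile copy_cmd) m1 t2 m2"
      and b2: "\<forall>b i. b \<noteq> B + 9 \<longrightarrow> m2 b i \<le> M2 M"
      using runs_withinD[OF 2(3), of m1 "M1 M" "M1 M"] b1 unfolding m2_def M2_def by auto
    have z0: "m0 b = (\<lambda>_. 0)" if "b \<noteq> 0" for b using that by (auto simp: m0_def input_memory_def)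
    have fr1: "m1 b = m0 b" if "b \<noteq> PAR" for b
      unfolding m1_def using that by (intro run_frame) (simp add: params_cmd_writes)
    have fr2: "m2 b = m1 b" if "b \<notin> {CTR, INP, 0}" for b
      unfolding m2_def using that by (intro run_frame) (simp add: copy_cmd_writes)
    \<comment> \<open>The bounds of the first two stages exempt bank \<open>B + 9\<close>. It is
      still zero, and the generator, which exempts bank 0 instead, requires a bound for it.\<close>
    have "m2 (B + 9) i \<le> M2 M" for i using fr1[of "B + 9"] fr2[of "B + 9"] z0 by simp
    with b2 have b2': "\<forall>b i. m2 b i \<le> M2 M" by metis
    obtain t3 where t3: "t3 \<le> h3 (M2 M)" "exec (compile generate_cmd) m2 t3 m"
      using runs_withinD[OF 3(3), of m2 "M2 M" "M2 M"] b2' unfolding m_def by blast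
    have len: "length (encode_CNF n F) \<ge> 2" by (simp add: encode_CNF_def)
    have par: "m1 PAR 0 = length (encode_CNF n F)" "m1 PAR 1 = n" "m1 PAR 2 = length F"
      unfolding m1_def using len by (auto simp: run_params_cmd m0_def input_memory_def encode_CNF_def)
    have "m2 INP = m0 0" "m2 0 = (\<lambda>_. 0)"
      using run_copy_cmd[of m1 "encode_CNF n F"] fr1[of 0] fr1[of INP] z0[of INP] par(1)
      by (simp_all add: m2_def m0_def)
    then have m_0: "m 0 = input_memory (instance_of n F) 0"
      unfolding m_def using fr2[of PAR] par by (intro run_generate_cmd[OF F]) (simp_all add: m0_def)
    have fr3: "m b = m2 b" if "b \<notin> {0, OUT, VTX, CLP, CTR, POW}" for b
      unfolding m_def using that generate_cmd_writes by (intro run_frame) blast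
    have "m b = input_memory (instance_of n F) b" if "b \<le> B" for b
    proof (cases "b = 0")
      case False
      then have "m b = m0 b" using that fr1[of b] fr2[of b] fr3[of b] by simp
      then show ?thesis using z0 False by (auto simp: input_memory_def)
    qed (simp add: m_0)
    moreover have "m PAR 2 = length F" using fr2[of PAR] fr3[of PAR] par by simp
    moreover have "t1 + t2 + t3 \<le> h1 M + h2 (M1 M) + h3 (M2 M)" using t1 t2 t3 by simp
    ultimately show "\<exists>t1 t2 t3 m1 m2 m. t1 + t2 + t3 \<le> h1 M + h2 (M1 M) + h3 (M2 M) \<and>
        exec (compile params_cmd) (input_memory (encode_CNF n F)) t1 m1 \<and>
        exec (compile copy_cmd) m1 t2 m2 \<and> exec (compile generate_cmd) m2 t3 m \<and>
        (\<forall>b \<in> {..B}. m b = input_memory (instance_of n F) b) \<and> m PAR 2 = length F"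
      using t1(2) t2(2) t3(2) unfolding m0_def[symmetric] by blast
  qed
qed

lemma sat_program_correct:
  assumes P: "banks P \<subseteq> {..B}"
  shows "\<exists>h. poly_bounded h \<and> (\<forall>k n F M tP X xs. kCNF k n F \<longrightarrow> k \<le> \<kappa> \<longrightarrow>
     (\<forall>b i. input_memory (encode_CNF n F) b i \<le> M) \<longrightarrow> length F \<le> M \<longrightarrow>
     computes P (instance_of n F) tP (encode_edges xs) \<longrightarrow>
     min_deletion_set {..<hub_size n + length (gadgets F) * N} (edge_set (instance_edges r (hub_size n) (gadgets F)))
       (instance_lists q r (hub_size n) (gadgets F)) X \<longrightarrow> edge_listing xs X \<longrightarrow>
     (\<exists>t \<le> h M + tP. computes (sat_program P) (encode_CNF n F) t [of_bool (satisfiable F)]))"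
proof -
  obtain h where h: "poly_bounded h" and gen: "\<And>k n F M. \<lbrakk>kCNF k n F; k \<le> \<kappa>;
     \<forall>b i. input_memory (encode_CNF n F) b i \<le> M\<rbrakk> \<Longrightarrow>
     \<exists>t1 t2 t3 m1 m2 m. t1 + t2 + t3 \<le> h M \<and>
        exec (compile params_cmd) (input_memory (encode_CNF n F)) t1 m1 \<and>
        exec (compile copy_cmd) m1 t2 m2 \<and> exec (compile generate_cmd) m2 t3 m \<and>
        (\<forall>b \<in> {..B}. m b = input_memory (instance_of n F) b) \<and> m PAR 2 = length F"
    using exec_generate by metis
  define D where "D = length tuples * gadget_edge_count"
  \<comment> \<open>\<open>M * D\<close> bounds the number of edges and thus \<open>card X\<close>,
    which occurs doubled in two words of \<open>answerE\<close>. The other summands bound the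
    remaining words of the final stores.\<close>
  define H where "H M = h M + (4 * (M * D) + M + budget + M * budget + 40)" for M
  show ?thesis
  proof (intro exI[of _ H] conjI allI impI)
    show "poly_bounded H" unfolding H_def[abs_def] by (intro poly_bounded_intros h)
    fix k n F M tP X xs
    assume F: "kCNF k n F" "k \<le> \<kappa>" and M: "\<forall>b i. input_memory (encode_CNF n F) b i \<le> M" "length F \<le> M"
      and comp: "computes P (instance_of n F) tP (encode_edges xs)"
      and X: "min_deletion_set {..<hub_size n + length (gadgets F) * N}
         (edge_set (instance_edges r (hub_size n) (gadgets F)))
         (instance_lists q r (hub_size n) (gadgets F)) X" "edge_listing xs X"
    interpret gi: gadget_instance q r "hub_size n" "gadgets F" by (rule gadget_instance[OF F(1)])
    have F': "kCNF \<kappa> n F" using F unfolding kCNF_def by (meson order.trans)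
    obtain t1 t2 t3 m1 m2 m where ex: "t1 + t2 + t3 \<le> h M"
        "exec (compile params_cmd) (input_memory (encode_CNF n F)) t1 m1"
        "exec (compile copy_cmd) m1 t2 m2" "exec (compile generate_cmd) m2 t3 m"
      and m: "\<forall>b \<in> {..B}. m b = input_memory (instance_of n F) b" "m PAR 2 = length F"
      using gen[OF F M(1)] by blast
    obtain s' where s': "exec P (input_memory (instance_of n F)) tP s'" "output_of s' = encode_edges xs"
      using comp by (auto simp: computes_def)
    obtain m' where m': "exec P m tP m'" "\<forall>b \<in> {..B}. m' b = s' b" "\<forall>b. b \<notin> {..B} \<longrightarrow> m' b = m b"
      using exec_banks[OF s'(1) P m(1)] by blast
    have card: "card X = length xs"
      using X(2) distinct_card[of "map (\<lambda>(u, v). {u, v}) xs"] by (simp add: edge_listing_def)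
    have "s' 0 0 = length (output_of s')" by (simp add: output_of_def)
    then have out: "m' 0 0 = 2 * card X" using m'(2) s'(2) card by (simp add: length_encode_edges)
    have par: "m' PAR 2 = length F" using m'(3) m(2) by simp
    define m4 where "m4 = m'(0 := (m' 0)(1 := eval answerE m'))"
    define m5 where "m5 = m4(0 := (m4 0)(0 := 1))"
    have "exec (Store 0 (Const 1) answerE) m' (1 + word_cost 1 + expr_cost answerE m') m4"
      using exec.Store[of 0 "Const 1" answerE m'] by (simp add: m4_def)
    moreover have "exec (Store 0 (Const 0) (Const 1)) m4 (1 + word_cost 0 + word_cost 1) m5"
      using exec.Store[of 0 "Const 0" "Const 1" m4] by (simp add: m5_def)
    ultimately have "exec (Seq (Store 0 (Const 1) answerE) (Store 0 (Const 0) (Const 1))) m'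
        ((1 + word_cost 1 + expr_cost answerE m') + (1 + word_cost 0 + word_cost 1)) m5"
      by (rule exec.Seq)
    then have "exec (sat_program P) (input_memory (encode_CNF n F))
        (t1 + (t2 + (t3 + (tP + ((1 + word_cost 1 + expr_cost answerE m') + (1 + word_cost 0 + word_cost 1)))))) m5"
      unfolding sat_program_def
      by (intro exec.Seq[OF ex(2)] exec.Seq[OF ex(3)] exec.Seq[OF ex(4)] exec.Seq[OF m'(1)])
    moreover have "output_of m5 = [of_bool (satisfiable F)]"
    proof -
      have "eval answerE m' = 1 - (2 * card X - length F * budget)"
        by (simp add: answerE_def out par)
      also have "\<dots> = of_bool (card X \<le> length (gadgets F) * (r * (r - 1)))"
        by (simp add: budget_def length_gadgets mult.assoc)
      also have "\<dots> = of_bool (satisfiable F)"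
        using gi.min_deletion_set_le_iff[OF X(1)] satisfiable_iff_colorable[OF F'] by simp
      finally show ?thesis by (simp add: output_of_def m5_def m4_def)
    qed
    moreover have "t1 + (t2 + (t3 + (tP + ((1 + word_cost 1 + expr_cost answerE m') + (1 + word_cost 0 + word_cost 1)))))
        \<le> H M + tP"
    proof -
      have "X \<subseteq> edge_set (instance_edges r (hub_size n) (gadgets F))"
        using X(1) by (auto simp: min_deletion_set_def deletion_set_def)
      then have "card X \<le> card (edge_set (instance_edges r (hub_size n) (gadgets F)))"
        by (intro card_mono) (simp_all add: edge_set_def)
      also have "\<dots> \<le> length (instance_edges r (hub_size n) (gadgets F))"
        unfolding edge_set_def by (metis card_length length_map)
      also have "\<dots> = length F * D" by (simp add: length_instance_edges length_gadgets D_def)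
      also have "\<dots> \<le> M * D" using M(2) by (rule mult_le_mono1)
      finally have X_le: "card X \<le> M * D" .
      have F_le: "length F * budget \<le> M * budget" using M(2) by (rule mult_le_mono1)
      have "expr_cost answerE m' = word_cost 1 + (word_cost 0 + word_cost (2 * card X) +
          (word_cost 2 + word_cost (length F) + word_cost budget + word_cost (length F * budget)) +
          word_cost (2 * card X - length F * budget)) + word_cost (1 - (2 * card X - length F * budget))"
        by (simp add: answerE_def out par)
      also have "\<dots> \<le> 2 + (1 + (2 * card X + 1) + (3 + (length F + 1) + (budget + 1) + (length F * budget + 1)) +
          (2 * card X - length F * budget + 1)) + 2"
        using word_cost_le[of 1] word_cost_le[of 0] word_cost_le[of "1 - (2 * card X - length F * budget)"]
          word_cost_le[of 2]
        by (intro add_mono word_cost_le) auto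
      also have "\<dots> \<le> 4 * (M * D) + M + budget + M * budget + 20"
        using X_le F_le M(2) by linarith
      finally show ?thesis using ex(1) word_cost_le[of 0] word_cost_le[of 1] unfolding H_def by linarith
    qed
    ultimately show "\<exists>t \<le> H M + tP. computes (sat_program P) (encode_CNF n F) t [of_bool (satisfiable F)]"
      unfolding computes_def by blast
  qed
qed

end


section \<open>Running time\<close>

text \<open>The clauses are distinct lists of at most \<open>k\<close> of the \<open>2 * n\<close>
  literals. The added 1 keeps the base positive, so that all powers are bounded by the
  \<open>k\<close>-th.\<close>

lemma kCNF_length_le:
  assumes "kCNF k n F"
  shows "length F \<le> (k + 1) * (2 * n + 1) ^ k"
proof -
  let ?A = "{..<n} \<times> (UNIV :: bool set)"
  have "set C \<subseteq> ?A \<and> length C \<le> k" if "C \<in> set F" for C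
    using assms that by (auto simp: kCNF_def)
  then have "set F \<subseteq> {C. set C \<subseteq> ?A \<and> length C \<le> k}" by auto
  then have "card (set F) \<le> card {C. set C \<subseteq> ?A \<and> length C \<le> k}"
    by (intro card_mono finite_lists_length_le) auto
  also have "\<dots> = (\<Sum>i\<le>k. card ?A ^ i)" by (rule card_lists_length_le) simp
  also have "\<dots> \<le> (\<Sum>i\<le>k. (2 * n + 1) ^ k)"
  proof (rule sum_mono)
    fix i assume "i \<in> {..k}"
    have "card ?A ^ i \<le> (2 * n + 1) ^ i" by (intro power_mono) (auto simp: card_cartesian_product)
    also have "\<dots> \<le> (2 * n + 1) ^ k" using \<open>i \<in> {..k}\<close> by (intro power_increasing) auto
    finally show "card ?A ^ i \<le> (2 * n + 1) ^ k" .
  qed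
  finally show ?thesis using assms by (simp add: kCNF_def distinct_card)
qed

lemma input_memory_le:
  assumes F: "kCNF k n F"
  shows "input_memory (encode_CNF n F) b i \<le> n + k + 3 + length F * (2 * k + 2)"
proof -
  let ?xs = "encode_CNF n F"
  have "length (concat (map encode_clause G)) \<le> length G * (1 + 2 * k)" if "set G \<subseteq> set F" for G
    using that
  proof (induction G)
    case (Cons C G)
    then have "length C \<le> k" using F by (auto simp: kCNF_def)
    then show ?case using Cons by (simp add: length_encode_clause)
  qed simp
  from this[of F] have len: "length ?xs \<le> 2 + length F * (2 * k + 2)" by (simp add: encode_CNF_def)
  have "x \<le> n + k + 1 + length F" if "x \<in> set ?xs" for x
  proof -
    have "x \<le> n + k + 1" if C: "C \<in> set F" and x: "x \<in> set (encode_clause C)" for C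
    proof -
      have "length C \<le> k" "\<forall>(y, b) \<in> set C. y < n" using F C by (auto simp: kCNF_def)
      then show ?thesis using x by (fastforce simp: encode_clause_def)
    qed
    then show ?thesis using that by (fastforce simp: encode_CNF_def)
  qed
  then have "x \<le> n + k + 3 + length F * (2 * k + 2)" if "x \<in> set (length ?xs # ?xs)" for x
    using that len by fastforce
  moreover have "(length ?xs # ?xs) ! i \<in> set (length ?xs # ?xs)" if "i \<le> length ?xs"
    using that by (intro nth_mem) simp
  ultimately show ?thesis unfolding input_memory_def by auto
qed

context reduction
begin

text \<open>Up to one block the hub has \<open>s * (n div t)\<close> vertices, so
  \<open>\<beta> ^ s \<le> \<gamma> ^ t\<close> turns the exponential factor into
  \<open>\<gamma> ^ n\<close>. All else is polynomial in \<open>n\<close>, as the number of clauses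
  is for fixed \<open>k\<close>.\<close>

lemma solves_kSAT_sat_program:
  fixes base \<beta> \<gamma> :: real
  assumes P: "banks P \<subseteq> {..B}" and k: "k \<le> \<kappa>"
    and LED: "solves_LED P q N r base"
    and base: "0 \<le> base" "base \<le> \<beta>" "1 \<le> \<beta>" and \<gamma>: "1 \<le> \<gamma>" "\<beta> ^ s \<le> \<gamma> ^ t"
  shows "solves_kSAT (sat_program P) k \<gamma>"
proof -
  obtain K d :: nat where LED': "\<forall>n E es L Q hs.
      simple_graph {..<n} E \<and> edge_listing es E \<and> (\<forall>v < n. L v \<subseteq> {1..q}) \<and>
      hub N r {..<n} E Q \<and> distinct hs \<and> set hs = Q \<longrightarrow>
      (\<exists>t ys. computes P (encode_instance q n es L hs) t ys \<and>
         real t \<le> base ^ card Q * (real K * real (n + 1) ^ d) \<and>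
         ((\<exists>X. deletion_set {..<n} E L X) \<longrightarrow>
          (\<exists>X xs. min_deletion_set {..<n} E L X \<and> edge_listing xs X \<and> ys = encode_edges xs)))"
    using LED unfolding solves_LED_def by (elim exE)
  obtain h where h: "poly_bounded h" and correct: "\<forall>k n F M tP X xs. kCNF k n F \<longrightarrow> k \<le> \<kappa> \<longrightarrow>
     (\<forall>b i. input_memory (encode_CNF n F) b i \<le> M) \<longrightarrow> length F \<le> M \<longrightarrow>
     computes P (instance_of n F) tP (encode_edges xs) \<longrightarrow>
     min_deletion_set {..<hub_size n + length (gadgets F) * N} (edge_set (instance_edges r (hub_size n) (gadgets F)))
       (instance_lists q r (hub_size n) (gadgets F)) X \<longrightarrow> edge_listing xs X \<longrightarrow>
     (\<exists>t \<le> h M + tP. computes (sat_program P) (encode_CNF n F) t [of_bool (satisfiable F)])"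
    using sat_program_correct[OF P] by (elim exE conjE)
  define c where "c n = (k + 1) * (2 * n + 1) ^ k" for n
  define M where "M n = n + k + 3 + c n * (2 * k + 2)" for n
  define V where "V n = s * (n + 1) + c n * (length tuples * N) + 1" for n
  \<comment> \<open>The factor \<open>\<beta> ^ s\<close> is the price of the additional block in
    \<open>hub_size\<close>.\<close>
  define A where "A = nat \<lceil>\<beta> ^ s\<rceil> * K"
  define T where "T n = h (M n) + A * V n ^ d" for n
  have pc: "poly_bounded c" unfolding c_def[abs_def] by (intro poly_bounded_intros)
  have "poly_bounded M" unfolding M_def[abs_def] by (intro poly_bounded_intros pc)
  then have "poly_bounded T" unfolding T_def[abs_def] V_def
    by (intro poly_bounded_intros poly_bounded_compose[OF h] pc)
  then obtain K' d' where T: "\<And>n. T n \<le> K' * (n + 1) ^ d'" by (auto simp: poly_bounded_def)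
  show ?thesis
    unfolding solves_kSAT_def
  proof (rule exI[of _ K'], rule exI[of _ d'], intro allI impI)
    fix n F assume F: "kCNF k n F"
    let ?p = "hub_size n" and ?gs = "gadgets F"
    let ?v = "?p + length ?gs * N"
    interpret gi: gadget_instance q r ?p ?gs by (rule gadget_instance[OF F])
    have "simple_graph {..<?v} (edge_set gi.es) \<and> edge_listing gi.es (edge_set gi.es) \<and>
        (\<forall>u < ?v. gi.L u \<subseteq> {1..q}) \<and> hub N r {..<?v} (edge_set gi.es) {..<?p} \<and>
        distinct [0..<?p] \<and> set [0..<?p] = {..<?p}"
      using gi.simple_graph_instance gi.edge_listing_instance gi.lists_subset gi.hub_instance
      by (intro conjI allI impI) (simp_all only: distinct_upt set_upt atLeast0LessThan)
    from LED'[THEN spec[of _ ?v], THEN spec[of _ "edge_set gi.es"], THEN spec[of _ gi.es], THEN spec[of _ gi.L],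
        THEN spec[of _ "{..<?p}"], THEN spec[of _ "[0..<?p]"], THEN mp, OF this]
    obtain tP X xs where tP: "computes P (instance_of n F) tP (encode_edges xs)"
      "real tP \<le> base ^ ?p * (real K * real (?v + 1) ^ d)"
      and X: "min_deletion_set {..<?v} (edge_set gi.es) gi.L X" "edge_listing xs X"
      using gi.ex_deletion_set unfolding instance_of_def[symmetric] card_lessThan by blast
    have cF: "length F \<le> c n" unfolding c_def by (rule kCNF_length_le[OF F])
    then have "length F * (2 * k + 2) \<le> c n * (2 * k + 2)" by (rule mult_le_mono1)
    then have mem: "\<forall>b i. input_memory (encode_CNF n F) b i \<le> M n"
      using input_memory_le[OF F] unfolding M_def by (meson add_left_mono order.trans)
    have "c n * 1 \<le> c n * (2 * k + 2)" by (rule mult_le_mono2) simp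
    then have "length F \<le> M n" using cF unfolding M_def by linarith
    then obtain t' where t': "t' \<le> h (M n) + tP"
      "computes (sat_program P) (encode_CNF n F) t' [of_bool (satisfiable F)]"
      using correct F k mem tP(1) X by blast
    have "length ?gs * N \<le> c n * (length tuples * N)"
      using mult_le_mono1[OF cF, of "length tuples * N"] by (simp add: length_gadgets mult.assoc)
    moreover have "?p \<le> s * (n + 1)" unfolding hub_size_def by (intro mult_le_mono2) simp
    ultimately have "?v + 1 \<le> V n" unfolding V_def by linarith
    then have v: "real (?v + 1) ^ d \<le> real (V n) ^ d" by (intro power_mono of_nat_mono of_nat_0_le_iff)
    have \<gamma>n: "\<gamma> ^ (t * (n div t)) \<le> \<gamma> ^ n" using \<gamma>(1) by (intro power_increasing) simp_all
    have \<beta>s: "0 \<le> \<beta> ^ s" "\<beta> ^ s \<le> real (nat \<lceil>\<beta> ^ s\<rceil>)"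
      using base real_nat_ceiling_ge[of "\<beta> ^ s"] by auto
    have "base ^ ?p \<le> \<beta> ^ ?p" using base by (intro power_mono)
    also have "\<beta> ^ ?p = (\<beta> ^ s) ^ (n div t) * \<beta> ^ s"
      by (simp add: hub_size_def power_mult power_add)
    also have "\<dots> \<le> (\<gamma> ^ t) ^ (n div t) * \<beta> ^ s"
      by (intro mult_right_mono power_mono \<gamma>(2) \<beta>s(1))
    also have "\<dots> = \<gamma> ^ (t * (n div t)) * \<beta> ^ s" by (simp only: power_mult)
    also have "\<dots> \<le> \<gamma> ^ n * real (nat \<lceil>\<beta> ^ s\<rceil>)"
      using \<gamma>(1) by (intro mult_mono \<gamma>n \<beta>s) simp
    finally have "base ^ ?p \<le> \<gamma> ^ n * real (nat \<lceil>\<beta> ^ s\<rceil>)" .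
    then have "base ^ ?p * (real K * real (?v + 1) ^ d) \<le>
        (\<gamma> ^ n * real (nat \<lceil>\<beta> ^ s\<rceil>)) * (real K * real (V n) ^ d)"
      by (rule mult_mono) (use \<gamma>(1) v in \<open>simp_all add: mult_left_mono\<close>)
    with tP(2) have "real tP \<le> (\<gamma> ^ n * real (nat \<lceil>\<beta> ^ s\<rceil>)) * (real K * real (V n) ^ d)"
      by (rule order.trans)
    also have "\<dots> = \<gamma> ^ n * real (A * V n ^ d)"
      by (simp only: A_def of_nat_mult of_nat_power mult.assoc)
    finally have "real tP \<le> \<gamma> ^ n * real (A * V n ^ d)" .
    moreover have "1 * real (h (M n)) \<le> \<gamma> ^ n * real (h (M n))"
      using \<gamma>(1) by (intro mult_right_mono one_le_power of_nat_0_le_iff)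
    moreover have "real t' \<le> real (h (M n)) + real tP"
      using of_nat_mono[OF t'(1), where 'a = real] by (simp only: of_nat_add)
    ultimately have "real t' \<le> \<gamma> ^ n * real (h (M n)) + \<gamma> ^ n * real (A * V n ^ d)" by linarith
    also have "\<dots> = \<gamma> ^ n * real (T n)" by (simp only: T_def of_nat_add distrib_left)
    also have "\<dots> \<le> \<gamma> ^ n * real (K' * (n + 1) ^ d')"
      using \<gamma>(1) by (intro mult_left_mono of_nat_mono T) simp
    also have "\<dots> = \<gamma> ^ n * (real K' * real (n + 1) ^ d')" by (simp only: of_nat_mult of_nat_power)
    finally show "\<exists>t. computes (sat_program P) (encode_CNF n F) t [of_bool (satisfiable F)] \<and>
        real t \<le> \<gamma> ^ n * (real K' * real (n + 1) ^ d')"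
      using t'(2) by blast
  qed
qed

end

text \<open>Take \<open>s\<close> with \<open>(q / \<beta>) ^ s > 2\<close> and the largest
  \<open>t\<close> with \<open>2 ^ t \<le> q ^ s\<close>. Then
  \<open>2 * \<beta> ^ s < q ^ s < 2 ^ (t + 1)\<close>, so the \<open>t\<close>-th root
  \<open>\<gamma>\<close> of \<open>\<beta> ^ s\<close> is below 2.\<close>

lemma ex_block_parameters:
  fixes \<beta> :: real
  assumes "q \<ge> 2" "1 \<le> \<beta>" "\<beta> < real q"
  shows "\<exists>s t :: nat. \<exists>\<gamma>. s \<ge> 1 \<and> t \<ge> 1 \<and> 2 ^ t \<le> q ^ s \<and> 1 \<le> \<gamma> \<and> \<gamma> < 2 \<and> \<beta> ^ s \<le> \<gamma> ^ t"
proof -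
  have "real q / \<beta> > 1" using assms by simp
  then obtain s where s: "2 < (real q / \<beta>) ^ s" using real_arch_pow by blast
  then have s1: "s \<ge> 1" by (cases s) auto
  have "q ^ s \<ge> 1" using assms(1) by simp
  then obtain t where t: "2 ^ t \<le> q ^ s" "q ^ s < 2 ^ (t + 1)" using ex_power_ivl1[of 2 "q ^ s"] by auto
  have "q ^ 1 \<le> q ^ s" using assms(1) s1 by (intro power_increasing) auto
  then have t1: "t \<ge> 1" using t(2) assms(1) by (cases t) auto
  have "2 * \<beta> ^ s < real q ^ s" using s assms(2) by (simp add: power_divide field_simps)
  also have "\<dots> = real (q ^ s)" by simp
  also have "\<dots> < real (2 ^ (t + 1))" using t(2) by (simp only: of_nat_less_iff)
  finally have less: "\<beta> ^ s < 2 ^ t" by simp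
  define \<gamma> where "\<gamma> = root t (\<beta> ^ s)"
  have pos: "1 \<le> \<beta> ^ s" using assms(2) by simp
  have "\<gamma> ^ t = \<beta> ^ s" unfolding \<gamma>_def using t1 pos by (intro real_root_pow_pos2) auto
  moreover have "1 \<le> \<gamma>" unfolding \<gamma>_def using t1 pos by (simp add: real_root_ge_1_iff)
  moreover have "\<gamma> < 2"
    using less t1 real_root_less_mono[of t "\<beta> ^ s" "2 ^ t"] by (simp add: \<gamma>_def real_root_power_cancel)
  ultimately show ?thesis using s1 t1 t(1) by (metis order.refl)
qed

text \<open>With a single vertex that forms the hub, the time bound is the base times a nonnegative
  number and so at most 0, but every execution takes positive time. This settles the case that
  \<open>\<epsilon>\<close> exceeds \<open>q\<close>.\<close>

lemma not_solves_LED_negative: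
  assumes "base < 0"
  shows "\<not> solves_LED P q \<sigma> \<delta> base"
proof
  assume "solves_LED P q \<sigma> \<delta> base"
  then obtain K d :: nat where LED: "\<forall>n E es L Q hs.
      simple_graph {..<n} E \<and> edge_listing es E \<and> (\<forall>v < n. L v \<subseteq> {1..q}) \<and>
      hub \<sigma> \<delta> {..<n} E Q \<and> distinct hs \<and> set hs = Q \<longrightarrow>
      (\<exists>t ys. computes P (encode_instance q n es L hs) t ys \<and>
         real t \<le> base ^ card Q * (real K * real (n + 1) ^ d) \<and>
         ((\<exists>X. deletion_set {..<n} E L X) \<longrightarrow>
          (\<exists>X xs. min_deletion_set {..<n} E L X \<and> edge_listing xs X \<and> ys = encode_edges xs)))"
    unfolding solves_LED_def by (elim exE)
  have "hub \<sigma> \<delta> {..<1} {} {0 :: nat}"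
    by (simp add: hub_def components_def quotient_def lessThan_Suc)
  then have "simple_graph {..<1 :: nat} {} \<and> edge_listing [] ({} :: nat set set) \<and> (\<forall>v < (1 :: nat). {} \<subseteq> {1..q}) \<and>
      hub \<sigma> \<delta> {..<1} {} {0 :: nat} \<and> distinct [0 :: nat] \<and> set [0 :: nat] = {0}"
    by (auto simp: simple_graph_def edge_listing_def)
  from LED[THEN spec[of _ 1], THEN spec[of _ "{}"], THEN spec[of _ "[]"], THEN spec[of _ "\<lambda>_. {}"],
      THEN spec[of _ "{0}"], THEN spec[of _ "[0]"], THEN mp, OF this]
  obtain t ys where t: "computes P (encode_instance q 1 [] (\<lambda>_. {}) [0]) t ys"
    "real t \<le> base ^ card {0 :: nat} * (real K * real (1 + 1) ^ d)" by blast
  have "base * (real K * real (1 + 1) ^ d) \<le> 0" using assms by (simp add: mult_nonpos_nonneg)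
  then have "t = 0" using t(2) by simp
  moreover obtain m where "exec P (input_memory (encode_instance q 1 [] (\<lambda>_. {}) [0])) t m"
    using t(1) by (auto simp: computes_def)
  ultimately show False using exec_time_pos by blast
qed

theorem theorem2p4:
  fixes q :: nat and \<epsilon> :: real
  assumes "q \<ge> 2" and "\<epsilon> > 0"
  shows "\<exists>\<sigma> \<delta> :: nat. (\<exists>P. solves_LED P q \<sigma> \<delta> (real q - \<epsilon>)) \<longrightarrow> \<not> SETH"
proof (cases "SETH \<and> real q - \<epsilon> \<ge> 0")
  case False
  then show ?thesis using not_solves_LED_negative[of "real q - \<epsilon>"] by (metis not_le)
next
  case True
  \<comment> \<open>For large \<open>\<epsilon>\<close> the base may lie below 1. Raising it to 1
    keeps it below \<open>q\<close> and yields \<open>\<gamma> \<ge> 1\<close>, so that the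
    polynomial part of the running time can be absorbed.\<close>
  define \<beta> where "\<beta> = max 1 (real q - \<epsilon>)"
  have \<beta>: "1 \<le> \<beta>" "\<beta> < real q" "real q - \<epsilon> \<le> \<beta>" using assms by (auto simp: \<beta>_def)
  obtain s t :: nat and \<gamma> where st: "s \<ge> 1" "t \<ge> 1" "2 ^ t \<le> q ^ s"
    and \<gamma>: "1 \<le> \<gamma>" "\<gamma> < 2" "\<beta> ^ s \<le> \<gamma> ^ t"
    using ex_block_parameters[OF assms(1) \<beta>(1,2)] by blast
  obtain dec :: "nat list \<Rightarrow> nat" where dec: "\<And>f :: nat \<Rightarrow> bool. \<exists>w. length w = s \<and> set w \<subseteq> {1..q} \<and>
      (\<forall>i<t. odd (dec w div 2 ^ i) = f i)"
    using ex_block_decoder[OF st(3)] by blast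
  have "\<not> (\<forall>k. \<exists>P. solves_kSAT P k (2 - (2 - \<gamma>)))"
    using True \<gamma>(2) unfolding SETH_def by (metis diff_gt_0_iff_gt)
  then obtain k where k: "\<And>P. \<not> solves_kSAT P k \<gamma>" by auto
  \<comment> \<open>Clauses are padded to \<open>k + 2\<close> literals, so that there are two slots
    even for \<open>k = 0\<close>.\<close>
  define r where "r = (k + 2) * s"
  have "\<not> solves_LED P q (gadget_size r) r (real q - \<epsilon>)" for P
  proof
    assume LED: "solves_LED P q (gadget_size r) r (real q - \<epsilon>)"
    \<comment> \<open>\<open>P\<close> enters only through the offset of the banks;
      \<open>r\<close>, and with it the hub parameters, was fixed before.\<close>
    interpret red: reduction q s t "k + 2" dec "Max (insert 0 (banks P))"
      by unfold_locales (use assms(1) st dec in auto)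
    have "banks P \<subseteq> {..Max (insert 0 (banks P))}" using finite_banks[of P] by auto
    moreover have "r = red.r" unfolding red.r_def r_def by simp
    ultimately have "solves_kSAT (red.sat_program P) k \<gamma>"
      using LED True \<beta> \<gamma> 
      by (intro red.solves_kSAT_sat_program[of P k "real q - \<epsilon>" \<beta>]) simp_all
    with k show False by blast
  qed
  then show ?thesis by blast
qed

end
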